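(* Let $0<\alpha<1$. There exists smooth initial data $\omega_0\in C_0^1(R)$, with support bounded away from the origin, such that the corresponding solution $\omega(x,t)$ of $$\partial_t\omega+u\cdot\nabla\omega=0,\qquad \omega(x,0)=\omega_0(x),$$ $$u(x,t)=\left(-x_1\int_{y_1y_2\ge x_1x_2}\frac{\omega(y,t)}{|y|^{2+\alpha}}\,dy,\; x_2\int_{y_1y_2\ge x_1x_2}\frac{\omega(y,t)}{|y|^{2+\alpha}}\,dy\right)$$ blows up in finite time. Specifically, the maximal existence time $T$ of the solution is finite and $$\lim_{t\to T^-}\int_0^t\|\nabla\omega(\cdot,s)\|_{L^\infty}\,ds=\infty .$$
   Context: $R=\{(x_1,x_2): x_1\ge 0,\ x_2\ge 0\}$ is the closed first quadrant, and $C_0^1(R)=\{f\in C^1(R): \operatorname{supp}(f)\text{ is compact}\}$; note that the support may meet the boundary of $R$. The integrals defining $u$ are over $y=(y_1,y_2)\in R$ with $y_1y_2\ge x_1x_2$. $C(0,T;C_0^1(R))$ denotes functions $\omega(x,t)$ that are continuous in time on $[0,T)$ (initial time included) with values in $C_0^1(R)$, with respect to the $C^1$ norm. A solution is such a function for which $u$ is well defined, satisfying the transport equation on $R$ in the classical sense with initial value $\omega_0$. The maximal existence time is the largest $T$ for which a solution in $C(0,T;C_0^1(R))$ with initial data $\omega_0$ exists. *)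

theory Defs
  imports "HOL-Analysis.Analysis" "HOL-Probability.Essential_Supremum"
begin

definition quadrant :: "(real \<times> real) set" where
  "quadrant = {x. fst x \<ge> 0 \<and> snd x \<ge> 0}"

text \<open>Derivatives are taken relative to the closed quadrant. The quadrant is convex with
  nonempty interior, so these derivatives are unique at every point of it, the boundary
  included. Values of functions outside the quadrant play no role.\<close>

definition gradient :: "(real \<times> real \<Rightarrow> real) \<Rightarrow> real \<times> real \<Rightarrow> real \<times> real" where
  "gradient f x =
     (frechet_derivative f (at x within quadrant) (1, 0),
      frechet_derivative f (at x within quadrant) (0, 1))"

primrec Ck_quadrant :: "nat \<Rightarrow> (real \<times> real \<Rightarrow> real) \<Rightarrow> bool" where
  "Ck_quadrant 0 f \<longleftrightarrow> continuous_on quadrant f"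
| "Ck_quadrant (Suc k) f \<longleftrightarrow>
     f differentiable_on quadrant \<and>
     Ck_quadrant k (\<lambda>x. fst (gradient f x)) \<and> Ck_quadrant k (\<lambda>x. snd (gradient f x))"

definition smooth_quadrant :: "(real \<times> real \<Rightarrow> real) \<Rightarrow> bool" where
  "smooth_quadrant f \<longleftrightarrow> (\<forall>k. Ck_quadrant k f)"

definition supp :: "(real \<times> real \<Rightarrow> real) \<Rightarrow> (real \<times> real) set" where
  "supp f = closure (support_on quadrant f)"

definition C01 :: "(real \<times> real \<Rightarrow> real) set" where
  "C01 = {f. Ck_quadrant 1 f \<and> compact (supp f)}"

text \<open>The suprema are taken in the reals and are meant for functions in \<open>C01\<close> and their
  differences, for which they are suprema of nonempty bounded sets.\<close>

definition C1_norm :: "(real \<times> real \<Rightarrow> real) \<Rightarrow> real" where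
  "C1_norm f = (SUP x\<in>quadrant. \<bar>f x\<bar>) + (SUP x\<in>quadrant. norm (gradient f x))"

definition Linf_norm :: "(real \<times> real \<Rightarrow> real \<times> real) \<Rightarrow> real" where
  "Linf_norm g = real_of_ereal (esssup (restrict_space lborel quadrant) (\<lambda>x. ereal (norm (g x))))"

text \<open>Time-dependent functions are written \<open>\<omega> t x\<close>.\<close>

definition C_time_C01 :: "real \<Rightarrow> (real \<Rightarrow> real \<times> real \<Rightarrow> real) set" where
  "C_time_C01 T = {\<omega>. \<forall>t\<in>{0..<T}. \<omega> t \<in> C01 \<and>
     ((\<lambda>s. C1_norm (\<lambda>x. \<omega> s x - \<omega> t x)) \<longlongrightarrow> 0) (at t within {0..<T})}"

definition hyperbolic_region :: "real \<times> real \<Rightarrow> (real \<times> real) set" where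
  "hyperbolic_region x = {y \<in> quadrant. fst y * snd y \<ge> fst x * snd x}"

definition kernel_integrand :: "real \<Rightarrow> (real \<times> real \<Rightarrow> real) \<Rightarrow> real \<times> real \<Rightarrow> real" where
  "kernel_integrand \<alpha> f y = f y / norm y powr (2 + \<alpha>)"

definition velocity_well_defined :: "real \<Rightarrow> (real \<times> real \<Rightarrow> real) \<Rightarrow> bool" where
  "velocity_well_defined \<alpha> f \<longleftrightarrow>
     (\<forall>x\<in>quadrant. set_integrable lborel (hyperbolic_region x) (kernel_integrand \<alpha> f))"

definition velocity :: "real \<Rightarrow> (real \<times> real \<Rightarrow> real) \<Rightarrow> real \<times> real \<Rightarrow> real \<times> real" where
  "velocity \<alpha> f x =
     (- fst x * (LINT y:hyperbolic_region x|lborel. kernel_integrand \<alpha> f y),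
      snd x * (LINT y:hyperbolic_region x|lborel. kernel_integrand \<alpha> f y))"

text \<open>The time derivative is relative to \<open>[0, T)\<close>, hence one-sided at \<open>t = 0\<close>.\<close>

definition solution ::
    "real \<Rightarrow> (real \<times> real \<Rightarrow> real) \<Rightarrow> real \<Rightarrow> (real \<Rightarrow> real \<times> real \<Rightarrow> real) \<Rightarrow> bool" where
  "solution \<alpha> \<omega>0 T \<omega> \<longleftrightarrow>
     \<omega> \<in> C_time_C01 T \<and>
     (\<forall>t\<in>{0..<T}. velocity_well_defined \<alpha> (\<omega> t)) \<and>
     (\<forall>t\<in>{0..<T}. \<forall>x\<in>quadrant.
        ((\<lambda>s. \<omega> s x) has_real_derivative - (velocity \<alpha> (\<omega> t) x \<bullet> gradient (\<omega> t) x))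
          (at t within {0..<T})) \<and>
     (\<forall>x\<in>quadrant. \<omega> 0 x = \<omega>0 x)"

definition maximal_existence_time :: "real \<Rightarrow> (real \<times> real \<Rightarrow> real) \<Rightarrow> real \<Rightarrow> bool" where
  "maximal_existence_time \<alpha> \<omega>0 T \<longleftrightarrow>
     T > 0 \<and> (\<exists>\<omega>. solution \<alpha> \<omega>0 T \<omega>) \<and> (\<forall>T'. (\<exists>\<omega>. solution \<alpha> \<omega>0 T' \<omega>) \<longrightarrow> T' \<le> T)"

end

theory Submission
  imports Defs "HOL-Computational_Algebra.Polynomial"
begin

text \<open>
  The velocity is tangent to the hyperbolas \<open>x\<^sub>1 x\<^sub>2 = z\<close>, and its stretching rate \<open>\<Omega> z t\<close>
  (the integral over \<open>y\<^sub>1 y\<^sub>2 \<ge> z\<close>) is constant on each of them.  Hence a solution is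
  determined by the accumulated exponent \<open>G z t\<close>, the time integral of \<open>\<Omega> z\<close>:
  \<open>\<omega> t x = \<omega>\<^sub>0 (x\<^sub>1 exp (G z t), x\<^sub>2 exp (- G z t))\<close> with \<open>z = x\<^sub>1 x\<^sub>2\<close>.
  In the coordinates \<open>(y\<^sub>1, w) = (s, y\<^sub>1 y\<^sub>2)\<close> this map only rescales \<open>s\<close>, which leaves
  \<open>ds / s\<close> invariant, so the equation closes up for \<open>G\<close> alone: the time derivative of \<open>G z\<close>
  is the integral over \<open>w \<ge> z\<close> of \<open>flux w (G w t)\<close>
  (\<open>nn_integral_hyperbolic\<close>, \<open>velocity_integral_eq_flux\<close>).

  By the inequality of the means the flux is bounded by a constant times \<open>w powr (- p)\<close>, where
  \<open>p = 1 + \<alpha> / 2\<close>, and it is Lipschitz in the exponent for \<open>w\<close> away from \<open>0\<close>.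
  As \<open>G z\<close> depends only on \<open>G w\<close> for \<open>w \<ge> z\<close>, Picard iteration yields one global solution
  on \<open>z > 0\<close> (\<open>exponent_eq_picard\<close>), unique by the same estimate (\<open>picard_unique\<close>).
  All the difficulty sits in the limit \<open>z \<rightarrow> 0\<close>, and the existence time is exactly the time up
  to which \<open>G\<close> stays bounded there.  Until then \<open>G\<close> extends to \<open>z = 0\<close> as a
  function that is continuously differentiable in \<open>z\<close>, and it produces a solution
  (\<open>vorticity_solution\<close>).
  Conversely, transport along characteristics shows that the exponent of any solution is this
  \<open>G\<close>, so no solution lives longer (\<open>solution_time_le\<close>).

  The existence time is finite because of a cascade over the scales \<open>z = 2 ^ - n\<close>.  The data
  are positive near \<open>(2, 0)\<close>; when \<open>G\<close> at scale \<open>w\<close> is about \<open>ln (1 / w) / 2\<close>, the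
  vorticity on that hyperbola is closest to the origin and the flux is of order
  \<open>w powr (- p)\<close>.  Once \<open>G\<close> has reached this threshold at \<open>2 ^ - n\<close>, monotonicity in \<open>z\<close>
  keeps the next dyadic strip in the regime of large flux until the threshold at
  \<open>2 ^ - Suc n\<close> is reached, which takes a time of order \<open>2 ^ (- n \<alpha> / 2)\<close>.  The times sum to
  a finite value (\<open>front_passes\<close>).

  Finally, a solution vanishes at the origin and takes values in \<open>[0, 1]\<close>, so \<open>\<Omega> 0 t\<close> is at
  most a constant times \<open>1\<close> plus the supremum of the gradient, the kernel being
  integrable against \<open>min (norm y) 1\<close> precisely when \<open>0 < \<alpha> < 1\<close>
  (\<open>kernel_weight_integrable\<close>).  Since \<open>G 0 t\<close> tends to infinity, so does the
  integral of the gradient (\<open>gradient_blowup\<close>).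
\<close>

section \<open>A smooth function that is flat at the origin\<close>

text \<open>The functions \<open>p (1 / x) exp (- 1 / x)\<close>, continued by \<open>0\<close>.  The family contains
  \<open>exp (- 1 / x)\<close> and is closed under differentiation, so that all derivatives exist by induction.\<close>
definition flat_poly :: "real poly \<Rightarrow> real \<Rightarrow> real" where
  "flat_poly p x = (if x \<le> 0 then 0 else poly p (1 / x) * exp (- (1 / x)))"

definition flat_deriv :: "real poly \<Rightarrow> real poly" where
  "flat_deriv p = [:0, 0, 1:] * (p - pderiv p)"

lemma poly_times_exp_minus_tendsto_0:
  fixes p :: "real poly"
  shows "((\<lambda>u. poly p u * exp (- u)) \<longlongrightarrow> 0) at_top"
proof -
  have "((\<lambda>u. \<Sum>i\<le>degree p. coeff p i * (u ^ i / exp u)) \<longlongrightarrow> (\<Sum>i\<le>degree p. coeff p i * 0)) at_top"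
    by (intro tendsto_sum tendsto_mult tendsto_const tendsto_power_div_exp_0)
  moreover have "(\<lambda>u. poly p u * exp (- u)) = (\<lambda>u. \<Sum>i\<le>degree p. coeff p i * (u ^ i / exp u))"
    by (simp add: poly_altdef sum_distrib_right exp_minus divide_inverse mult.assoc)
  ultimately show ?thesis by simp
qed

lemma flat_poly_has_real_derivative:
  "(flat_poly p has_real_derivative flat_poly (flat_deriv p) x) (at x)"
proof -
  consider "x > 0" | "x < 0" | "x = 0" by linarith
  then show ?thesis
  proof cases
    case 1
    have "((\<lambda>x. poly p (1 / x) * exp (- (1 / x))) has_real_derivative flat_poly (flat_deriv p) x) (at x)"
      using 1 by (auto intro!: derivative_eq_intros DERIV_chain'[where g = "poly p"] poly_DERIV
          simp: flat_poly_def flat_deriv_def field_simps power2_eq_square)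
    then show ?thesis
      by (rule has_field_derivative_transform_within_open[of _ _ _ "{0<..}"])
        (use 1 in \<open>auto simp: flat_poly_def\<close>)
  next
    case 2
    have "((\<lambda>x. 0) has_real_derivative flat_poly (flat_deriv p) x) (at x)"
      using 2 by (simp add: flat_poly_def)
    then show ?thesis
      by (rule has_field_derivative_transform_within_open[of _ _ _ "{..<0}"])
        (use 2 in \<open>auto simp: flat_poly_def\<close>)
  next
    case 3
    have "((\<lambda>h. flat_poly p h / h) \<longlongrightarrow> 0) (at_left 0)"
      by (rule tendsto_eventually) (auto simp: eventually_at_filter flat_poly_def)
    moreover have "((\<lambda>h. flat_poly p h / h) \<longlongrightarrow> 0) (at_right 0)"
    proof -
      have "((\<lambda>h. poly (pCons 0 p) (inverse h) * exp (- inverse h)) \<longlongrightarrow> 0) (at_right 0)"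
        by (rule filterlim_compose[OF poly_times_exp_minus_tendsto_0 filterlim_inverse_at_top_right])
      moreover have "\<forall>\<^sub>F h in at_right 0. poly (pCons 0 p) (inverse h) * exp (- inverse h) = flat_poly p h / h"
        by (auto simp: eventually_at_filter flat_poly_def field_simps)
      ultimately show ?thesis by (rule Lim_transform_eventually)
    qed
    ultimately have "((\<lambda>h. flat_poly p h / h) \<longlongrightarrow> 0) (at 0)"
      by (rule filterlim_split_at)
    then show ?thesis
      using 3 by (simp add: DERIV_def flat_poly_def)
  qed
qed

lemma flat_poly_continuous_on: "continuous_on S (flat_poly p)"
  using flat_poly_has_real_derivative
  by (meson DERIV_isCont continuous_at_imp_continuous_on)

abbreviation flat :: "real \<Rightarrow> real" where
  "flat \<equiv> flat_poly 1"

lemma flat_nonneg: "0 \<le> flat x" and flat_le_1: "flat x \<le> 1" and flat_pos: "0 < x \<Longrightarrow> 0 < flat x"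
  and flat_eq_0: "x \<le> 0 \<Longrightarrow> flat x = 0"
  by (auto simp: flat_poly_def)

lemma flat_mono: "x \<le> y \<Longrightarrow> flat x \<le> flat y"
  by (auto simp: flat_poly_def field_simps)

section \<open>Differential calculus on the closed quadrant\<close>

lemma quadrant_approach:
  assumes "x \<in> quadrant" "i \<in> Basis" "e > (0::real)"
  shows "\<exists>d. 0 < \<bar>d\<bar> \<and> \<bar>d\<bar> < e \<and> x + d *\<^sub>R i \<in> quadrant"
  using assms by (intro exI[of _ "e/2"]) (auto simp: quadrant_def Basis_prod_def)

lemma gradient_eqI:
  assumes "(f has_derivative (\<lambda>h. a * fst h + b * snd h)) (at x within quadrant)" "x \<in> quadrant"
  shows "gradient f x = (a, b)"
proof -
  have "f differentiable (at x within quadrant)"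
    using assms(1) by (auto simp: differentiable_def)
  then have "(f has_derivative frechet_derivative f (at x within quadrant)) (at x within quadrant)"
    by (simp add: frechet_derivative_works)
  then have "frechet_derivative f (at x within quadrant) = (\<lambda>h. a * fst h + b * snd h)"
    using frechet_derivative_unique_within[OF _ assms(1)] quadrant_approach[OF assms(2)] by blast
  then show ?thesis by (simp add: gradient_def)
qed

lemma has_derivative_gradient:
  assumes "f differentiable (at x within quadrant)"
  shows "(f has_derivative (\<lambda>h. fst (gradient f x) * fst h + snd (gradient f x) * snd h))
           (at x within quadrant)"
proof -
  let ?D = "frechet_derivative f (at x within quadrant)"
  have D: "(f has_derivative ?D) (at x within quadrant)"
    using assms by (simp add: frechet_derivative_works)
  then have "linear ?D" by (rule has_derivative_linear)
  then interpret linear ?D .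
  have "?D h = fst (gradient f x) * fst h + snd (gradient f x) * snd h" for h
  proof -
    have "?D h = ?D (fst h *\<^sub>R (1, 0) + snd h *\<^sub>R (0, 1))" by simp
    then show ?thesis unfolding add scaleR by (simp add: gradient_def mult.commute)
  qed
  then show ?thesis using D by presburger
qed

lemma gradient_cong:
  assumes "\<And>y. y \<in> quadrant \<Longrightarrow> f y = g y" "x \<in> quadrant"
  shows "gradient f x = gradient g x"
proof -
  have "(f has_derivative L) (at x within quadrant) \<longleftrightarrow> (g has_derivative L) (at x within quadrant)" for L
    using assms has_derivative_transform[of x quadrant f g L] has_derivative_transform[of x quadrant g f L]
    by auto
  then show ?thesis by (simp add: gradient_def frechet_derivative_def)
qed

text \<open>Gradients are unspecified off the quadrant; this congruence makes every later computation
  insensitive to them.\<close>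
lemma Ck_quadrant_cong:
  assumes "\<And>y. y \<in> quadrant \<Longrightarrow> f y = g y"
  shows "Ck_quadrant k f \<longleftrightarrow> Ck_quadrant k g"
  using assms
proof (induction k arbitrary: f g)
  case 0
  then show ?case by (simp cong: continuous_on_cong)
next
  case (Suc k)
  have "f differentiable_on quadrant \<longleftrightarrow> g differentiable_on quadrant"
    using Suc.prems unfolding differentiable_on_def differentiable_def
    by (metis has_derivative_transform)
  moreover have "Ck_quadrant k (\<lambda>x. fst (gradient f x)) \<longleftrightarrow> Ck_quadrant k (\<lambda>x. fst (gradient g x))"
    "Ck_quadrant k (\<lambda>x. snd (gradient f x)) \<longleftrightarrow> Ck_quadrant k (\<lambda>x. snd (gradient g x))"
    using gradient_cong[of f g] Suc.prems by (intro Suc.IH; simp)+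
  ultimately show ?case by simp
qed

lemma Ck_quadrant_SucI:
  assumes "\<And>x. x \<in> quadrant \<Longrightarrow> (f has_derivative (\<lambda>h. a x * fst h + b x * snd h)) (at x within quadrant)"
    and "Ck_quadrant k a" "Ck_quadrant k b"
  shows "Ck_quadrant (Suc k) f"
proof -
  have "f differentiable_on quadrant"
    using assms(1) by (auto simp: differentiable_on_def differentiable_def)
  moreover have "gradient f x = (a x, b x)" if "x \<in> quadrant" for x
    using gradient_eqI assms(1) that by blast
  ultimately show ?thesis
    using assms(2,3) Ck_quadrant_cong[of "\<lambda>x. fst (gradient f x)" a k]
      Ck_quadrant_cong[of "\<lambda>x. snd (gradient f x)" b k] by simp
qed

lemma Ck_quadrant_SucD:
  assumes "Ck_quadrant (Suc k) f" "x \<in> quadrant"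
  shows "(f has_derivative (\<lambda>h. fst (gradient f x) * fst h + snd (gradient f x) * snd h)) (at x within quadrant)"
  using assms by (intro has_derivative_gradient) (auto simp: differentiable_on_def)

lemma Ck_quadrant_continuous_on: "Ck_quadrant k f \<Longrightarrow> continuous_on quadrant f"
  by (cases k) (auto intro: differentiable_imp_continuous_on)

lemma Ck_quadrant_Suc_imp: "Ck_quadrant (Suc k) f \<Longrightarrow> Ck_quadrant k f"
proof (induction k arbitrary: f)
  case 0
  then show ?case using Ck_quadrant_continuous_on by fastforce
next
  case (Suc k)
  then show ?case by (metis Ck_quadrant.simps(2))
qed

lemma Ck_quadrant_const: "Ck_quadrant k (\<lambda>x. c)"
proof (induction k arbitrary: c)
  case (Suc k)
  show ?case
    by (rule Ck_quadrant_SucI[OF _ Suc Suc, of _ 0 0]) (auto intro!: derivative_eq_intros)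
qed simp

lemma Ck_quadrant_add:
  "Ck_quadrant k f \<Longrightarrow> Ck_quadrant k g \<Longrightarrow> Ck_quadrant k (\<lambda>x. f x + g x)"
proof (induction k arbitrary: f g)
  case (Suc k)
  show ?case
    using Suc.prems
    by (intro Ck_quadrant_SucI[OF _ Suc.IH Suc.IH])
      (auto intro!: derivative_eq_intros Ck_quadrant_SucD simp: algebra_simps)
qed (auto intro: continuous_intros)

lemma Ck_quadrant_mult:
  "Ck_quadrant k f \<Longrightarrow> Ck_quadrant k g \<Longrightarrow> Ck_quadrant k (\<lambda>x. f x * g x)"
proof (induction k arbitrary: f g)
  case (Suc k)
  have fg: "Ck_quadrant k f" "Ck_quadrant k g"
    using Suc.prems by (blast intro: Ck_quadrant_Suc_imp)+
  have "((\<lambda>x. f x * g x) has_derivative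
          (\<lambda>h. (f x * fst (gradient g x) + fst (gradient f x) * g x) * fst h
              + (f x * snd (gradient g x) + snd (gradient f x) * g x) * snd h)) (at x within quadrant)"
    if "x \<in> quadrant" for x
    using has_derivative_mult[OF Ck_quadrant_SucD[OF Suc.prems(1) that] Ck_quadrant_SucD[OF Suc.prems(2) that]]
    by (rule has_derivative_eq_rhs) (auto simp: algebra_simps)
  then show ?case
    by (rule Ck_quadrant_SucI) (use Suc fg in \<open>auto intro!: Ck_quadrant_add\<close>)
qed (auto intro: continuous_intros)

lemma Ck_quadrant_flat_poly_affine:
  "Ck_quadrant k (\<lambda>x. flat_poly p (c + a * fst x + b * snd x))"
proof (induction k arbitrary: p)
  case 0
  show ?case
    by (auto intro!: continuous_intros continuous_on_compose2[OF flat_poly_continuous_on[of UNIV]])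
next
  case (Suc k)
  have "((\<lambda>x. flat_poly p (c + a * fst x + b * snd x)) has_derivative
          (\<lambda>h. (flat_poly (flat_deriv p) (c + a * fst x + b * snd x) * a) * fst h
              + (flat_poly (flat_deriv p) (c + a * fst x + b * snd x) * b) * snd h)) (at x within quadrant)" for x
  proof -
    have "((\<lambda>x. c + a * fst x + b * snd x) has_derivative (\<lambda>h. a * fst h + b * snd h)) (at x within quadrant)"
      by (auto intro!: derivative_eq_intros)
    from has_derivative_compose[OF this flat_poly_has_real_derivative[unfolded has_field_derivative_def]]
    show ?thesis by (rule has_derivative_eq_rhs) (auto simp: algebra_simps)
  qed
  then show ?case
    by (rule Ck_quadrant_SucI) (intro Ck_quadrant_mult Suc Ck_quadrant_const)+
qed

lemma quadrant_zero: "0 \<in> quadrant"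
  and quadrant_closed: "closed quadrant"
  and quadrant_convex: "convex quadrant"
proof -
  show "0 \<in> quadrant" by (simp add: quadrant_def)
  have "closed ({x::real \<times> real. 0 \<le> fst x} \<inter> {x. 0 \<le> snd x})"
    by (intro closed_Int closed_Collect_le continuous_intros)
  moreover have "{x::real \<times> real. 0 \<le> fst x} \<inter> {x. 0 \<le> snd x} = quadrant"
    by (auto simp: quadrant_def)
  ultimately show "closed quadrant" by simp
  show "convex quadrant" by (auto simp: quadrant_def convex_def)
qed

lemma quadrant_measurable [measurable]: "quadrant \<in> sets borel"
  using quadrant_closed by (rule borel_closed)

lemma gradient_diff:
  assumes "f differentiable (at x within quadrant)" "g differentiable (at x within quadrant)"
    and "x \<in> quadrant"
  shows "gradient (\<lambda>y. f y - g y) x = gradient f x - gradient g x"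
proof -
  have "((\<lambda>y. f y - g y) has_derivative
          (\<lambda>h. (fst (gradient f x) - fst (gradient g x)) * fst h
              + (snd (gradient f x) - snd (gradient g x)) * snd h)) (at x within quadrant)"
    using has_derivative_diff[OF has_derivative_gradient[OF assms(1)] has_derivative_gradient[OF assms(2)]]
    by (rule has_derivative_eq_rhs) (auto simp: algebra_simps)
  from gradient_eqI[OF this assms(3)] show ?thesis by (simp add: prod_eq_iff)
qed

section \<open>Compactly supported functions of class C1\<close>

lemma C01_differentiable: "f \<in> C01 \<Longrightarrow> x \<in> quadrant \<Longrightarrow> f differentiable (at x within quadrant)"
  by (auto simp: C01_def differentiable_on_def)

lemma C01_continuous_on: "f \<in> C01 \<Longrightarrow> continuous_on quadrant f"
  unfolding C01_def using Ck_quadrant_continuous_on by blast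

lemma C01_gradient_continuous_on:
  assumes "f \<in> C01"
  shows "continuous_on quadrant (gradient f)"
proof -
  have "continuous_on quadrant (\<lambda>x. (fst (gradient f x), snd (gradient f x)))"
    using assms by (intro continuous_on_Pair) (auto simp: C01_def)
  then show ?thesis by simp
qed

lemma eq_0_outside_supp: "x \<in> quadrant \<Longrightarrow> x \<notin> supp f \<Longrightarrow> f x = 0"
  using closure_subset[of "support_on quadrant f"] by (auto simp: supp_def support_on_def)

lemma gradient_eq_0_outside_supp:
  assumes "x \<in> quadrant" "x \<notin> supp f"
  shows "gradient f x = 0"
proof -
  have "open (- supp f)" by (auto simp: supp_def)
  then obtain d where d: "d > 0" "ball x d \<subseteq> - supp f"
    using assms(2) by (metis ComplI openE)
  have "((\<lambda>x. 0) has_derivative (\<lambda>h. 0 * fst h + 0 * snd h)) (at x within quadrant)"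
    by simp
  then have "(f has_derivative (\<lambda>h. 0 * fst h + 0 * snd h)) (at x within quadrant)"
    using d assms(1)
    by (elim has_derivative_transform_within[of _ _ _ _ d])
      (auto simp: eq_0_outside_supp subset_iff dist_commute)
  from gradient_eqI[OF this assms(1)] show ?thesis by (simp add: zero_prod_def)
qed

lemma C01_bounded:
  assumes "f \<in> C01"
  obtains B where "B \<ge> 0" "\<And>x. x \<in> quadrant \<Longrightarrow> \<bar>f x\<bar> \<le> B"
    "\<And>x. x \<in> quadrant \<Longrightarrow> norm (gradient f x) \<le> B"
proof -
  let ?K = "quadrant \<inter> supp f"
  have K: "compact ?K"
    using assms quadrant_closed by (auto simp: C01_def intro: closed_Int_compact)
  have "bounded (f ` ?K)" "bounded (gradient f ` ?K)"
    using C01_continuous_on[OF assms] C01_gradient_continuous_on[OF assms] K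
    by (auto intro!: compact_imp_bounded compact_continuous_image elim: continuous_on_subset)
  then obtain A B where A: "\<And>x. x \<in> ?K \<Longrightarrow> norm (f x) \<le> A" and B: "\<And>x. x \<in> ?K \<Longrightarrow> norm (gradient f x) \<le> B"
    unfolding bounded_iff by blast
  show thesis
  proof (rule that[of "max 0 (max A B)"])
    fix x :: "real \<times> real" assume x: "x \<in> quadrant"
    show "\<bar>f x\<bar> \<le> max 0 (max A B)" "norm (gradient f x) \<le> max 0 (max A B)"
      using A[of x] B[of x] x eq_0_outside_supp[of x f] gradient_eq_0_outside_supp[of x f]
      by (cases "x \<in> supp f"; simp)+
  qed simp
qed

lemma C01_diff:
  assumes "f \<in> C01" "g \<in> C01"
  shows "(\<lambda>x. f x - g x) \<in> C01"
proof -
  have "Ck_quadrant 1 (\<lambda>x. f x + (-1) * g x)"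
    using assms by (intro Ck_quadrant_add Ck_quadrant_mult Ck_quadrant_const) (auto simp: C01_def)
  have "supp (\<lambda>x. f x - g x) \<subseteq> supp f \<union> supp g"
    unfolding supp_def by (subst closure_Un[symmetric], rule closure_mono) (auto simp: support_on_def)
  moreover have "compact (supp f \<union> supp g)"
    using assms by (auto simp: C01_def)
  ultimately have "compact (supp (\<lambda>x. f x - g x))"
    using bounded_subset[of "supp f \<union> supp g" "supp (\<lambda>x. f x - g x)"]
    by (simp add: compact_eq_bounded_closed) (simp add: supp_def)
  with \<open>Ck_quadrant 1 (\<lambda>x. f x + (-1) * g x)\<close> show ?thesis by (simp add: C01_def)
qed

lemma
  assumes "f \<in> C01"
  shows abs_le_C1_norm: "x \<in> quadrant \<Longrightarrow> \<bar>f x\<bar> \<le> C1_norm f"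
    and gradient_le_C1_norm: "x \<in> quadrant \<Longrightarrow> norm (gradient f x) \<le> C1_norm f"
    and gradient_le_SUP: "x \<in> quadrant \<Longrightarrow> norm (gradient f x) \<le> (SUP x\<in>quadrant. norm (gradient f x))"
proof -
  obtain B where "B \<ge> 0" and B: "\<And>x. x \<in> quadrant \<Longrightarrow> \<bar>f x\<bar> \<le> B"
      "\<And>x. x \<in> quadrant \<Longrightarrow> norm (gradient f x) \<le> B"
    by (rule C01_bounded[OF assms]) (rule that)
  have bdd: "bdd_above ((\<lambda>x. \<bar>f x\<bar>) ` quadrant)" "bdd_above ((\<lambda>x. norm (gradient f x)) ` quadrant)"
    by (rule bdd_aboveI2, erule B(1), rule bdd_aboveI2, erule B(2))
  have *: "\<bar>f x\<bar> \<le> (SUP x\<in>quadrant. \<bar>f x\<bar>)" "norm (gradient f x) \<le> (SUP x\<in>quadrant. norm (gradient f x))"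
    if "x \<in> quadrant" for x
    by (rule cSUP_upper[OF that bdd(1)], rule cSUP_upper[OF that bdd(2)])
  have **: "0 \<le> (SUP x\<in>quadrant. \<bar>f x\<bar>)" "0 \<le> (SUP x\<in>quadrant. norm (gradient f x))"
    using order_trans[OF abs_ge_zero *(1)[OF quadrant_zero]] order_trans[OF norm_ge_zero *(2)[OF quadrant_zero]]
    by blast+
  assume x: "x \<in> quadrant"
  show "norm (gradient f x) \<le> (SUP x\<in>quadrant. norm (gradient f x))"
    by (rule *(2)[OF x])
  show "\<bar>f x\<bar> \<le> C1_norm f"
    using *(1)[OF x] **(2) unfolding C1_norm_def by (rule add_increasing2[rotated])
  show "norm (gradient f x) \<le> C1_norm f"
    using *(2)[OF x] **(1) unfolding C1_norm_def by (rule add_increasing[rotated])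
qed

lemma C1_norm_le:
  assumes "\<And>x. x \<in> quadrant \<Longrightarrow> \<bar>f x\<bar> \<le> A" "\<And>x. x \<in> quadrant \<Longrightarrow> norm (gradient f x) \<le> B"
  shows "C1_norm f \<le> A + B"
  unfolding C1_norm_def using assms quadrant_zero
  by (intro add_mono cSUP_least) auto

lemma C1_norm_nonneg: "f \<in> C01 \<Longrightarrow> 0 \<le> C1_norm f"
  using order_trans[OF abs_ge_zero abs_le_C1_norm[OF _ quadrant_zero]] .

lemma abs_diff_le_gradient_bound:
  assumes "f \<in> C01" "\<And>x. x \<in> quadrant \<Longrightarrow> norm (gradient f x) \<le> B"
    and "x \<in> quadrant" "y \<in> quadrant"
  shows "\<bar>f x - f y\<bar> \<le> B * norm (x - y)"
proof -
  have "norm (f x - f y) \<le> B * norm (x - y)"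
  proof (rule differentiable_bound[OF quadrant_convex])
    fix x :: "real \<times> real" assume x: "x \<in> quadrant"
    show "(f has_derivative (\<lambda>h. fst (gradient f x) * fst h + snd (gradient f x) * snd h)) (at x within quadrant)"
      using C01_differentiable[OF assms(1) x] by (rule has_derivative_gradient)
    show "onorm (\<lambda>h. fst (gradient f x) * fst h + snd (gradient f x) * snd h) \<le> B"
    proof (rule onorm_le)
      fix h :: "real \<times> real"
      have "\<bar>gradient f x \<bullet> h\<bar> \<le> norm (gradient f x) * norm h"
        by (rule Cauchy_Schwarz_ineq2)
      also have "\<dots> \<le> B * norm h"
        using assms(2)[OF x] by (simp add: mult_right_mono)
      finally show "norm (fst (gradient f x) * fst h + snd (gradient f x) * snd h) \<le> B * norm h"
        by (simp add: inner_prod_def)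
    qed
  qed (use assms in auto)
  then show ?thesis by simp
qed

text \<open>A gradient value above the essential supremum would, by continuity, be exceeded on a small box
  that has positive measure and lies in the quadrant, even when the point is on the boundary.\<close>
lemma Linf_norm_gradient_eq_SUP:
  assumes "f \<in> C01"
  shows "Linf_norm (gradient f) = (SUP x\<in>quadrant. norm (gradient f x))"
proof -
  let ?M = "restrict_space lborel quadrant" and ?S = "SUP x\<in>quadrant. norm (gradient f x)"
  let ?h = "\<lambda>x. ereal (norm (gradient f x))"
  have "(\<lambda>x. norm (gradient f x)) \<in> borel_measurable (restrict_space borel quadrant)"
    using C01_gradient_continuous_on[OF assms]
    by (intro borel_measurable_continuous_on_restrict continuous_intros)
  then have "(\<lambda>x. norm (gradient f x)) \<in> borel_measurable ?M"
    by (simp cong: measurable_cong_sets add: measurable_cong_sets[OF sets_restrict_space_cong[OF sets_lborel] refl])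
  then have meas: "?h \<in> borel_measurable ?M" by measurable
  have le: "esssup ?M ?h \<le> ereal ?S"
    using meas gradient_le_SUP[OF assms] by (intro esssup_I AE_I2) (auto simp: space_restrict_space)
  have ge: "?h x \<le> esssup ?M ?h" if x: "x \<in> quadrant" for x
  proof (rule ccontr)
    assume "\<not> ?thesis"
    then have "esssup ?M ?h < ?h x" by (simp add: not_le)
    from ereal_dense2[OF this] obtain c where c: "esssup ?M ?h < ereal c" "c < norm (gradient f x)"
      by auto
    have "\<forall>\<^sub>F y in at x within quadrant. c < norm (gradient f y)"
      using C01_gradient_continuous_on[OF assms] x c(2) unfolding continuous_on_def
      using order_tendstoD(1)[OF tendsto_norm] by blast
    then obtain d where d: "d > 0" "\<And>y. y \<in> quadrant \<Longrightarrow> y \<noteq> x \<Longrightarrow> dist y x < d \<Longrightarrow> c < norm (gradient f y)"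
      unfolding eventually_at by blast
    let ?B = "box x (x + (d/2, d/2))"
    have B: "y \<in> quadrant \<and> c < norm (gradient f y)" if "y \<in> ?B" for y
    proof -
      have y: "fst x < fst y" "fst y < fst x + d/2" "snd x < snd y" "snd y < snd x + d/2"
        using that by (auto simp: box_def Basis_prod_def inner_prod_def)
      have "dist y x \<le> \<bar>fst y - fst x\<bar> + \<bar>snd y - snd x\<bar>"
        unfolding dist_norm by (metis fst_diff norm_Pair_le prod.collapse real_norm_def snd_diff)
      then have "dist y x < d" using y by linarith
      moreover have "y \<in> quadrant" "y \<noteq> x" using x y by (auto simp: quadrant_def)
      ultimately show ?thesis using d(2) by blast
    qed
    have "AE y in ?M. ?h y \<le> esssup ?M ?h" by (rule esssup_AE)
    then have "AE y in lborel. y \<in> quadrant \<longrightarrow> ?h y \<le> esssup ?M ?h"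
      by (simp add: AE_restrict_space_iff)
    then have "AE y in lborel. y \<notin> ?B"
    proof eventually_elim
      case (elim y)
      show ?case
      proof
        assume "y \<in> ?B"
        then have "ereal c < ?h y" "?h y \<le> esssup ?M ?h" using B[of y] elim by auto
        then show False using c(1) by (meson less_le_trans order_less_asym)
      qed
    qed
    then have "emeasure lborel ?B = 0"
      by (subst (asm) AE_iff_null_sets[symmetric]) auto
    moreover have "emeasure lborel ?B = ennreal (d/2 * (d/2))"
      using d(1) by (subst emeasure_lborel_box) (auto simp: Basis_prod_def inner_Pair_0 prod.insert_if)
    ultimately show False using d(1) by simp
  qed
  have fin: "\<bar>esssup ?M ?h\<bar> \<noteq> \<infinity>"
    using le ge[OF quadrant_zero] by auto
  then obtain r where r: "esssup ?M ?h = ereal r" by auto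
  have "?S \<le> r" using ge r quadrant_zero by (intro cSUP_least) auto
  moreover have "r \<le> ?S" using le r by simp
  ultimately show ?thesis by (simp add: Linf_norm_def r)
qed

section \<open>The kernel near the origin and near infinity\<close>

lemma nn_integral_indicator_has_integral:
  fixes f :: "real \<Rightarrow> real"
  assumes [measurable]: "f \<in> borel_measurable borel" "S \<in> sets borel"
    and nonneg: "\<And>x. x \<in> S \<Longrightarrow> 0 \<le> f x" and I: "(f has_integral I) S"
  shows "(\<integral>\<^sup>+x. ennreal (indicator S x * f x) \<partial>lborel) = ennreal I"
proof (rule nn_integral_has_integral_lborel)
  have "((\<lambda>x. if x \<in> S then f x else 0) has_integral I) UNIV"
    using I by (simp add: has_integral_restrict_UNIV)
  moreover have "(\<lambda>x. if x \<in> S then f x else 0) = (\<lambda>x. indicator S x * f x)" by auto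
  ultimately show "((\<lambda>x. indicator S x * f x) has_integral I) UNIV" by simp
qed (use nonneg in \<open>auto simp: indicator_def\<close>)

text \<open>A function of class \<open>C01\<close> that vanishes at the origin is at most a multiple of
  \<open>min (norm y) 1\<close>; this is the resulting majorant of the kernel.\<close>
definition kernel_weight :: "real \<Rightarrow> real \<times> real \<Rightarrow> real" where
  "kernel_weight \<alpha> y = indicator quadrant y * (min (norm y) 1 / norm y powr (2 + \<alpha>))"

lemma kernel_weight_nonneg: "0 \<le> kernel_weight \<alpha> y"
  by (simp add: kernel_weight_def)

text \<open>One factor of a product majorant: the first term serves the unit square, the second the rest of
  the quadrant.\<close>
definition axis_weight :: "real \<Rightarrow> real \<Rightarrow> real" where
  "axis_weight \<alpha> r = indicator {0..1} r * r powr (- (1 + \<alpha>) / 2)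
                     + indicator {0..} r * (1 + r) powr (- (1 + \<alpha> / 2))"

lemma axis_weight_measurable [measurable]: "axis_weight \<alpha> \<in> borel_measurable borel"
  unfolding axis_weight_def by measurable

lemma axis_weight_nonneg: "0 \<le> axis_weight \<alpha> r"
  by (simp add: axis_weight_def)

lemma axis_weight_finite:
  assumes "0 < \<alpha>" "\<alpha> < 1"
  shows "(\<integral>\<^sup>+r. ennreal (axis_weight \<alpha> r) \<partial>lborel) < \<infinity>"
proof -
  have 1: "(\<integral>\<^sup>+r. ennreal (indicator {0..1} r * r powr (- (1 + \<alpha>) / 2)) \<partial>lborel)
      = ennreal (1 powr (- (1 + \<alpha>) / 2 + 1) / (- (1 + \<alpha>) / 2 + 1))"
    using assms by (intro nn_integral_indicator_has_integral has_integral_powr_from_0) auto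
  have 2: "(\<integral>\<^sup>+r. ennreal (indicator {1..} r * r powr (- (1 + \<alpha> / 2))) \<partial>lborel)
      = ennreal (- (1 powr (- (1 + \<alpha> / 2) + 1)) / (- (1 + \<alpha> / 2) + 1))"
    using assms by (intro nn_integral_indicator_has_integral has_integral_powr_to_inf) auto
  have "(\<integral>\<^sup>+r. ennreal (indicator {1..} r * r powr (- (1 + \<alpha> / 2))) \<partial>lborel)
      = (\<integral>\<^sup>+r. ennreal (indicator {1..} (1 + r) * (1 + r) powr (- (1 + \<alpha> / 2))) \<partial>lborel)"
    by (subst nn_integral_real_affine[where c = 1 and t = 1]) auto
  also have "\<dots> = (\<integral>\<^sup>+r. ennreal (indicator {0..} r * (1 + r) powr (- (1 + \<alpha> / 2))) \<partial>lborel)"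
    by (intro nn_integral_cong) (auto simp: indicator_def)
  finally have 3: "(\<integral>\<^sup>+r. ennreal (indicator {0..} r * (1 + r) powr (- (1 + \<alpha> / 2))) \<partial>lborel) < \<infinity>"
    using 2 by simp
  have "(\<integral>\<^sup>+r. ennreal (axis_weight \<alpha> r) \<partial>lborel) =
      (\<integral>\<^sup>+r. ennreal (indicator {0..1} r * r powr (- (1 + \<alpha>) / 2)) \<partial>lborel)
      + (\<integral>\<^sup>+r. ennreal (indicator {0..} r * (1 + r) powr (- (1 + \<alpha> / 2))) \<partial>lborel)"
    unfolding axis_weight_def by (subst nn_integral_add[symmetric]) auto
  then show ?thesis using 1 3 by simp
qed

text \<open>On the unit square \<open>norm y ^ 2 \<ge> y\<^sub>1 y\<^sub>2\<close>, elsewhere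
  \<open>4 norm y ^ 2 \<ge> (1 + y\<^sub>1) (1 + y\<^sub>2)\<close>; either estimate splits the weight into a product.\<close>
lemma kernel_weight_le_axis_weights:
  assumes "0 < \<alpha>" "\<alpha> < 1" "fst y \<noteq> 0" "snd y \<noteq> 0"
  shows "kernel_weight \<alpha> y \<le> 4 powr (1 + \<alpha> / 2) * (axis_weight \<alpha> (fst y) * axis_weight \<alpha> (snd y))"
proof (cases "y \<in> quadrant")
  case False
  then show ?thesis by (simp add: kernel_weight_def axis_weight_nonneg)
next
  case True
  define a b where "a = fst y" and "b = snd y"
  have ab: "a > 0" "b > 0" using True assms by (auto simp: a_def b_def quadrant_def)
  have n2: "(norm y)\<^sup>2 = a\<^sup>2 + b\<^sup>2" by (simp add: norm_prod_def a_def b_def)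
  have n: "norm y > 0" using ab by (auto simp: a_def b_def)
  have nab: "a \<le> norm y" "b \<le> norm y"
    using norm_fst_le[of "fst y" "snd y"] norm_snd_le[of "snd y" "fst y"] ab by (auto simp: a_def b_def)
  have pw: "norm y powr r = ((norm y)\<^sup>2) powr (r / 2)" for r
  proof -
    have "(norm y)\<^sup>2 = norm y powr 2" using n by (simp add: powr_numeral)
    then show ?thesis by (simp only: powr_powr) simp
  qed
  have split: "X \<le> 4 powr (1 + \<alpha> / 2) * X" if "X \<ge> 0" for X :: real
    using ge_one_powr_ge_zero[of 4 "1 + \<alpha> / 2"] assms that
    by (metis mult_right_mono mult_1 add_nonneg_nonneg divide_nonneg_pos less_imp_le one_le_numeral zero_le_one zero_less_numeral)
  show ?thesis
  proof (cases "a \<le> 1 \<and> b \<le> 1")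
    case True
    have "kernel_weight \<alpha> y \<le> norm y / norm y powr (2 + \<alpha>)"
      unfolding kernel_weight_def using \<open>y \<in> quadrant\<close> by (simp add: divide_right_mono)
    also have "\<dots> = norm y powr (- (1 + \<alpha>))"
    proof -
      have "- (1 + \<alpha>) = 1 - (2 + \<alpha>)" by simp
      then show ?thesis using n by (simp only: powr_diff) simp
    qed
    also have "\<dots> = ((norm y)\<^sup>2) powr (- (1 + \<alpha>) / 2)" by (rule pw)
    also have "\<dots> \<le> (a * b) powr (- (1 + \<alpha>) / 2)"
    proof (rule powr_mono2')
      have "2 * (a * b) \<le> a\<^sup>2 + b\<^sup>2" using sum_squares_bound[of a b] by (simp add: mult.assoc)
      moreover have "a * b \<ge> 0" using ab by simp
      ultimately show "a * b \<le> (norm y)\<^sup>2" unfolding n2 by linarith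
    qed (use ab assms in auto)
    also have "\<dots> = a powr (- (1 + \<alpha>) / 2) * b powr (- (1 + \<alpha>) / 2)"
      using ab by (simp add: powr_mult)
    also have "\<dots> \<le> axis_weight \<alpha> a * axis_weight \<alpha> b"
      using ab True by (intro mult_mono) (auto simp: axis_weight_def)
    also have "\<dots> \<le> 4 powr (1 + \<alpha> / 2) * (axis_weight \<alpha> a * axis_weight \<alpha> b)"
      by (intro split mult_nonneg_nonneg axis_weight_nonneg)
    finally show ?thesis by (simp add: a_def b_def)
  next
    case False
    then have n1: "norm y \<ge> 1" using nab by linarith
    have "(1 + a) * (1 + b) \<le> (2 * norm y) * (2 * norm y)"
      using n1 nab ab by (intro mult_mono) auto
    then have le: "(1 + a) * (1 + b) / 4 \<le> (norm y)\<^sup>2" by (simp add: power2_eq_square)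
    have "kernel_weight \<alpha> y = norm y powr (- (2 + \<alpha>))"
      unfolding kernel_weight_def using \<open>y \<in> quadrant\<close> n1
      by (simp only: powr_minus) (simp add: divide_simps)
    also have "\<dots> = ((norm y)\<^sup>2) powr (- (2 + \<alpha>) / 2)" by (rule pw)
    also have "\<dots> \<le> ((1 + a) * (1 + b) / 4) powr (- (2 + \<alpha>) / 2)"
      using ab assms le by (intro powr_mono2') auto
    also have "\<dots> = ((1 + a) * (1 + b) * (1/4)) powr (- (1 + \<alpha> / 2))"
      by (rule arg_cong2[where f = "(powr)"]) (simp_all add: field_simps)
    also have "\<dots> = (1 + a) powr (- (1 + \<alpha> / 2)) * (1 + b) powr (- (1 + \<alpha> / 2)) * (1/4) powr (- (1 + \<alpha> / 2))"
      using ab by (simp only: powr_mult)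
    also have "(1/4) powr (- (1 + \<alpha> / 2)) = (4::real) powr (1 + \<alpha> / 2)"
      by (simp only: powr_divide powr_minus powr_one_eq_one) simp
    also have "(1 + a) powr (- (1 + \<alpha> / 2)) * (1 + b) powr (- (1 + \<alpha> / 2)) * 4 powr (1 + \<alpha> / 2)
        \<le> (axis_weight \<alpha> a * axis_weight \<alpha> b) * 4 powr (1 + \<alpha> / 2)"
      using ab by (intro mult_right_mono mult_mono) (auto simp: axis_weight_def)
    finally show ?thesis by (simp add: a_def b_def mult.commute)
  qed
qed

lemma kernel_weight_measurable [measurable]: "kernel_weight \<alpha> \<in> borel_measurable borel"
  unfolding kernel_weight_def by measurable

text \<open>The exponent \<open>- (1 + \<alpha>) / 2\<close> is above \<open>-1\<close> because \<open>\<alpha> < 1\<close>, and \<open>- (1 + \<alpha> / 2)\<close> is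
  below \<open>-1\<close> because \<open>\<alpha> > 0\<close>; a product majorant replaces polar coordinates.\<close>
lemma kernel_weight_integrable:
  assumes "0 < \<alpha>" "\<alpha> < 1"
  shows "integrable lborel (kernel_weight \<alpha>)"
proof (rule integrableI_nonneg)
  let ?c = "4 powr (1 + \<alpha> / 2) :: real"
  have "AE y in (lborel :: (real \<times> real) measure). y \<bullet> (1, 0) \<noteq> 0"
    "AE y in (lborel :: (real \<times> real) measure). y \<bullet> (0, 1) \<noteq> 0"
    by (rule AE_lborel_inner_neq; simp add: Basis_prod_def)+
  then have ae: "AE y in (lborel :: (real \<times> real) measure). ennreal (kernel_weight \<alpha> y) \<le>
      ennreal ?c * (ennreal (axis_weight \<alpha> (fst y)) * ennreal (axis_weight \<alpha> (snd y)))"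
  proof eventually_elim
    case (elim y)
    have "ennreal (kernel_weight \<alpha> y) \<le> ennreal (?c * (axis_weight \<alpha> (fst y) * axis_weight \<alpha> (snd y)))"
      using elim assms by (intro ennreal_leI kernel_weight_le_axis_weights) (auto simp: inner_prod_def)
    then show ?case by (simp add: ennreal_mult axis_weight_nonneg)
  qed
  have "(\<integral>\<^sup>+y. ennreal (axis_weight \<alpha> (fst y)) * ennreal (axis_weight \<alpha> (snd y)) \<partial>lborel)
      = (\<integral>\<^sup>+r. \<integral>\<^sup>+s. ennreal (axis_weight \<alpha> r) * ennreal (axis_weight \<alpha> s) \<partial>lborel \<partial>lborel)"
    unfolding lborel_prod[symmetric] by (subst lborel.nn_integral_fst[symmetric]) auto
  also have "\<dots> = (\<integral>\<^sup>+r. ennreal (axis_weight \<alpha> r) \<partial>lborel) * (\<integral>\<^sup>+r. ennreal (axis_weight \<alpha> r) \<partial>lborel)"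
    by (simp add: nn_integral_cmult nn_integral_multc)
  also have "\<dots> < \<infinity>" using axis_weight_finite[OF assms] by (simp add: ennreal_mult_less_top)
  finally have fin: "(\<integral>\<^sup>+y. ennreal (axis_weight \<alpha> (fst y)) * ennreal (axis_weight \<alpha> (snd y)) \<partial>lborel) < \<infinity>" .
  have "(\<integral>\<^sup>+y. ennreal (kernel_weight \<alpha> y) \<partial>lborel) \<le>
      (\<integral>\<^sup>+y. ennreal ?c * (ennreal (axis_weight \<alpha> (fst y)) * ennreal (axis_weight \<alpha> (snd y))) \<partial>lborel)"
    using ae by (rule nn_integral_mono_AE)
  also have "\<dots> = ennreal ?c * (\<integral>\<^sup>+y. ennreal (axis_weight \<alpha> (fst y)) * ennreal (axis_weight \<alpha> (snd y)) \<partial>lborel)"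
    by (rule nn_integral_cmult) (simp add: borel_prod[symmetric])
  also have "\<dots> < \<infinity>" using fin by (simp add: ennreal_mult_less_top)
  finally show "(\<integral>\<^sup>+y. ennreal (kernel_weight \<alpha> y) \<partial>lborel) < \<infinity>" .
qed (auto simp: kernel_weight_nonneg)

section \<open>Integration along hyperbolas\<close>

definition hyp_region :: "real \<Rightarrow> (real \<times> real) set" where
  "hyp_region z = {y \<in> quadrant. z \<le> fst y * snd y}"

lemma hyperbolic_region_eq: "hyperbolic_region x = hyp_region (fst x * snd x)"
  by (simp add: hyperbolic_region_def hyp_region_def)

lemma hyp_region_measurable [measurable]: "hyp_region z \<in> sets borel"
proof -
  have "closed {y::real \<times> real. z \<le> fst y * snd y}"
    by (intro closed_Collect_le continuous_intros)
  then have "closed (quadrant \<inter> {y::real \<times> real. z \<le> fst y * snd y})"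
    using quadrant_closed by (rule closed_Int[rotated])
  moreover have "quadrant \<inter> {y::real \<times> real. z \<le> fst y * snd y} = hyp_region z"
    by (auto simp: hyp_region_def)
  ultimately show ?thesis by (metis borel_closed)
qed

lemma kernel_integrand_bound:
  assumes \<alpha>: "0 < \<alpha>" "\<alpha> < 1" and f: "continuous_on quadrant f"
    and le: "\<And>y. y \<in> quadrant \<Longrightarrow> \<bar>f y\<bar> \<le> A * min (norm y) 1"
  shows "set_integrable lborel (hyp_region z) (kernel_integrand \<alpha> f)"
    and "\<bar>LINT y:hyp_region z|lborel. kernel_integrand \<alpha> f y\<bar> \<le> A * (LINT y|lborel. kernel_weight \<alpha> y)"
proof -
  let ?g = "\<lambda>y. indicator (hyp_region z) y *\<^sub>R kernel_integrand \<alpha> f y"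
  have "(\<lambda>y. indicator quadrant y *\<^sub>R f y) \<in> borel_measurable borel"
    using f by (rule borel_measurable_continuous_on_indicator[OF quadrant_measurable])
  then have "(\<lambda>y. indicator (hyp_region z) y * ((indicator quadrant y *\<^sub>R f y) / norm y powr (2 + \<alpha>))) \<in> borel_measurable borel"
    by measurable
  moreover have "(\<lambda>y. indicator (hyp_region z) y * ((indicator quadrant y *\<^sub>R f y) / norm y powr (2 + \<alpha>))) = ?g"
    by (auto simp: indicator_def hyp_region_def kernel_integrand_def)
  ultimately have meas: "?g \<in> borel_measurable borel" by simp
  have bd: "norm (?g y) \<le> A * kernel_weight \<alpha> y" for y
  proof (cases "y \<in> quadrant")
    case True
    have "\<bar>kernel_integrand \<alpha> f y\<bar> = \<bar>f y\<bar> / norm y powr (2 + \<alpha>)"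
      by (simp add: kernel_integrand_def)
    also have "\<dots> \<le> A * min (norm y) 1 / norm y powr (2 + \<alpha>)"
      using le[OF True] by (rule divide_right_mono) simp
    also have "\<dots> = A * kernel_weight \<alpha> y" using True by (simp add: kernel_weight_def)
    finally have "\<bar>kernel_integrand \<alpha> f y\<bar> \<le> A * kernel_weight \<alpha> y" .
    then show ?thesis by (cases "y \<in> hyp_region z") auto
  qed (auto simp: hyp_region_def kernel_weight_def)
  have int: "integrable lborel (\<lambda>y. A * kernel_weight \<alpha> y)"
    using kernel_weight_integrable[OF \<alpha>] by simp
  show "set_integrable lborel (hyp_region z) (kernel_integrand \<alpha> f)"
    unfolding set_integrable_def
    by (rule Bochner_Integration.integrable_bound[OF int])
      (use meas in simp, intro AE_I2 order_trans[OF bd], simp)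
  then have "norm (LINT y|lborel. ?g y) \<le> (LINT y|lborel. A * kernel_weight \<alpha> y)"
    using int bd unfolding set_integrable_def by (intro Bochner_Integration.integral_norm_bound_integral) auto
  then show "\<bar>LINT y:hyp_region z|lborel. kernel_integrand \<alpha> f y\<bar> \<le> A * (LINT y|lborel. kernel_weight \<alpha> y)"
    by (simp add: set_lebesgue_integral_def)
qed

text \<open>The substitution \<open>y = (s, w / s)\<close> for fixed \<open>s\<close>, followed by an exchange of the integrals.\<close>
lemma nn_integral_hyperbolic:
  fixes f :: "real \<times> real \<Rightarrow> ennreal"
  assumes f [measurable]: "f \<in> borel_measurable borel" and "0 \<le> z"
  shows "(\<integral>\<^sup>+y. f y * indicator (hyp_region z) y \<partial>lborel) =
    (\<integral>\<^sup>+w. (\<integral>\<^sup>+s. f (s, w / s) * ennreal (1 / s) * indicator {0<..} s \<partial>lborel) * indicator {z..} w \<partial>lborel)"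
proof -
  have [measurable]: "f \<in> borel_measurable (borel \<Otimes>\<^sub>M borel)" "hyp_region z \<in> sets (borel \<Otimes>\<^sub>M borel)"
    using hyp_region_measurable[of z] f by (simp_all only: borel_prod)
  have "(\<integral>\<^sup>+y. f y * indicator (hyp_region z) y \<partial>lborel) =
      (\<integral>\<^sup>+s. \<integral>\<^sup>+v. f (s, v) * indicator (hyp_region z) (s, v) \<partial>lborel \<partial>lborel)"
    unfolding lborel_prod[symmetric] by (subst lborel.nn_integral_fst[symmetric]) auto
  also have "\<dots> = (\<integral>\<^sup>+s. \<integral>\<^sup>+w. f (s, w / s) * ennreal (1 / s) * indicator {0<..} s * indicator {z..} w \<partial>lborel \<partial>lborel)"
  proof (rule nn_integral_cong_AE)
    show "AE s in lborel. (\<integral>\<^sup>+v. f (s, v) * indicator (hyp_region z) (s, v) \<partial>lborel) =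
        (\<integral>\<^sup>+w. f (s, w / s) * ennreal (1 / s) * indicator {0<..} s * indicator {z..} w \<partial>lborel)"
      using AE_lborel_singleton[of "0::real"]
    proof eventually_elim
      case (elim s)
      show ?case
      proof (cases "s > 0")
        case True
        have "(\<integral>\<^sup>+v. f (s, v) * indicator (hyp_region z) (s, v) \<partial>lborel) =
            ennreal \<bar>1/s\<bar> * (\<integral>\<^sup>+w. f (s, 0 + (1/s) * w) * indicator (hyp_region z) (s, 0 + (1/s) * w) \<partial>lborel)"
          using True by (intro nn_integral_real_affine) auto
        also have "\<dots> = (\<integral>\<^sup>+w. ennreal \<bar>1/s\<bar> * (f (s, 0 + (1/s) * w) * indicator (hyp_region z) (s, 0 + (1/s) * w)) \<partial>lborel)"
          by (rule nn_integral_cmult[symmetric]) measurable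
        also have "\<dots> = (\<integral>\<^sup>+w. f (s, w / s) * ennreal (1 / s) * indicator {0<..} s * indicator {z..} w \<partial>lborel)"
          using True \<open>0 \<le> z\<close>
          by (intro nn_integral_cong)
            (auto simp: indicator_def hyp_region_def quadrant_def zero_le_divide_iff mult.commute)
        finally show ?thesis .
      qed (use elim in \<open>auto simp: hyp_region_def quadrant_def\<close>)
    qed
  qed
  also have "\<dots> = (\<integral>\<^sup>+w. \<integral>\<^sup>+s. f (s, w / s) * ennreal (1 / s) * indicator {0<..} s * indicator {z..} w \<partial>lborel \<partial>lborel)"
    by (rule lborel_pair.Fubini') measurable
  also have "\<dots> = (\<integral>\<^sup>+w. (\<integral>\<^sup>+s. f (s, w / s) * ennreal (1 / s) * indicator {0<..} s \<partial>lborel) * indicator {z..} w \<partial>lborel)"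
    by (intro nn_integral_cong nn_integral_multc) measurable
  finally show ?thesis .
qed

text \<open>Invariance of \<open>ds / s\<close>: moving mass along a hyperbola is a scaling of \<open>s\<close>.\<close>
lemma nn_integral_scale_invariant:
  fixes h :: "real \<Rightarrow> ennreal"
  assumes [measurable]: "h \<in> borel_measurable borel" and a: "0 < a"
  shows "(\<integral>\<^sup>+s. h s * ennreal (1 / s) * indicator {0<..} s \<partial>lborel) =
         (\<integral>\<^sup>+s. h (a * s) * ennreal (1 / s) * indicator {0<..} s \<partial>lborel)"
proof -
  have "(\<integral>\<^sup>+s. h s * ennreal (1 / s) * indicator {0<..} s \<partial>lborel) =
      ennreal \<bar>a\<bar> * (\<integral>\<^sup>+s. h (0 + a * s) * ennreal (1 / (0 + a * s)) * indicator {0<..} (0 + a * s) \<partial>lborel)"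
    using a by (intro nn_integral_real_affine) auto
  also have "\<dots> = (\<integral>\<^sup>+s. ennreal \<bar>a\<bar> * (h (0 + a * s) * ennreal (1 / (0 + a * s)) * indicator {0<..} (0 + a * s)) \<partial>lborel)"
    by (rule nn_integral_cmult[symmetric]) measurable
  also have "\<dots> = (\<integral>\<^sup>+s. h (a * s) * ennreal (1 / s) * indicator {0<..} s \<partial>lborel)"
  proof (intro nn_integral_cong)
    fix s :: real
    show "ennreal \<bar>a\<bar> * (h (0 + a * s) * ennreal (1 / (0 + a * s)) * indicator {0<..} (0 + a * s)) =
        h (a * s) * ennreal (1 / s) * indicator {0<..} s"
    proof (cases "s > 0")
      case True
      have "ennreal \<bar>a\<bar> * ennreal (1 / (0 + a * s)) = ennreal (\<bar>a\<bar> * (1 / (0 + a * s)))"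
        using a True by (intro ennreal_mult[symmetric]) auto
      also have "\<bar>a\<bar> * (1 / (0 + a * s)) = 1 / s" using a True by simp
      finally show ?thesis using a True by (simp add: mult.left_commute[of "ennreal a"])
    qed (use a in \<open>auto simp: indicator_def zero_less_mult_iff\<close>)
  qed
  finally show ?thesis .
qed

section \<open>Continuity and integration lemmas in one variable\<close>


lemma continuous_on_locally:
  fixes f :: "'a::t2_space \<Rightarrow> 'b::topological_space"
  assumes "\<And>x. x \<in> S \<Longrightarrow> \<exists>U. open U \<and> x \<in> U \<and> continuous_on (S \<inter> U) f"
  shows "continuous_on S f"
  unfolding continuous_on_eq_continuous_within
proof
  fix x assume x: "x \<in> S"
  then obtain U where U: "open U" "x \<in> U" "continuous_on (S \<inter> U) f" using assms by blast
  then have "continuous (at x within (S \<inter> U)) f"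
    using x by (auto simp: continuous_on_eq_continuous_within)
  moreover have "at x within (S \<inter> U) = at x within S"
    using U by (intro at_within_nhd[of x U]) auto
  ultimately show "continuous (at x within S) f" by simp
qed

lemma has_integral_power_over_fact:
  fixes t c M :: real
  assumes "0 \<le> t"
  shows "((\<lambda>s. c * (M * (c * s) ^ k / fact k)) has_integral M * (c * t) ^ Suc k / fact (Suc k)) {0..t}"
proof -
  have der: "((\<lambda>s. M * (c * s) ^ Suc k / fact (Suc k)) has_real_derivative c * (M * (c * s) ^ k / fact k)) (at s within {0..t})" for s
  proof -
    have "((\<lambda>s. c * s) has_real_derivative c) (at s within {0..t})"
      by (auto intro!: derivative_eq_intros)
    from DERIV_power_Suc[OF this, of k]
    have "((\<lambda>s. (c * s) ^ Suc k) has_real_derivative (1 + real k) * ((c * s) ^ k * c)) (at s within {0..t})"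
      by (simp add: mult.commute)
    from DERIV_cmult[OF this, of "M / fact (Suc k)"]
    have "((\<lambda>s. M / fact (Suc k) * (c * s) ^ Suc k) has_real_derivative
        M / fact (Suc k) * ((1 + real k) * ((c * s) ^ k * c))) (at s within {0..t})" .
    moreover have "M / fact (Suc k) * ((1 + real k) * ((c * s) ^ k * c)) = c * (M * (c * s) ^ k / fact k)"
    proof -
      have "fact (Suc k) = (1 + real k) * fact k" by simp
      moreover have "M / (a * b) * (a * (x * c)) = c * (M * x / b)" if "a \<noteq> 0" for a b x :: real
        using that by simp
      moreover have "1 + real k \<noteq> 0" by linarith
      ultimately show ?thesis by presburger
    qed
    ultimately show ?thesis by (simp add: mult_ac)
  qed
  have "((\<lambda>s. c * (M * (c * s) ^ k / fact k)) has_integral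
      M * (c * t) ^ Suc k / fact (Suc k) - M * (c * 0) ^ Suc k / fact (Suc k)) {0..t}"
    using der assms by (intro fundamental_theorem_of_calculus)
      (auto simp: has_real_derivative_iff_has_vector_derivative[symmetric])
  then show ?thesis by simp
qed

lemma integral_stretch_to_unit:
  fixes f :: "real \<Rightarrow> real"
  assumes "continuous_on {0..t} f" "0 \<le> t"
  shows "integral {0..t} f = t * integral {0..1} (\<lambda>\<tau>. f (t * \<tau>))"
proof (cases "t = 0")
  case False
  then have t: "t > 0" using assms by simp
  have "(f has_integral integral {0..t} f) {0..t}"
    using assms by (intro integrable_integral integrable_continuous_interval)
  from has_integral_stretch_real[OF this, of t] t
  have "((\<lambda>x. f (t * x)) has_integral (1 / t) * integral {0..t} f) ((\<lambda>x. x / t) ` {0..t})" by simp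
  moreover have "(\<lambda>x. x / t) ` {0..t} = {0..1}"
    using t by (auto simp: image_divide_atLeastAtMost)
  ultimately have "integral {0..1} (\<lambda>\<tau>. f (t * \<tau>)) = (1 / t) * integral {0..t} f"
    by (metis integral_unique)
  then show ?thesis using t by simp
qed simp

text \<open>Rescaling \<open>{0..t}\<close> to the unit interval turns a variable domain of integration into a
  parameter of the integrand.\<close>
lemma time_integral_continuous:
  fixes f :: "real \<Rightarrow> real \<Rightarrow> real"
  assumes f: "continuous_on (A \<times> I) (\<lambda>x. f (fst x) (snd x))"
    and I: "\<And>t s. t \<in> I \<Longrightarrow> 0 \<le> s \<Longrightarrow> s \<le> t \<Longrightarrow> s \<in> I" "I \<subseteq> {0..}"
  shows "continuous_on (A \<times> I) (\<lambda>x. integral {0..snd x} (f (fst x)))"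
proof -
  let ?m = "\<lambda>y::(real \<times> real) \<times> real. (fst (fst y), snd (fst y) * snd y)"
  have sub: "?m ` ((A \<times> I) \<times> {0..1}) \<subseteq> A \<times> I"
  proof (intro image_subsetI)
    fix y assume y: "y \<in> (A \<times> I) \<times> {0..1::real}"
    then have y': "fst (fst y) \<in> A" "snd (fst y) \<in> I" "0 \<le> snd y" "snd y \<le> 1" by auto
    then have "0 \<le> snd (fst y)" using I(2) by auto
    then have "0 \<le> snd (fst y) * snd y" "snd (fst y) * snd y \<le> snd (fst y)"
      using y' by (auto simp: mult_left_le)
    then show "?m y \<in> A \<times> I" using I(1) y' by simp
  qed
  have "continuous_on ((A \<times> I) \<times> {0..1}) ?m" by (intro continuous_intros)
  from continuous_on_compose2[OF f this sub]
  have "continuous_on ((A \<times> I) \<times> {0..1}) (\<lambda>y. f (fst (fst y)) (snd (fst y) * snd y))"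
    by simp
  then have "continuous_on ((A \<times> I) \<times> cbox 0 1) (\<lambda>(x, \<tau>). f (fst x) (snd x * \<tau>))"
    by (simp add: split_beta)
  from integral_continuous_on_param[OF this]
  have "continuous_on (A \<times> I) (\<lambda>x. snd x * integral {0..1} (\<lambda>\<tau>. f (fst x) (snd x * \<tau>)))"
    by (intro continuous_intros) simp
  then show ?thesis
  proof (rule continuous_on_eq)
    fix x assume x: "x \<in> A \<times> I"
    then have sub: "{0..snd x} \<subseteq> I" using I by auto
    have "continuous_on {0..snd x} (\<lambda>s. (fst x, s))" by (intro continuous_intros)
    moreover have "(\<lambda>s. (fst x, s)) ` {0..snd x} \<subseteq> A \<times> I"
      using x sub by (intro image_subsetI) auto
    ultimately have "continuous_on {0..snd x} (\<lambda>s. f (fst (fst x, s)) (snd (fst x, s)))"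
      by (rule continuous_on_compose2[OF f])
    then have "continuous_on {0..snd x} (f (fst x))" by simp
    then show "snd x * integral {0..1} (\<lambda>\<tau>. f (fst x) (snd x * \<tau>)) = integral {0..snd x} (f (fst x))"
      using x I by (intro integral_stretch_to_unit[symmetric]) auto
  qed
qed

lemma continuous_on_of_l1_lipschitz:
  fixes f :: "real \<times> real \<Rightarrow> real"
  assumes "0 \<le> L" and le: "\<And>x y. x \<in> S \<Longrightarrow> y \<in> S \<Longrightarrow>
      \<bar>f x - f y\<bar> \<le> L * (\<bar>fst x - fst y\<bar> + \<bar>snd x - snd y\<bar>)"
  shows "continuous_on S f"
proof (rule lipschitz_on_continuous_on)
  show "(L * 2)-lipschitz_on S f"
  proof (rule lipschitz_onI)
    fix x y assume "x \<in> S" "y \<in> S"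
    then have "\<bar>f x - f y\<bar> \<le> L * (\<bar>fst x - fst y\<bar> + \<bar>snd x - snd y\<bar>)" by (rule le)
    also have "\<dots> \<le> L * (dist x y + dist x y)"
      using \<open>0 \<le> L\<close> dist_fst_le[of x y] dist_snd_le[of x y]
      by (intro mult_left_mono add_mono) (auto simp: dist_real_def)
    finally show "dist (f x) (f y) \<le> L * 2 * dist x y" by (simp add: dist_real_def)
  qed (use \<open>0 \<le> L\<close> in simp)
qed

lemma time_integral_lipschitz:
  fixes r :: "real \<Rightarrow> real \<Rightarrow> real"
  assumes int: "\<And>z. z \<in> A \<Longrightarrow> r z integrable_on {0..t1}"
    and B: "0 \<le> B" "\<And>z s. z \<in> A \<Longrightarrow> s \<in> {0..t1} \<Longrightarrow> \<bar>r z s\<bar> \<le> B"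
    and K: "0 \<le> K" "\<And>z w s. z \<in> A \<Longrightarrow> w \<in> A \<Longrightarrow> s \<in> {0..t1} \<Longrightarrow> \<bar>r z s - r w s\<bar> \<le> K * \<bar>z - w\<bar>"
    and zw: "z \<in> A" "w \<in> A" and st: "s \<in> {0..t1}" "t \<in> {0..t1}"
  shows "\<bar>integral {0..t} (r z) - integral {0..s} (r w)\<bar> \<le> (K * t1 + B) * (\<bar>z - w\<bar> + \<bar>t - s\<bar>)"
proof -
  have i: "r z integrable_on {a..b}" if "z \<in> A" "0 \<le> a" "b \<le> t1" for z a b
    using int[OF that(1)] by (rule integrable_on_subinterval) (use that in auto)
  have "norm (integral {0..t} (\<lambda>s. r z s - r w s)) \<le> integral {0..t} (\<lambda>_::real. K * \<bar>z - w\<bar>)"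
    using K(2)[OF zw] st i zw by (intro integral_norm_bound_integral integrable_diff integrable_const_ivl) auto
  moreover have "integral {0..t} (\<lambda>s. r z s - r w s) = integral {0..t} (r z) - integral {0..t} (r w)"
    using i zw st by (intro integral_diff) auto
  moreover have "integral {0..t} (\<lambda>_::real. K * \<bar>z - w\<bar>) = K * \<bar>z - w\<bar> * t" using st by simp
  moreover have "K * \<bar>z - w\<bar> * t \<le> K * \<bar>z - w\<bar> * t1" using K(1) st by (intro mult_left_mono) auto
  ultimately have space: "\<bar>integral {0..t} (r z) - integral {0..t} (r w)\<bar> \<le> K * \<bar>z - w\<bar> * t1"
    by (simp only: real_norm_def)
  have time: "\<bar>integral {0..b} (r w) - integral {0..a} (r w)\<bar> \<le> B * (b - a)"
    if ab: "0 \<le> a" "a \<le> b" "b \<le> t1" for a b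
  proof -
    have "integral {0..a} (r w) + integral {a..b} (r w) = integral {0..b} (r w)"
      using ab by (intro Henstock_Kurzweil_Integration.integral_combine i zw) auto
    moreover have "norm (integral {a..b} (r w)) \<le> integral {a..b} (\<lambda>_::real. B)"
      using B(2)[OF zw(2)] ab by (intro integral_norm_bound_integral i zw integrable_const_ivl) auto
    moreover have "integral {a..b} (\<lambda>_::real. B) = B * (b - a)" using ab by simp
    ultimately show ?thesis by (simp only: real_norm_def)
  qed
  have "\<bar>integral {0..t} (r w) - integral {0..s} (r w)\<bar> \<le> B * \<bar>t - s\<bar>"
    using time[of s t] time[of t s] st by (cases "s \<le> t") (auto simp: abs_minus_commute)
  moreover have "0 \<le> K * t1 * \<bar>t - s\<bar>" "0 \<le> B * \<bar>z - w\<bar>" using K(1) B(1) st by auto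
  moreover have "(K * t1 + B) * (\<bar>z - w\<bar> + \<bar>t - s\<bar>)
      = K * \<bar>z - w\<bar> * t1 + B * \<bar>t - s\<bar> + K * t1 * \<bar>t - s\<bar> + B * \<bar>z - w\<bar>"
    by (simp add: algebra_simps)
  ultimately show ?thesis using space by linarith
qed

section \<open>The flux through a hyperbola\<close>

text \<open>The initial data \<open>\<phi> (y\<^sub>1) \<psi> (y\<^sub>2)\<close>.  The support of \<open>\<phi>\<close> keeps them away from the origin, and
  \<open>c\<close> bounds both factors from below where the cascade needs positive vorticity.\<close>
locale vortex_profile =
  fixes \<alpha> c :: real and \<phi> \<phi>' \<psi> \<psi>' :: "real \<Rightarrow> real"
  assumes alpha: "0 < \<alpha>" "\<alpha> < 1"
    and phi_deriv: "\<And>s. (\<phi> has_real_derivative \<phi>' s) (at s)"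
    and psi_deriv: "\<And>s. (\<psi> has_real_derivative \<psi>' s) (at s)"
    and phi'_cont: "continuous_on UNIV \<phi>'" and psi'_cont: "continuous_on UNIV \<psi>'"
    and phi_bounds: "\<And>s. 0 \<le> \<phi> s" "\<And>s. \<phi> s \<le> 1"
    and psi_bounds: "\<And>s. 0 \<le> \<psi> s" "\<And>s. \<psi> s \<le> 1"
    and phi_0: "\<And>s. s \<notin> {1..3} \<Longrightarrow> \<phi> s = 0" and psi_0: "\<And>s. 1 \<le> s \<Longrightarrow> \<psi> s = 0"
    and c_pos: "0 < c" and phi_ge: "\<And>s. 3/2 \<le> s \<Longrightarrow> s \<le> 5/2 \<Longrightarrow> c \<le> \<phi> s"
    and psi_ge: "\<And>s. s \<le> 2/3 \<Longrightarrow> c \<le> \<psi> s"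
begin

definition p :: real where "p = 1 + \<alpha> / 2"

lemma p_pos: "0 < p" using alpha by (simp add: p_def)

lemma phi_cont: "continuous_on S \<phi>" and psi_cont: "continuous_on S \<psi>"
  using phi_deriv psi_deriv by (meson DERIV_isCont continuous_at_imp_continuous_on)+

lemmas phi_continuous [continuous_intros] = continuous_on_compose2[OF phi_cont[of UNIV]]
lemmas psi_continuous [continuous_intros] = continuous_on_compose2[OF psi_cont[of UNIV]]
lemmas phi'_continuous [continuous_intros] = continuous_on_compose2[OF phi'_cont]
lemmas psi'_continuous [continuous_intros] = continuous_on_compose2[OF psi'_cont]

lemma phi_measurable [measurable]: "\<phi> \<in> borel_measurable borel"
  and psi_measurable [measurable]: "\<psi> \<in> borel_measurable borel"
  using phi_cont psi_cont by (auto intro: borel_measurable_continuous_onI)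

text \<open>The squared distance from the origin of the point \<open>(s, w / s)\<close> after it has been moved along its
  hyperbola to \<open>(s exp (- g), w / s exp g)\<close>.\<close>
definition sqnorm_at :: "real \<Rightarrow> real \<Rightarrow> real \<Rightarrow> real" where
  "sqnorm_at w g s = s\<^sup>2 * exp (- 2 * g) + (w / s)\<^sup>2 * exp (2 * g)"

definition flux_integrand :: "real \<Rightarrow> real \<Rightarrow> real \<Rightarrow> real" where
  "flux_integrand w g s = \<phi> s * \<psi> (w / s) / s * sqnorm_at w g s powr (- p)"

text \<open>The contribution of the hyperbola \<open>y\<^sub>1 y\<^sub>2 = w\<close> to the velocity integral when its vorticity has
  been moved by the exponent \<open>g\<close>.\<close>
definition flux :: "real \<Rightarrow> real \<Rightarrow> real" where
  "flux w g = integral {1..3} (flux_integrand w g)"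

lemma sqnorm_at_ge: "1 \<le> s \<Longrightarrow> exp (- 2 * g) \<le> sqnorm_at w g s"
  unfolding sqnorm_at_def using power_mono[of 1 s 2]
  by (intro add_increasing2) (auto simp: mult_le_cancel_right1)

lemma sqnorm_at_pos: "1 \<le> s \<Longrightarrow> 0 < sqnorm_at w g s"
  using sqnorm_at_ge[of s g w] by (meson exp_gt_zero less_le_trans)

text \<open>The inequality between arithmetic and geometric means: a hyperbola stays away from the origin.\<close>
lemma sqnorm_at_ge_w:
  assumes "s > 0"
  shows "2 * w \<le> sqnorm_at w g s"
proof -
  have "2 * (s * exp (- g)) * (w / s * exp g) \<le> (s * exp (- g))\<^sup>2 + (w / s * exp g)\<^sup>2"
    by (rule sum_squares_bound)
  moreover have "2 * (s * exp (- g)) * (w / s * exp g) = 2 * w"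
    using assms by (simp add: exp_minus field_simps)
  moreover have "(s * exp (- g))\<^sup>2 + (w / s * exp g)\<^sup>2 = sqnorm_at w g s"
    by (simp only: sqnorm_at_def power_mult_distrib exp_double[symmetric] mult_minus_right mult_minus_left)
  ultimately show ?thesis by simp
qed

lemma flux_integrand_continuous:
  "continuous_on (UNIV \<times> {1..3}) (\<lambda>(x, s). flux_integrand (fst x) (snd x) s)"
proof -
  have "sqnorm_at (fst (fst x)) (snd (fst x)) (snd x) \<noteq> 0" if "x \<in> UNIV \<times> {1..3}" for x
    using sqnorm_at_pos[of "snd x" "fst (fst x)" "snd (fst x)"] that by auto
  then show ?thesis
    unfolding flux_integrand_def split_beta sqnorm_at_def
    by (intro continuous_intros) auto
qed

lemma flux_continuous_pair: "continuous_on UNIV (\<lambda>x. flux (fst x) (snd x))"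
  unfolding flux_def
  using integral_continuous_on_param[of UNIV 1 3 "\<lambda>x s. flux_integrand (fst x) (snd x) s"]
    flux_integrand_continuous by simp

lemma flux_continuous [continuous_intros]:
  assumes "continuous_on S f" "continuous_on S g"
  shows "continuous_on S (\<lambda>x. flux (f x) (g x))"
  using continuous_on_compose2[OF flux_continuous_pair continuous_on_Pair[OF assms]] by simp

lemma flux_integrand_continuous_on: "continuous_on {1..3} (flux_integrand w g)"
proof -
  have "continuous_on {1..3} (\<lambda>s. (\<lambda>(x, s). flux_integrand (fst x) (snd x) s) ((w, g), s))"
    by (intro continuous_on_compose2[OF flux_integrand_continuous] continuous_intros) auto
  then show ?thesis by simp
qed

lemma flux_integrand_integrable: "flux_integrand w g integrable_on {1..3}"
  using flux_integrand_continuous_on by (rule integrable_continuous_interval)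

lemma flux_integrand_nonneg: "1 \<le> s \<Longrightarrow> 0 \<le> flux_integrand w g s"
  unfolding flux_integrand_def using phi_bounds psi_bounds by simp

lemma flux_integrand_factor_le:
  assumes "1 \<le> s"
  shows "\<phi> s * \<psi> (w / s) / s \<le> 1"
proof -
  have "\<phi> s * \<psi> (w / s) \<le> 1 * 1" using phi_bounds psi_bounds by (intro mult_mono) auto
  then show ?thesis using assms by (simp add: divide_le_eq)
qed

lemma flux_nonneg: "0 \<le> flux w g"
  unfolding flux_def
  by (intro integral_nonneg flux_integrand_integrable) (auto intro: flux_integrand_nonneg)

lemma flux_eq_0: "3 \<le> w \<Longrightarrow> flux w g = 0"
proof -
  assume w: "3 \<le> w"
  have "flux_integrand w g s = 0" if "s \<in> {1..3}" for s
  proof -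
    have "1 \<le> w / s" using that w by (simp add: le_divide_eq)
    then show ?thesis by (simp add: flux_integrand_def psi_0)
  qed
  then have "integral {1..3} (flux_integrand w g) = integral {1..3::real} (\<lambda>_. 0)"
    by (rule integral_cong)
  then show ?thesis unfolding flux_def by simp
qed

lemma integral_le_bound_13:
  assumes "h integrable_on {1..3::real}" "\<And>s. s \<in> {1..3} \<Longrightarrow> h s \<le> (B::real)"
  shows "integral {1..3} h \<le> 2 * B"
  using integral_le[OF assms(1) integrable_const_ivl assms(2)] by simp

lemma flux_le: "flux w g \<le> 2 * exp (2 * p * g)"
  unfolding flux_def
proof (rule integral_le_bound_13[OF flux_integrand_integrable])
  fix s :: real assume s: "s \<in> {1..3}"
  have "flux_integrand w g s \<le> 1 * exp (- 2 * g) powr (- p)"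
    unfolding flux_integrand_def using s sqnorm_at_ge[of s g w] p_pos phi_bounds psi_bounds
    by (intro mult_mono flux_integrand_factor_le powr_mono2') auto
  also have "\<dots> = exp (2 * p * g)" by (simp add: exp_powr_real algebra_simps)
  finally show "flux_integrand w g s \<le> exp (2 * p * g)" .
qed

definition flux_lip :: "real \<Rightarrow> real" where
  "flux_lip z = 4 * p * (2 * z) powr (- p)"

lemma flux_lip_nonneg: "0 \<le> flux_lip z"
  using p_pos by (simp add: flux_lip_def)

text \<open>The derivative of \<open>sqnorm_at w g s powr (- p)\<close> in \<open>g\<close> has modulus at most \<open>2 p\<close> times the
  function itself,
  which is bounded because the hyperbola keeps its distance from the origin.\<close>
lemma flux_lipschitz:
  assumes z: "0 < z" "z \<le> w"
  shows "\<bar>flux w g - flux w h\<bar> \<le> flux_lip z * \<bar>g - h\<bar>"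
proof -
  have bd: "\<bar>flux_integrand w g s - flux_integrand w h s\<bar> \<le> 2 * p * (2 * z) powr (- p) * \<bar>g - h\<bar>"
    if s: "s \<in> {1..3}" for s
  proof -
    define d where "d x = - 2 * (s\<^sup>2 * exp (- 2 * x)) + 2 * ((w / s)\<^sup>2 * exp (2 * x))" for x
    have der: "((\<lambda>x. sqnorm_at w x s powr (- p)) has_real_derivative
        (- p) * sqnorm_at w x s powr (- p - 1) * d x) (at x within UNIV)" for x
    proof -
      have "((\<lambda>x. sqnorm_at w x s) has_real_derivative d x) (at x)"
        unfolding sqnorm_at_def d_def by (auto intro!: derivative_eq_intros)
      then have "((\<lambda>x. sqnorm_at w x s powr (- p)) has_real_derivative
          (- p * sqnorm_at w x s powr (- p - 1)) * d x) (at x)"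
        using sqnorm_at_pos[of s w x] s
        by (intro DERIV_chain2[OF has_real_derivative_powr]) auto
      then show ?thesis by simp
    qed
    have le: "\<bar>(- p) * sqnorm_at w x s powr (- p - 1) * d x\<bar> \<le> 2 * p * (2 * z) powr (- p)" for x
    proof -
      let ?D = "sqnorm_at w x s"
      have D: "?D > 0" "2 * z \<le> ?D" using sqnorm_at_pos[of s w x] sqnorm_at_ge_w[of s w x] s z by auto
      have ab: "\<bar>- 2 * A + 2 * B\<bar> \<le> 2 * A + 2 * B" if "0 \<le> A" "0 \<le> B" for A B :: real
        using that by linarith
      have "\<bar>d x\<bar> \<le> 2 * ?D" unfolding d_def sqnorm_at_def distrib_left by (rule ab) auto
      then have "\<bar>(- p) * ?D powr (- p - 1) * d x\<bar> \<le> p * ?D powr (- p - 1) * (2 * ?D)"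
        using p_pos by (simp add: abs_mult mult_left_mono)
      also have "\<dots> = 2 * p * (?D powr (- p - 1) * ?D powr 1)" using D by simp
      also have "\<dots> = 2 * p * ?D powr (- p)" unfolding powr_add[symmetric] by simp
      also have "\<dots> \<le> 2 * p * (2 * z) powr (- p)"
        using p_pos D z by (intro mult_left_mono powr_mono2') auto
      finally show ?thesis .
    qed
    have "norm (sqnorm_at w g s powr (- p) - sqnorm_at w h s powr (- p)) \<le> 2 * p * (2 * z) powr (- p) * norm (g - h)"
      by (rule field_differentiable_bound[OF convex_UNIV der]) (use le in auto)
    then have *: "\<bar>sqnorm_at w g s powr (- p) - sqnorm_at w h s powr (- p)\<bar> \<le> 2 * p * (2 * z) powr (- p) * \<bar>g - h\<bar>"
      by simp
    have "\<bar>flux_integrand w g s - flux_integrand w h s\<bar>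
        = (\<phi> s * \<psi> (w / s) / s) * \<bar>sqnorm_at w g s powr (- p) - sqnorm_at w h s powr (- p)\<bar>"
      unfolding flux_integrand_def right_diff_distrib[symmetric] abs_mult
      using phi_bounds psi_bounds s by simp
    also have "\<dots> \<le> 1 * (2 * p * (2 * z) powr (- p) * \<bar>g - h\<bar>)"
      using s * phi_bounds psi_bounds by (intro mult_mono flux_integrand_factor_le) auto
    finally show ?thesis by simp
  qed
  have "flux w g - flux w h = integral {1..3} (\<lambda>s. flux_integrand w g s - flux_integrand w h s)"
    unfolding flux_def by (rule integral_diff[symmetric]; rule flux_integrand_integrable)
  moreover have "norm (integral {1..3} (\<lambda>s. flux_integrand w g s - flux_integrand w h s))
      \<le> integral {1..3} (\<lambda>s::real. 2 * p * (2 * z) powr (- p) * \<bar>g - h\<bar>)"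
  proof (rule integral_norm_bound_integral)
    show "(\<lambda>s. flux_integrand w g s - flux_integrand w h s) integrable_on {1..3}"
      by (rule integrable_diff; rule flux_integrand_integrable)
    show "(\<lambda>s::real. 2 * p * (2 * z) powr (- p) * \<bar>g - h\<bar>) integrable_on {1..3}"
      by (rule integrable_const_ivl)
    show "norm (flux_integrand w g s - flux_integrand w h s) \<le> 2 * p * (2 * z) powr (- p) * \<bar>g - h\<bar>"
      if "s \<in> {1..3}" for s
      using bd[OF that] by simp
  qed
  moreover have "integral {1..3} (\<lambda>s::real. 2 * p * (2 * z) powr (- p) * \<bar>g - h\<bar>) = flux_lip z * \<bar>g - h\<bar>"
    by (simp add: flux_lip_def)
  ultimately show ?thesis by (simp only: real_norm_def)
qed

definition flux_low :: real where
  "flux_low = c\<^sup>2 / 3 * 11 powr (- p)"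

lemma flux_low_pos: "0 < flux_low"
  using c_pos by (simp add: flux_low_def)

text \<open>In this range of exponents both terms of \<open>sqnorm_at\<close> are at most of order \<open>2 ^ - n\<close>, the
  smallest order possible on hyperbolas \<open>w\<close> comparable to \<open>2 ^ - n\<close>.\<close>
lemma flux_ge:
  assumes w: "0 \<le> w" "w \<le> (1/2) ^ n"
    and g: "real n * ln 2 / 2 \<le> g" "g \<le> real (Suc n) * ln 2 / 2"
  shows "flux_low * (2 ^ n) powr p \<le> flux w g"
proof -
  let ?b = "flux_low * (2 ^ n) powr p"
  have ge: "?b \<le> flux_integrand w g s" if s: "s \<in> {3/2..5/2}" for s
  proof -
    have e1: "exp (- 2 * g) \<le> (1/2) ^ n"
    proof -
      have "exp (- 2 * g) \<le> exp (real n * (- ln 2))" using g by simp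
      also have "\<dots> = exp (- ln 2) ^ n" by (rule exp_of_nat_mult)
      finally show ?thesis by (simp add: exp_minus inverse_eq_divide)
    qed
    have e2: "exp (2 * g) \<le> 2 ^ Suc n"
    proof -
      have "exp (2 * g) \<le> exp (real (Suc n) * ln 2)" using g by simp
      also have "\<dots> = exp (ln 2) ^ Suc n" by (rule exp_of_nat_mult)
      finally show ?thesis by simp
    qed
    have ws: "w / s \<le> 2/3" "0 \<le> w / s" "w / s \<le> (1/2)^n"
    proof -
      have "(1/2 :: real) ^ n \<le> 1" by (rule power_le_one) auto
      then have "w \<le> 1" using w by linarith
      then show "w / s \<le> 2/3" using s by (simp add: divide_le_eq)
      show "0 \<le> w / s" using w s by simp
      have "w / s \<le> w / 1" using s w by (intro divide_left_mono) auto
      then show "w / s \<le> (1/2)^n" using w by simp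
    qed
    have "sqnorm_at w g s \<le> 9 * (1/2) ^ n + ((1/2) ^ n)\<^sup>2 * 2 ^ Suc n"
      unfolding sqnorm_at_def
    proof (intro add_mono mult_mono e1 e2 power_mono ws)
      have "s\<^sup>2 \<le> 3\<^sup>2" using s by (intro power_mono) auto
      then show "s\<^sup>2 \<le> 9" by simp
    qed auto
    also have "((1/2 :: real) ^ n)\<^sup>2 * 2 ^ Suc n = 2 * (1/2)^n"
      by (simp add: power2_eq_square power_one_over field_simps)
    finally have D: "sqnorm_at w g s \<le> 11 * (1/2)^n" by simp
    have "c * c / 3 \<le> \<phi> s * \<psi> (w / s) / s"
      using s ws c_pos phi_ge[of s] psi_ge[of "w / s"] by (intro frac_le mult_mono) (auto intro: order_trans)
    moreover have "(11 * (1/2)^n) powr (- p) \<le> sqnorm_at w g s powr (- p)"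
      using D sqnorm_at_pos[of s w g] s p_pos by (intro powr_mono2') auto
    ultimately have "c * c / 3 * (11 * (1/2)^n) powr (- p) \<le> flux_integrand w g s"
      unfolding flux_integrand_def using c_pos s phi_bounds psi_bounds by (intro mult_mono) auto
    moreover have "(11 * (1/2)^n) powr (- p) = 11 powr (- p) * (2 ^ n) powr p"
    proof -
      have "((1/2)^n) powr (- p) = inverse (2 ^ n) powr (- p)"
        by (simp add: power_one_over inverse_eq_divide)
      also have "\<dots> = (2 ^ n :: real) powr p" by (simp add: powr_minus inverse_powr)
      finally show ?thesis by (simp only: powr_mult)
    qed
    ultimately show ?thesis by (simp add: flux_low_def power2_eq_square mult.assoc)
  qed
  have sub: "{3/2..5/2::real} \<subseteq> {1..3}" by auto
  have int: "flux_integrand w g integrable_on {3/2..5/2}"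
    using flux_integrand_continuous_on sub by (intro integrable_continuous_interval) (rule continuous_on_subset)
  have "?b = integral {3/2..5/2::real} (\<lambda>_. ?b)" by simp
  also have "\<dots> \<le> integral {3/2..5/2} (flux_integrand w g)"
    using ge int by (intro integral_le integrable_const_ivl) auto
  also have "\<dots> \<le> flux w g"
    unfolding flux_def using sub int flux_integrand_integrable
    by (intro integral_subset_le) (auto intro: flux_integrand_nonneg)
  finally show ?thesis .
qed

section \<open>The velocity in hyperbolic coordinates\<close>

text \<open>A vorticity of this form arises from the initial data by the area preserving map that
  moves the hyperbola \<open>y\<^sub>1 y\<^sub>2 = w\<close> along itself by the stretching exponent \<open>g w\<close>.\<close>
definition stretched :: "(real \<Rightarrow> real) \<Rightarrow> (real \<times> real \<Rightarrow> real) \<Rightarrow> bool" where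
  "stretched g om \<longleftrightarrow> continuous_on quadrant om \<and>
     (\<forall>y\<in>quadrant. om y = \<phi> (fst y * exp (g (fst y * snd y))) * \<psi> (snd y * exp (- g (fst y * snd y))))"

lemma stretchedD: "stretched g om \<Longrightarrow> y \<in> quadrant \<Longrightarrow>
    om y = \<phi> (fst y * exp (g (fst y * snd y))) * \<psi> (snd y * exp (- g (fst y * snd y)))"
  by (simp add: stretched_def)

lemma stretched_nonneg: "stretched g om \<Longrightarrow> y \<in> quadrant \<Longrightarrow> 0 \<le> om y"
  using phi_bounds psi_bounds by (simp add: stretchedD)

lemma stretched_le_1: "stretched g om \<Longrightarrow> y \<in> quadrant \<Longrightarrow> om y \<le> 1"
  using phi_bounds psi_bounds by (simp add: stretchedD mult_le_one)

lemma stretched_kernel_measurable: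
  assumes "stretched g om"
  shows "(\<lambda>y. indicator quadrant y * kernel_integrand \<alpha> om y) \<in> borel_measurable borel"
proof -
  have "continuous_on quadrant om" using assms unfolding stretched_def by blast
  then have "(\<lambda>y. indicator quadrant y *\<^sub>R om y) \<in> borel_measurable borel"
    by (rule borel_measurable_continuous_on_indicator[OF quadrant_measurable])
  then have "(\<lambda>y. (indicator quadrant y *\<^sub>R om y) / norm y powr (2 + \<alpha>)) \<in> borel_measurable borel"
    by measurable
  then show ?thesis by (simp add: kernel_integrand_def)
qed

lemma nn_integral_flux_integrand:
  "(\<integral>\<^sup>+s. ennreal (indicator {0<..} s * flux_integrand w g s) \<partial>lborel) = ennreal (flux w g)"
proof -
  have [measurable]: "flux_integrand w g \<in> borel_measurable borel"
    unfolding flux_integrand_def sqnorm_at_def by measurable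
  have "(\<integral>\<^sup>+s. ennreal (indicator {0<..} s * flux_integrand w g s) \<partial>lborel)
      = (\<integral>\<^sup>+s. ennreal (indicator {1..3} s * flux_integrand w g s) \<partial>lborel)"
    by (intro nn_integral_cong) (auto simp: indicator_def flux_integrand_def phi_0)
  also have "\<dots> = ennreal (flux w g)"
    unfolding flux_def using flux_integrand_integrable
    by (intro nn_integral_indicator_has_integral) (auto simp: flux_integrand_nonneg integrable_integral)
  finally show ?thesis .
qed

text \<open>The map along the hyperbola \<open>y\<^sub>1 y\<^sub>2 = w\<close> is the scaling by \<open>exp (- g w)\<close>, undone by the invariance
  of \<open>ds / s\<close>.  The set \<open>B\<close> allows restriction to strips between hyperbolas.\<close>
lemma nn_integral_kernel_eq_flux:
  assumes om: "stretched g om" and z: "0 \<le> z" and [measurable]: "B \<in> sets borel"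
  shows "(\<integral>\<^sup>+y. ennreal (indicator (hyp_region z) y * indicator B (fst y * snd y) * kernel_integrand \<alpha> om y) \<partial>lborel)
       = (\<integral>\<^sup>+w. ennreal (flux w (g w)) * indicator B w * indicator {z..} w \<partial>lborel)"
proof -
  define f where "f y = ennreal (indicator B (fst y * snd y) * (indicator quadrant y * kernel_integrand \<alpha> om y))" for y
  have prod_meas: "(\<lambda>y. fst y * snd y) \<in> borel_measurable (borel :: (real \<times> real) measure)"
    by (intro borel_measurable_continuous_onI continuous_intros)
  have [measurable]: "f \<in> borel_measurable borel"
    unfolding f_def using stretched_kernel_measurable[OF om] prod_meas by measurable
  have [measurable]: "(\<lambda>s. f (s, w / s)) \<in> borel_measurable borel" for w
  proof -
    have "(\<lambda>s. (s, w / s)) \<in> borel \<rightarrow>\<^sub>M borel \<Otimes>\<^sub>M borel" by measurable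
    then have "(\<lambda>s. (s, w / s)) \<in> borel \<rightarrow>\<^sub>M borel" by (simp only: borel_prod)
    then show ?thesis by measurable
  qed
  have "(\<integral>\<^sup>+y. ennreal (indicator (hyp_region z) y * indicator B (fst y * snd y) * kernel_integrand \<alpha> om y) \<partial>lborel)
      = (\<integral>\<^sup>+y. f y * indicator (hyp_region z) y \<partial>lborel)"
    by (intro nn_integral_cong) (auto simp: f_def indicator_def hyp_region_def)
  also have "\<dots> = (\<integral>\<^sup>+w. (\<integral>\<^sup>+s. f (s, w / s) * ennreal (1 / s) * indicator {0<..} s \<partial>lborel) * indicator {z..} w \<partial>lborel)"
    using z by (intro nn_integral_hyperbolic) auto
  also have "\<dots> = (\<integral>\<^sup>+w. ennreal (flux w (g w)) * indicator B w * indicator {z..} w \<partial>lborel)"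
  proof (intro nn_integral_cong)
    fix w :: real
    show "(\<integral>\<^sup>+s. f (s, w / s) * ennreal (1 / s) * indicator {0<..} s \<partial>lborel) * indicator {z..} w
        = ennreal (flux w (g w)) * indicator B w * indicator {z..} w"
    proof (cases "z \<le> w")
      case True
      then have w: "0 \<le> w" using z by simp
      let ?a = "exp (- g w)"
      have eq: "f (?a * s, w / (?a * s)) * ennreal (1 / s) * indicator {0<..} s
          = ennreal (indicator {0<..} s * flux_integrand w (g w) s) * indicator B w" for s
      proof (cases "s > 0")
        case s: True
        let ?y = "(?a * s, w / (?a * s))"
        have y: "?y \<in> quadrant" "fst ?y * snd ?y = w" using s w by (auto simp: quadrant_def)
        have e: "fst ?y * exp (g w) = s" "snd ?y * exp (- g w) = w / s"
          using s by (simp_all add: exp_minus field_simps)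
        have omy: "om ?y = \<phi> s * \<psi> (w / s)"
          using stretchedD[OF om y(1)] unfolding y(2) e by simp
        have "sqnorm_at w (g w) s = (norm ?y)\<^sup>2"
        proof -
          have "exp (- 2 * g w) = (exp (- g w))\<^sup>2" "exp (2 * g w) = (exp (g w))\<^sup>2"
            by (simp_all only: exp_double[symmetric]) simp
          then show ?thesis
            using s by (simp add: sqnorm_at_def norm_Pair exp_minus power_divide power_mult_distrib field_simps)
        qed
        moreover have ny: "norm ?y > 0" using s by (simp add: zero_less_norm_iff prod_eq_iff)
        ultimately have "sqnorm_at w (g w) s powr (- p) = (norm ?y powr 2) powr (- p)"
          by (simp add: powr_numeral)
        also have "\<dots> = norm ?y powr (- (2 + \<alpha>))" by (simp only: powr_powr) (simp add: p_def)
        also have "\<dots> = 1 / norm ?y powr (2 + \<alpha>)" by (simp only: powr_minus_divide)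
        finally have "kernel_integrand \<alpha> om ?y = \<phi> s * \<psi> (w / s) * sqnorm_at w (g w) s powr (- p)"
          by (simp only: kernel_integrand_def omy) simp
        then have "f ?y = ennreal (indicator B w * (\<phi> s * \<psi> (w / s) * sqnorm_at w (g w) s powr (- p)))"
          unfolding f_def y(2) using y(1) by simp
        also have "\<dots> * ennreal (1 / s) = ennreal (indicator B w * flux_integrand w (g w) s)"
          using s phi_bounds psi_bounds
          by (subst ennreal_mult[symmetric]) (auto simp: flux_integrand_def)
        finally show ?thesis using s by (auto simp: indicator_def)
      qed auto
      have "(\<integral>\<^sup>+s. f (s, w / s) * ennreal (1 / s) * indicator {0<..} s \<partial>lborel)
          = (\<integral>\<^sup>+s. f (?a * s, w / (?a * s)) * ennreal (1 / s) * indicator {0<..} s \<partial>lborel)"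
        by (rule nn_integral_scale_invariant) auto
      also have "\<dots> = (\<integral>\<^sup>+s. ennreal (indicator {0<..} s * flux_integrand w (g w) s) * indicator B w \<partial>lborel)"
        by (simp only: eq)
      also have "\<dots> = ennreal (flux w (g w)) * indicator B w"
      proof -
        have [measurable]: "flux_integrand w (g w) \<in> borel_measurable borel"
          unfolding flux_integrand_def sqnorm_at_def by measurable
        show ?thesis by (subst nn_integral_multc) (auto simp: nn_integral_flux_integrand)
      qed
      finally show ?thesis by simp
    qed simp
  qed
  finally show ?thesis .
qed

lemma integral_shift_flux:
  assumes g: "continuous_on {z..} g" and z0: "0 \<le> z" and z: "z + 3 \<le> b"
  shows "integral {0..3} (\<lambda>\<theta>. flux (z + \<theta>) (g (z + \<theta>))) = integral {z..b} (\<lambda>w. flux w (g w))"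
proof -
  have c: "continuous_on S (\<lambda>w. flux w (g w))" if "S \<subseteq> {z..}" for S
    using g that by (intro continuous_intros) (rule continuous_on_subset)
  have "integral {0..3} (\<lambda>\<theta>. flux (z + \<theta>) (g (z + \<theta>))) = integral {z..z + 3} (\<lambda>w. flux w (g w))"
    using integral_shift_Icc_real[of 0 3 "\<lambda>w. flux w (g w)" z] by (simp add: add.commute o_def)
  moreover have "integral {z + 3..b} (\<lambda>w. flux w (g w)) = integral {z + 3..b} (\<lambda>_. 0)"
    using z0 by (intro integral_cong) (auto simp: flux_eq_0)
  moreover have "integral {z..z + 3} (\<lambda>w. flux w (g w)) + integral {z + 3..b} (\<lambda>w. flux w (g w)) = integral {z..b} (\<lambda>w. flux w (g w))"
    using z by (intro Henstock_Kurzweil_Integration.integral_combine integrable_continuous_interval c) auto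
  ultimately show ?thesis by simp
qed

lemma velocity_integral_eq_flux:
  assumes om: "stretched g om" and g: "continuous_on {0..} g" and z: "0 \<le> z"
  shows "set_integrable lborel (hyp_region z) (kernel_integrand \<alpha> om)"
    and "(LINT y:hyp_region z|lborel. kernel_integrand \<alpha> om y)
           = integral {0..3} (\<lambda>\<theta>. flux (z + \<theta>) (g (z + \<theta>)))"
proof -
  let ?I = "integral {z..z + 3} (\<lambda>w. flux w (g w))"
  let ?k = "\<lambda>y. indicator (hyp_region z) y * kernel_integrand \<alpha> om y"
  have c: "continuous_on S (\<lambda>w. flux w (g w))" if "S \<subseteq> {0..}" for S
    using g that by (intro continuous_intros) (rule continuous_on_subset)
  have gm [measurable]: "(\<lambda>w. indicator {0..} w *\<^sub>R flux w (g w)) \<in> borel_measurable borel"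
    using c by (intro borel_measurable_continuous_on_indicator) auto
  have I: "(\<lambda>w. flux w (g w)) integrable_on {z..z+3}"
    using z by (intro integrable_continuous_interval c) auto
  have I0: "0 \<le> ?I" using I by (intro integral_nonneg) (auto simp: flux_nonneg)
  have "(\<integral>\<^sup>+y. ennreal (?k y) \<partial>lborel) = (\<integral>\<^sup>+w. ennreal (flux w (g w)) * indicator {z..} w \<partial>lborel)"
    using nn_integral_kernel_eq_flux[OF om z, of UNIV] by simp
  also have "\<dots> = (\<integral>\<^sup>+w. ennreal (indicator {z..z+3} w * (indicator {0..} w *\<^sub>R flux w (g w))) \<partial>lborel)"
    using z by (intro nn_integral_cong) (auto simp: indicator_def flux_eq_0)
  also have "\<dots> = ennreal ?I"
  proof (rule nn_integral_indicator_has_integral)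
    have "((\<lambda>w. flux w (g w)) has_integral ?I) {z..z + 3}" using I by (rule integrable_integral)
    then show "((\<lambda>w. indicator {0..} w *\<^sub>R flux w (g w)) has_integral ?I) {z..z + 3}"
      using z by (elim has_integral_eq[rotated]) auto
    show "(\<lambda>w. indicator {0..} w *\<^sub>R flux w (g w)) \<in> borel_measurable borel" by (rule gm)
  qed (auto simp: flux_nonneg)
  finally have nn: "(\<integral>\<^sup>+y. ennreal (?k y) \<partial>lborel) = ennreal ?I" .
  have k0: "0 \<le> ?k y" for y
    using stretched_nonneg[OF om, of y] by (auto simp: indicator_def kernel_integrand_def hyp_region_def)
  have km: "?k \<in> borel_measurable borel"
  proof -
    have "(\<lambda>y. indicator (hyp_region z) y * (indicator quadrant y * kernel_integrand \<alpha> om y)) \<in> borel_measurable borel"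
      using stretched_kernel_measurable[OF om] by measurable
    moreover have "(\<lambda>y. indicator (hyp_region z) y * (indicator quadrant y * kernel_integrand \<alpha> om y)) = ?k"
      by (auto simp: indicator_def hyp_region_def)
    ultimately show ?thesis by simp
  qed
  show "set_integrable lborel (hyp_region z) (kernel_integrand \<alpha> om)"
    unfolding set_integrable_def using km k0 nn by (intro integrableI_nonneg) auto
  have "(LINT y:hyp_region z|lborel. kernel_integrand \<alpha> om y) = enn2real (\<integral>\<^sup>+y. ennreal (?k y) \<partial>lborel)"
    unfolding set_lebesgue_integral_def using km k0 by (subst integral_eq_nn_integral) auto
  also have "\<dots> = ?I" using nn I0 by simp
  also have "\<dots> = integral {0..3} (\<lambda>\<theta>. flux (z + \<theta>) (g (z + \<theta>)))"
    using z by (intro integral_shift_flux[symmetric] continuous_on_subset[OF g]) auto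
  finally show "(LINT y:hyp_region z|lborel. kernel_integrand \<alpha> om y)
           = integral {0..3} (\<lambda>\<theta>. flux (z + \<theta>) (g (z + \<theta>)))" .
qed

text \<open>The identity of integrals on the strip between two hyperbolas, for an exponent that is only bounded
  above.  It is the source of continuity in \<open>z\<close> for the exponent of an arbitrary solution.\<close>
lemma velocity_integral_lipschitz:
  assumes om: "stretched g om" and gM: "\<And>w. 0 \<le> w \<Longrightarrow> g w \<le> M" and z: "0 \<le> z" "z \<le> z'"
    and int: "\<And>w. 0 \<le> w \<Longrightarrow> set_integrable lborel (hyp_region w) (kernel_integrand \<alpha> om)"
  shows "\<bar>(LINT y:hyp_region z|lborel. kernel_integrand \<alpha> om y)
      - (LINT y:hyp_region z'|lborel. kernel_integrand \<alpha> om y)\<bar> \<le> 2 * exp (2 * p * M) * (z' - z)"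
proof -
  let ?k = "\<lambda>z y. indicator (hyp_region z) y *\<^sub>R kernel_integrand \<alpha> om y"
  let ?s = "\<lambda>y. indicator (hyp_region z) y * indicator {..<z'} (fst y * snd y) * kernel_integrand \<alpha> om y"
  have eq: "?k z y - ?k z' y = ?s y" for y
    using z by (auto simp: indicator_def hyp_region_def)
  have i: "integrable lborel (?k z)" "integrable lborel (?k z')"
    using int z unfolding set_integrable_def by auto
  have s0: "0 \<le> ?s y" for y
    using stretched_nonneg[OF om, of y] by (auto simp: indicator_def kernel_integrand_def hyp_region_def)
  have si: "integrable lborel ?s" using Bochner_Integration.integrable_diff[OF i] unfolding eq .
  have "ennreal (LINT y|lborel. ?s y) = (\<integral>\<^sup>+y. ennreal (?s y) \<partial>lborel)"
    using si s0 by (intro nn_integral_eq_integral[symmetric]) auto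
  also have "\<dots> = (\<integral>\<^sup>+w. ennreal (flux w (g w)) * indicator {..<z'} w * indicator {z..} w \<partial>lborel)"
    using om z by (intro nn_integral_kernel_eq_flux) auto
  also have "\<dots> \<le> (\<integral>\<^sup>+w. ennreal (2 * exp (2 * p * M)) * indicator {z..<z'} w \<partial>lborel)"
  proof (intro nn_integral_mono)
    fix w :: real
    show "ennreal (flux w (g w)) * indicator {..<z'} w * indicator {z..} w \<le> ennreal (2 * exp (2 * p * M)) * indicator {z..<z'} w"
    proof (cases "w \<in> {z..<z'}")
      case True
      then have "flux w (g w) \<le> 2 * exp (2 * p * g w)" "g w \<le> M" using flux_le gM z by auto
      then have "flux w (g w) \<le> 2 * exp (2 * p * M)"
        using p_pos by (meson exp_le_cancel_iff mult_le_cancel_left_pos order_trans zero_less_mult_iff zero_less_numeral)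
      then show ?thesis using True by (simp add: ennreal_leI)
    qed (auto simp: indicator_def)
  qed
  also have "\<dots> = ennreal (2 * exp (2 * p * M)) * ennreal (z' - z)"
    using z by (subst nn_integral_cmult_indicator) auto
  also have "\<dots> = ennreal (2 * exp (2 * p * M) * (z' - z))"
    using z by (intro ennreal_mult[symmetric]) auto
  finally have "(LINT y|lborel. ?s y) \<le> 2 * exp (2 * p * M) * (z' - z)"
    using z by (subst (asm) ennreal_le_iff) auto
  moreover have "0 \<le> (LINT y|lborel. ?s y)" using s0 by (intro integral_nonneg_AE) auto
  moreover have "(LINT y:hyp_region z|lborel. kernel_integrand \<alpha> om y)
      - (LINT y:hyp_region z'|lborel. kernel_integrand \<alpha> om y) = (LINT y|lborel. ?s y)"
    unfolding set_lebesgue_integral_def Bochner_Integration.integral_diff[OF i, symmetric] eq ..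
  ultimately show ?thesis by simp
qed

section \<open>The stretching exponent off the axes\<close>

text \<open>The integral of the flux over \<open>w \<ge> z\<close>.  As the flux vanishes for \<open>w \<ge> 3\<close>, the fixed interval
  \<open>0 \<le> w - z \<le> 3\<close> suffices, and \<open>z\<close> enters as a parameter only.\<close>
definition flux_tail :: "(real \<Rightarrow> real \<Rightarrow> real) \<Rightarrow> real \<Rightarrow> real \<Rightarrow> real" where
  "flux_tail h z s = integral {0..3} (\<lambda>\<theta>. flux (z + \<theta>) (h (z + \<theta>) s))"

definition picard :: "(real \<Rightarrow> real \<Rightarrow> real) \<Rightarrow> real \<Rightarrow> real \<Rightarrow> real" where
  "picard h z t = integral {0..t} (flux_tail h z)"

lemma flux_tail_continuous:
  assumes h: "continuous_on (A \<times> I) (\<lambda>x. h (fst x) (snd x))"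
    and A: "\<And>z \<theta>. z \<in> A \<Longrightarrow> 0 \<le> \<theta> \<Longrightarrow> z + \<theta> \<in> A"
  shows "continuous_on (A \<times> I) (\<lambda>x. flux_tail h (fst x) (snd x))"
proof -
  have "continuous_on ((A \<times> I) \<times> {0..3}) (\<lambda>y. h (fst (fst (fst y) + snd y, snd (fst y))) (snd (fst (fst y) + snd y, snd (fst y))))"
    by (rule continuous_on_compose2[OF h, where f = "\<lambda>y. (fst (fst y) + snd y, snd (fst y))"])
      (auto intro!: continuous_intros A)
  then have "continuous_on ((A \<times> I) \<times> cbox 0 3) (\<lambda>(x, \<theta>). flux (fst x + \<theta>) (h (fst x + \<theta>) (snd x)))"
    unfolding split_beta by (intro continuous_intros) auto
  from integral_continuous_on_param[OF this]
  show ?thesis by (simp add: flux_tail_def)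
qed

lemma flux_tail_continuous_time:
  assumes h: "continuous_on (A \<times> I) (\<lambda>x. h (fst x) (snd x))"
    and A: "\<And>z \<theta>. z \<in> A \<Longrightarrow> 0 \<le> \<theta> \<Longrightarrow> z + \<theta> \<in> A" and "z \<in> A" "J \<subseteq> I"
  shows "continuous_on J (flux_tail h z)"
proof -
  have "continuous_on J (\<lambda>s. (z, s))" by (intro continuous_on_Pair continuous_on_const continuous_on_id)
  then have "continuous_on J (\<lambda>s. flux_tail h (fst (z, s)) (snd (z, s)))"
    by (intro continuous_on_compose2[OF flux_tail_continuous[OF h A], of J "Pair z"]) (use assms(3,4) in auto)
  then show ?thesis by simp
qed

lemma slice_continuous:
  assumes h: "continuous_on (A \<times> I) (\<lambda>x. h (fst x) (snd x))" and "s \<in> I" "B \<subseteq> A"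
  shows "continuous_on B (\<lambda>w. h w s)"
proof -
  have "continuous_on B (\<lambda>w. (w, s))" by (intro continuous_on_Pair continuous_on_const continuous_on_id)
  then have "continuous_on B (\<lambda>w. h (fst (w, s)) (snd (w, s)))"
    by (rule continuous_on_compose2[OF h]) (use assms(2,3) in auto)
  then show ?thesis by simp
qed

lemma flux_tail_integrable:
  assumes h: "continuous_on (A \<times> I) (\<lambda>x. h (fst x) (snd x))" and "s \<in> I"
    and A: "\<And>z \<theta>. z \<in> A \<Longrightarrow> 0 \<le> \<theta> \<Longrightarrow> z + \<theta> \<in> A" and "z \<in> A"
  shows "(\<lambda>\<theta>. flux (z + \<theta>) (h (z + \<theta>) s)) integrable_on {0..3}"
proof -
  have "continuous_on {0..3} (\<lambda>\<theta>. h (z + \<theta>) s)"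
  proof (rule continuous_on_compose2[OF slice_continuous[OF h \<open>s \<in> I\<close> subset_refl]])
    show "(+) z ` {0..3} \<subseteq> A" using A[OF \<open>z \<in> A\<close>] by (intro image_subsetI) simp
  qed (intro continuous_intros)
  then show ?thesis
    by (intro integrable_continuous_interval continuous_intros)
qed

lemma picard_continuous:
  assumes h: "continuous_on (A \<times> I) (\<lambda>x. h (fst x) (snd x))"
    and A: "\<And>z \<theta>. z \<in> A \<Longrightarrow> 0 \<le> \<theta> \<Longrightarrow> z + \<theta> \<in> A"
    and I: "\<And>t s. t \<in> I \<Longrightarrow> 0 \<le> s \<Longrightarrow> s \<le> t \<Longrightarrow> s \<in> I" "I \<subseteq> {0..}"
  shows "continuous_on (A \<times> I) (\<lambda>x. picard h (fst x) (snd x))"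
  unfolding picard_def using flux_tail_continuous[OF h A] I by (rule time_integral_continuous)

lemma flux_tail_diff:
  assumes h: "continuous_on ({z..} \<times> I) (\<lambda>x. h (fst x) (snd x))"
    and k: "continuous_on ({z..} \<times> I) (\<lambda>x. k (fst x) (snd x))"
    and z: "0 < z" "z \<le> w" and s: "s \<in> I"
    and le: "\<And>w. z \<le> w \<Longrightarrow> \<bar>h w s - k w s\<bar> \<le> B"
  shows "\<bar>flux_tail h w s - flux_tail k w s\<bar> \<le> 3 * flux_lip z * B"
proof -
  have ih: "(\<lambda>\<theta>. flux (w + \<theta>) (h (w + \<theta>) s)) integrable_on {0..3}"
    and ik: "(\<lambda>\<theta>. flux (w + \<theta>) (k (w + \<theta>) s)) integrable_on {0..3}"
    using z s by (auto intro: flux_tail_integrable[OF h] flux_tail_integrable[OF k])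
  have "norm (integral {0..3} (\<lambda>\<theta>. flux (w + \<theta>) (h (w + \<theta>) s) - flux (w + \<theta>) (k (w + \<theta>) s)))
      \<le> integral {0..3} (\<lambda>_::real. flux_lip z * B)"
  proof (rule integral_norm_bound_integral)
    fix \<theta> :: real assume "\<theta> \<in> {0..3}"
    then have w: "z \<le> w + \<theta>" using z by simp
    have "\<bar>flux (w + \<theta>) (h (w + \<theta>) s) - flux (w + \<theta>) (k (w + \<theta>) s)\<bar> \<le> flux_lip z * \<bar>h (w + \<theta>) s - k (w + \<theta>) s\<bar>"
      using z(1) w by (rule flux_lipschitz)
    also have "\<dots> \<le> flux_lip z * B" using le[OF w] flux_lip_nonneg by (intro mult_left_mono)
    finally show "norm (flux (w + \<theta>) (h (w + \<theta>) s) - flux (w + \<theta>) (k (w + \<theta>) s)) \<le> flux_lip z * B" by simp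
  qed (use ih ik in \<open>auto intro: integrable_diff\<close>)
  moreover have "flux_tail h w s - flux_tail k w s =
      integral {0..3} (\<lambda>\<theta>. flux (w + \<theta>) (h (w + \<theta>) s) - flux (w + \<theta>) (k (w + \<theta>) s))"
    unfolding flux_tail_def using ih ik by (rule integral_diff[symmetric])
  ultimately show ?thesis by simp
qed

text \<open>The step of the Picard estimate.  It is confined to a half line \<open>w \<ge> z\<close>, which \<open>picard\<close> maps to
  itself and on which the Lipschitz constant is finite.\<close>
lemma picard_diff:
  assumes h: "continuous_on ({z..} \<times> {0..t1}) (\<lambda>x. h (fst x) (snd x))"
    and k: "continuous_on ({z..} \<times> {0..t1}) (\<lambda>x. k (fst x) (snd x))"
    and z: "0 < z" "z \<le> w" and t: "0 \<le> t" "t \<le> t1"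
    and le: "\<And>w s. z \<le> w \<Longrightarrow> 0 \<le> s \<Longrightarrow> s \<le> t1 \<Longrightarrow> \<bar>h w s - k w s\<bar> \<le> M * (3 * flux_lip z * s) ^ n / fact n"
  shows "\<bar>picard h w t - picard k w t\<bar> \<le> M * (3 * flux_lip z * t) ^ Suc n / fact (Suc n)"
proof -
  have ih: "flux_tail h w integrable_on {0..t}" and ik: "flux_tail k w integrable_on {0..t}"
    using z t by (auto intro!: integrable_continuous_interval flux_tail_continuous_time[OF h] flux_tail_continuous_time[OF k])
  note I = has_integral_power_over_fact[OF t(1), of "3 * flux_lip z" M n]
  have "norm (integral {0..t} (\<lambda>s. flux_tail h w s - flux_tail k w s))
      \<le> integral {0..t} (\<lambda>s. 3 * flux_lip z * (M * (3 * flux_lip z * s) ^ n / fact n))"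
  proof (rule integral_norm_bound_integral)
    fix s assume s: "s \<in> {0..t}"
    show "norm (flux_tail h w s - flux_tail k w s) \<le> 3 * flux_lip z * (M * (3 * flux_lip z * s) ^ n / fact n)"
      unfolding real_norm_def using s t le by (intro flux_tail_diff[OF h k z]) auto
  qed (use ih ik I in \<open>auto intro: integrable_diff\<close>)
  moreover have "picard h w t - picard k w t = integral {0..t} (\<lambda>s. flux_tail h w s - flux_tail k w s)"
    unfolding picard_def using ih ik by (rule integral_diff[symmetric])
  ultimately show ?thesis unfolding integral_unique[OF I] by simp
qed

lemma flux_le_far:
  assumes "0 < z" "z \<le> w"
  shows "flux w g \<le> 2 * (2 * z) powr (- p)"
  unfolding flux_def
proof (rule integral_le_bound_13[OF flux_integrand_integrable])
  fix s :: real assume s: "s \<in> {1..3}"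
  have "flux_integrand w g s \<le> 1 * (2 * z) powr (- p)"
    unfolding flux_integrand_def using s sqnorm_at_ge_w[of s w g] p_pos phi_bounds psi_bounds assms
    by (intro mult_mono flux_integrand_factor_le powr_mono2') auto
  then show "flux_integrand w g s \<le> (2 * z) powr (- p)" by simp
qed

lemma picard_bounds:
  assumes h: "continuous_on ({z..} \<times> {0..t}) (\<lambda>x. h (fst x) (snd x))"
    and w: "z \<le> w" "0 \<le> t" and le: "\<And>w s. z \<le> w \<Longrightarrow> 0 \<le> s \<Longrightarrow> s \<le> t \<Longrightarrow> flux w (h w s) \<le> B"
  shows "0 \<le> picard h w t" "picard h w t \<le> 3 * B * t"
proof -
  have tail: "0 \<le> flux_tail h w s \<and> flux_tail h w s \<le> 3 * B" if s: "s \<in> {0..t}" for s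
  proof
    have I: "(\<lambda>\<theta>. flux (w + \<theta>) (h (w + \<theta>) s)) integrable_on {0..3}"
      using w s by (auto intro: flux_tail_integrable[OF h])
    show "0 \<le> flux_tail h w s"
      unfolding flux_tail_def using I by (intro integral_nonneg) (auto simp: flux_nonneg)
    have "flux_tail h w s \<le> integral {0..3} (\<lambda>_::real. B)"
      unfolding flux_tail_def using I le w s by (intro integral_le) auto
    then show "flux_tail h w s \<le> 3 * B" by simp
  qed
  have I: "flux_tail h w integrable_on {0..t}"
    using w by (auto intro!: integrable_continuous_interval flux_tail_continuous_time[OF h])
  show "0 \<le> picard h w t"
    unfolding picard_def using I tail by (intro integral_nonneg) auto
  have "picard h w t \<le> integral {0..t} (\<lambda>_::real. 3 * B)"
    unfolding picard_def using I tail by (intro integral_le) auto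
  then show "picard h w t \<le> 3 * B * t" using w by (simp add: mult_ac)
qed

lemma picard_unique:
  assumes h: "continuous_on ({z..} \<times> {0..t1}) (\<lambda>x. h (fst x) (snd x))"
    and k: "continuous_on ({z..} \<times> {0..t1}) (\<lambda>x. k (fst x) (snd x))"
    and z: "0 < z"
    and heq: "\<And>w s. z \<le> w \<Longrightarrow> 0 \<le> s \<Longrightarrow> s \<le> t1 \<Longrightarrow> h w s = picard h w s"
    and keq: "\<And>w s. z \<le> w \<Longrightarrow> 0 \<le> s \<Longrightarrow> s \<le> t1 \<Longrightarrow> k w s = picard k w s"
    and w: "z \<le> w" and t: "0 \<le> t" "t \<le> t1"
  shows "h w t = k w t"
proof -
  define M where "M = 3 * (2 * (2 * z) powr (- p)) * t1"
  have bound: "0 \<le> f w s \<and> f w s \<le> M"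
    if f: "continuous_on ({z..} \<times> {0..t1}) (\<lambda>x. f (fst x) (snd x))"
      and feq: "\<And>w s. z \<le> w \<Longrightarrow> 0 \<le> s \<Longrightarrow> s \<le> t1 \<Longrightarrow> f w s = picard f w s"
      and w: "z \<le> w" "0 \<le> s" "s \<le> t1" for f w s
  proof -
    have "continuous_on ({z..} \<times> {0..s}) (\<lambda>x. f (fst x) (snd x))"
      using f by (rule continuous_on_subset) (use w in auto)
    from picard_bounds[OF this w(1,2) flux_le_far[OF z]]
    have "0 \<le> f w s" "f w s \<le> 3 * (2 * (2 * z) powr (- p)) * s" using feq[OF w] by auto
    moreover have "3 * (2 * (2 * z) powr (- p)) * s \<le> M"
      unfolding M_def using w by (intro mult_left_mono) auto
    ultimately show ?thesis by linarith
  qed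
  have "\<forall>w s. z \<le> w \<longrightarrow> 0 \<le> s \<longrightarrow> s \<le> t1 \<longrightarrow> \<bar>h w s - k w s\<bar> \<le> M * (3 * flux_lip z * s) ^ n / fact n" for n
  proof (induction n)
    case 0
    show ?case
    proof (intro allI impI)
      fix w s
      show "\<bar>h w s - k w s\<bar> \<le> M * (3 * flux_lip z * s) ^ 0 / fact 0" if "z \<le> w" "0 \<le> s" "s \<le> t1"
      proof -
        note ws = that
        have "0 \<le> h w s" "h w s \<le> M" using bound[OF h heq ws] by blast+
        moreover have "0 \<le> k w s" "k w s \<le> M" using bound[OF k keq ws] by blast+
        ultimately have "\<bar>h w s - k w s\<bar> \<le> M" by linarith
        then show "\<bar>h w s - k w s\<bar> \<le> M * (3 * flux_lip z * s) ^ 0 / fact 0" by simp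
      qed
    qed
  next
    case (Suc n)
    show ?case
    proof (intro allI impI)
      fix w s assume ws: "z \<le> w" "0 \<le> s" "s \<le> t1"
      have "\<bar>picard h w s - picard k w s\<bar> \<le> M * (3 * flux_lip z * s) ^ Suc n / fact (Suc n)"
        using ws Suc by (intro picard_diff[OF h k z]) auto
      then show "\<bar>h w s - k w s\<bar> \<le> M * (3 * flux_lip z * s) ^ Suc n / fact (Suc n)"
        using heq[OF ws] keq[OF ws] by simp
    qed
  qed
  then have le: "\<bar>h w t - k w t\<bar> \<le> M * ((3 * flux_lip z * t) ^ n / fact n)" for n
    using w t by simp
  have "(\<lambda>n. (3 * flux_lip z * t) ^ n / fact n) \<longlonglongrightarrow> 0"
    using summable_LIMSEQ_zero[OF summable_exp_generic[of "3 * flux_lip z * t"]]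
    by (simp add: divide_inverse mult.commute)
  from tendsto_mult_left[OF this, of M]
  have "\<bar>h w t - k w t\<bar> \<le> 0"
    using le by (intro LIMSEQ_le_const[of _ 0]) auto
  then show ?thesis by simp
qed

primrec picard_iterate :: "nat \<Rightarrow> real \<Rightarrow> real \<Rightarrow> real" where
  "picard_iterate 0 = (\<lambda>_ _. 0)"
| "picard_iterate (Suc n) = picard (picard_iterate n)"

text \<open>The limit of the Picard iterates, written as a telescoping series for the Weierstrass test.\<close>
definition exponent :: "real \<Rightarrow> real \<Rightarrow> real" where
  "exponent z t = (\<Sum>n. picard_iterate (Suc n) z t - picard_iterate n z t)"

lemma picard_iterate_continuous:
  "continuous_on ({0<..} \<times> {0..}) (\<lambda>x. picard_iterate n (fst x) (snd x))"
proof (induction n)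
  case (Suc n)
  show ?case unfolding picard_iterate.simps
    by (rule picard_continuous[OF Suc]) auto
qed simp

lemma picard_iterate_step:
  assumes z: "0 < z" and w: "z \<le> w" and t: "0 \<le> t" "t \<le> t1"
  shows "\<bar>picard_iterate (Suc n) w t - picard_iterate n w t\<bar> \<le> 6 * t1 * (3 * flux_lip z * t) ^ n / fact n"
  using w t
proof (induction n arbitrary: w t)
  case 0
  have "flux w 0 \<le> 2" for w using flux_le[of w 0] by simp
  then have "0 \<le> picard (\<lambda>_ _. 0) w t"
    using 0 by (intro picard_bounds(1)[where z = w and B = 2]) auto
  moreover have "picard (\<lambda>_ _. 0) w t \<le> 3 * 2 * t"
    using 0 \<open>\<And>w. flux w 0 \<le> 2\<close> by (intro picard_bounds(2)[where z = w]) auto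
  ultimately show ?case using 0 by simp
next
  case (Suc n)
  have c: "continuous_on ({z..} \<times> {0..t1}) (\<lambda>x. picard_iterate n (fst x) (snd x))" for n
    using picard_iterate_continuous by (rule continuous_on_subset) (use z in auto)
  show ?case
    using picard_diff[OF c[of "Suc n"] c[of n] z, of w t "6 * t1" n] Suc by simp
qed

lemma picard_iterate_uniform_limit:
  assumes z: "0 < z" and "0 \<le> t1"
  shows "uniform_limit ({z..} \<times> {0..t1}) (\<lambda>n x. picard_iterate n (fst x) (snd x))
           (\<lambda>x. exponent (fst x) (snd x)) sequentially"
proof -
  have "summable (\<lambda>n. 6 * t1 * (3 * flux_lip z * t1) ^ n / fact n)"
    using summable_mult[OF summable_exp_generic[of "3 * flux_lip z * t1"], of "6 * t1"]
    by (simp add: divide_inverse mult_ac)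
  moreover have "norm (picard_iterate (Suc n) (fst x) (snd x) - picard_iterate n (fst x) (snd x))
      \<le> 6 * t1 * (3 * flux_lip z * t1) ^ n / fact n" if "x \<in> {z..} \<times> {0..t1}" for n x
  proof -
    have "\<bar>picard_iterate (Suc n) (fst x) (snd x) - picard_iterate n (fst x) (snd x)\<bar>
        \<le> 6 * t1 * (3 * flux_lip z * snd x) ^ n / fact n"
      using that by (intro picard_iterate_step[OF z]) auto
    also have "\<dots> \<le> 6 * t1 * (3 * flux_lip z * t1) ^ n / fact n"
      using that \<open>0 \<le> t1\<close> flux_lip_nonneg[of z]
      by (intro divide_right_mono mult_left_mono power_mono) auto
    finally show ?thesis by simp
  qed
  ultimately have "uniform_limit ({z..} \<times> {0..t1})
      (\<lambda>n x. \<Sum>i<n. picard_iterate (Suc i) (fst x) (snd x) - picard_iterate i (fst x) (snd x))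
      (\<lambda>x. \<Sum>i. picard_iterate (Suc i) (fst x) (snd x) - picard_iterate i (fst x) (snd x)) sequentially"
    by (rule Weierstrass_m_test[rotated])
  moreover have "(\<Sum>i<n. picard_iterate (Suc i) z t - picard_iterate i z t) = picard_iterate n z t" for n z t
    using sum_lessThan_telescope[of "\<lambda>i. picard_iterate i z t" n] by simp
  ultimately show ?thesis by (simp only: exponent_def)
qed

lemma exponent_continuous:
  "continuous_on ({0<..} \<times> {0..}) (\<lambda>x. exponent (fst x) (snd x))"
proof (rule continuous_on_locally)
  fix x :: "real \<times> real" assume x: "x \<in> {0<..} \<times> {0..}"
  let ?U = "{fst x / 2<..} \<times> {..<snd x + 1}"
  have "continuous_on ({fst x / 2..} \<times> {0..snd x + 1}) (\<lambda>x. exponent (fst x) (snd x))"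
  proof (rule uniform_limit_theorem[OF _ picard_iterate_uniform_limit])
    show "\<forall>\<^sub>F n in sequentially. continuous_on ({fst x / 2..} \<times> {0..snd x + 1}) (\<lambda>x. picard_iterate n (fst x) (snd x))"
      using x by (intro always_eventually allI continuous_on_subset[OF picard_iterate_continuous]) auto
  qed (use x in auto)
  then have "continuous_on (({0<..} \<times> {0..}) \<inter> ?U) (\<lambda>x. exponent (fst x) (snd x))"
    by (rule continuous_on_subset) auto
  moreover have "open ?U" "x \<in> ?U" using x by (auto intro!: open_Times simp: mem_Times_iff)
  ultimately show "\<exists>U. open U \<and> x \<in> U \<and> continuous_on (({0<..} \<times> {0..}) \<inter> U) (\<lambda>x. exponent (fst x) (snd x))"
    by (intro exI[of _ ?U] conjI)
qed

lemma exponent_eq_picard: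
  assumes z: "0 < z" and t: "0 \<le> t"
  shows "exponent z t = picard exponent z t"
proof (rule LIMSEQ_unique)
  have "(z, t) \<in> {z..} \<times> {0..t}" using t by simp
  from tendsto_uniform_limitI[OF picard_iterate_uniform_limit[OF z t] this]
  have "(\<lambda>n. picard_iterate n z t) \<longlonglongrightarrow> exponent z t" by simp
  then show "(\<lambda>n. picard_iterate (Suc n) z t) \<longlonglongrightarrow> exponent z t" by (rule LIMSEQ_Suc)
  have c: "continuous_on ({z..} \<times> {0..t}) (\<lambda>x. picard_iterate n (fst x) (snd x))" for n
    using picard_iterate_continuous by (rule continuous_on_subset) (use z in auto)
  have ce: "continuous_on ({z..} \<times> {0..t}) (\<lambda>x. exponent (fst x) (snd x))"
    using exponent_continuous by (rule continuous_on_subset) (use z in auto)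
  show "(\<lambda>n. picard_iterate (Suc n) z t) \<longlonglongrightarrow> picard exponent z t"
  proof (rule LIMSEQ_I)
    fix r :: real assume r: "0 < r"
    define e where "e = r / (3 * flux_lip z * t + 1)"
    have k: "0 \<le> 3 * flux_lip z * t" using flux_lip_nonneg t by simp
    then have e: "0 < e" using r by (simp add: e_def add_nonneg_pos)
    from uniform_limitD[OF picard_iterate_uniform_limit[OF z t] e]
    obtain N where N: "\<And>n x. n \<ge> N \<Longrightarrow> x \<in> {z..} \<times> {0..t} \<Longrightarrow> dist (picard_iterate n (fst x) (snd x)) (exponent (fst x) (snd x)) < e"
      unfolding eventually_sequentially by blast
    show "\<exists>N. \<forall>n\<ge>N. norm (picard_iterate (Suc n) z t - picard exponent z t) < r"
    proof (intro exI allI impI)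
      fix n assume n: "N \<le> n"
      have le: "\<bar>picard_iterate n w s - exponent w s\<bar> \<le> e * (3 * flux_lip z * s) ^ 0 / fact 0"
        if "z \<le> w" "0 \<le> s" "s \<le> t" for w s
        using N[OF n, of "(w, s)"] that by (simp add: dist_real_def)
      have "\<bar>picard (picard_iterate n) z t - picard exponent z t\<bar> \<le> e * (3 * flux_lip z * t) ^ Suc 0 / fact (Suc 0)"
        using t le by (intro picard_diff[OF c ce z]) auto
      also have "\<dots> < e * (3 * flux_lip z * t + 1)" using e by simp
      also have "\<dots> = r" unfolding e_def using k by (simp add: add_nonneg_pos[THEN less_imp_neq, symmetric])
      finally show "norm (picard_iterate (Suc n) z t - picard exponent z t) < r" by simp
    qed
  qed
qed

section \<open>The front reaches the axes in finite time\<close>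

lemma flux_tail_split:
  assumes h: "continuous_on {z..} (\<lambda>w. h w s)" and z: "0 \<le> z" "z \<le> z'"
  shows "flux_tail h z s = integral {z..z'} (\<lambda>w. flux w (h w s)) + flux_tail h z' s"
proof -
  have h': "continuous_on {z'..} (\<lambda>w. h w s)" using h by (rule continuous_on_subset) (use z in auto)
  have "flux_tail h z s = integral {z..z' + 3} (\<lambda>w. flux w (h w s))"
    unfolding flux_tail_def using h z by (intro integral_shift_flux[where g = "\<lambda>w. h w s"]) auto
  moreover have "flux_tail h z' s = integral {z'..z' + 3} (\<lambda>w. flux w (h w s))"
    unfolding flux_tail_def using h' z by (intro integral_shift_flux[where g = "\<lambda>w. h w s"]) auto
  moreover have "continuous_on {z..z' + 3} (\<lambda>w. flux w (h w s))"
    using h by (intro continuous_intros) (rule continuous_on_subset, auto)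
  then have "integral {z..z'} (\<lambda>w. flux w (h w s)) + integral {z'..z' + 3} (\<lambda>w. flux w (h w s))
      = integral {z..z' + 3} (\<lambda>w. flux w (h w s))"
    using z by (intro Henstock_Kurzweil_Integration.integral_combine integrable_continuous_interval) auto
  ultimately show ?thesis by simp
qed

lemma exponent_slice_continuous: "0 \<le> t \<Longrightarrow> 0 < z \<Longrightarrow> continuous_on {z..} (\<lambda>w. exponent w t)"
  by (rule slice_continuous[OF exponent_continuous]) auto

lemma exponent_flux_integrable: "0 \<le> t \<Longrightarrow> 0 < z \<Longrightarrow> (\<lambda>w. flux w (exponent w t)) integrable_on {z..z'}"
  using exponent_slice_continuous[of t z]
  by (intro integrable_continuous_interval continuous_intros) (rule continuous_on_subset, auto)

lemma exponent_tail_nonneg: "0 \<le> t \<Longrightarrow> 0 < z \<Longrightarrow> 0 \<le> flux_tail exponent z t"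
  unfolding flux_tail_def
  by (intro integral_nonneg flux_tail_integrable[OF exponent_continuous]) (auto simp: flux_nonneg)

lemma exponent_tail_antimono:
  assumes "0 \<le> t" "0 < z" "z \<le> z'"
  shows "flux_tail exponent z' t \<le> flux_tail exponent z t"
proof -
  have "0 \<le> integral {z..z'} (\<lambda>w. flux w (exponent w t))"
    using assms by (intro integral_nonneg exponent_flux_integrable) (auto simp: flux_nonneg)
  then show ?thesis
    using flux_tail_split[where h = exponent, OF exponent_slice_continuous, of t z z'] assms by simp
qed

lemma exponent_tail_integrable:
  assumes "0 < z" "0 \<le> s"
  shows "flux_tail exponent z integrable_on {s..t}"
  using assms by (intro integrable_continuous_interval flux_tail_continuous_time[OF exponent_continuous]) auto

lemma exponent_diff:
  assumes "0 < z" "0 \<le> s" "s \<le> t"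
  shows "exponent z t - exponent z s = integral {s..t} (flux_tail exponent z)"
proof -
  have "integral {0..s} (flux_tail exponent z) + integral {s..t} (flux_tail exponent z)
      = integral {0..t} (flux_tail exponent z)"
    using assms by (intro Henstock_Kurzweil_Integration.integral_combine exponent_tail_integrable) auto
  then show ?thesis
    using exponent_eq_picard[of z t] exponent_eq_picard[of z s] assms by (simp add: picard_def)
qed

lemma exponent_0: "0 < z \<Longrightarrow> exponent z 0 = 0"
  by (simp add: exponent_eq_picard picard_def)

lemma exponent_mono_time:
  assumes "0 < z" "0 \<le> s" "s \<le> t"
  shows "exponent z s \<le> exponent z t"
proof -
  have "0 \<le> integral {s..t} (flux_tail exponent z)"
    using assms by (intro integral_nonneg exponent_tail_integrable) (auto intro: exponent_tail_nonneg)
  then show ?thesis using exponent_diff[OF assms] by simp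
qed

lemma exponent_antimono:
  assumes "0 < z" "z \<le> z'" "0 \<le> t"
  shows "exponent z' t \<le> exponent z t"
  unfolding exponent_eq_picard[OF assms(1,3)] exponent_eq_picard[OF less_le_trans[OF assms(1,2)] assms(3)] picard_def
  using assms by (intro integral_le exponent_tail_integrable) (auto intro: exponent_tail_antimono)

definition front_ratio :: real where "front_ratio = 2 powr (- (\<alpha> / 2))"

text \<open>The \<open>k\<close>-th crossing takes at most \<open>(ln 2 / 2) / (flux_low / 2 * 2 powr (k \<alpha> / 2))\<close>.\<close>
definition front_time :: "nat \<Rightarrow> real" where
  "front_time n = ln 2 / flux_low * (\<Sum>k<n. front_ratio ^ k)"

lemma front_ratio: "0 < front_ratio" "front_ratio < 1"
  using alpha powr_less_mono[of "- (\<alpha> / 2)" 0 2] by (auto simp: front_ratio_def)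

lemma front_time_nonneg: "0 \<le> front_time n"
  using flux_low_pos front_ratio by (simp add: front_time_def sum_nonneg)

lemma front_time_le: "front_time n \<le> ln 2 / flux_low * (1 / (1 - front_ratio))"
proof -
  have "(\<Sum>k<n. front_ratio ^ k) \<le> (\<Sum>k. front_ratio ^ k)"
    using front_ratio by (intro sum_le_suminf summable_geometric) auto
  also have "\<dots> = 1 / (1 - front_ratio)" using front_ratio by (intro suminf_geometric) auto
  finally show ?thesis unfolding front_time_def using flux_low_pos by (intro mult_left_mono) auto
qed

text \<open>While the exponent at \<open>2 ^ - Suc n\<close> is below its threshold, monotonicity in \<open>w\<close> and in time
  puts the exponent on all of the strip \<open>2 ^ - Suc n \<le> w \<le> 2 ^ - n\<close> between the thresholds of its
  two ends, where the flux is large.  The strip then pushes the exponent at \<open>2 ^ - Suc n\<close> at a rate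
  of order \<open>2 ^ (n \<alpha> / 2)\<close> over the remaining \<open>ln 2 / 2\<close>, so the crossing times form a convergent
  geometric series.\<close>
lemma front_passes: "real n * ln 2 / 2 \<le> exponent ((1/2) ^ n) (front_time n)"
proof (induction n)
  case 0
  show ?case by (simp add: front_time_def exponent_0)
next
  case (Suc n)
  let ?z = "(1/2 :: real) ^ Suc n" and ?y = "(1/2 :: real) ^ n"
  let ?t = "front_time (Suc n)" and ?s = "front_time n"
  \<comment> \<open>width \<open>2 ^ - Suc n\<close> of the strip times the lower bound \<open>flux_low * (2 ^ n) powr p\<close> of the flux\<close>
  define \<rho> where "\<rho> = flux_low / 2 * (2 ^ n) powr (\<alpha> / 2)"
  have dt: "?t = ?s + ln 2 / flux_low * front_ratio ^ n"
    by (simp add: front_time_def distrib_left)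
  then have st: "?s \<le> ?t" using flux_low_pos front_ratio by simp
  show ?case
  proof (rule ccontr)
    assume "\<not> ?thesis"
    then have below: "exponent ?z ?t < real (Suc n) * ln 2 / 2" by simp
    have tail: "\<rho> \<le> flux_tail exponent ?z t" if t: "t \<in> {?s..?t}" for t
    proof -
      have t0: "0 \<le> t" using t front_time_nonneg[of n] by simp
      have fl: "flux_low * (2 ^ n) powr p \<le> flux w (exponent w t)" if w: "w \<in> {?z..?y}" for w
      proof (rule flux_ge)
        have w0: "0 < ?z" "0 < w" using w by (auto intro: less_le_trans[of _ ?z])
        show "0 \<le> w" "w \<le> ?y" using w w0 by auto
        have "exponent ?y ?s \<le> exponent ?y t" using t front_time_nonneg by (intro exponent_mono_time) auto
        also have "\<dots> \<le> exponent w t" using w w0 t0 by (intro exponent_antimono) auto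
        finally show "real n * ln 2 / 2 \<le> exponent w t" using Suc by simp
        have "exponent w t \<le> exponent ?z t" using w w0 t0 by (intro exponent_antimono) auto
        also have "\<dots> \<le> exponent ?z ?t" using t t0 by (intro exponent_mono_time) auto
        finally show "exponent w t \<le> real (Suc n) * ln 2 / 2" using below by simp
      qed
      have "\<rho> = integral {?z..?y} (\<lambda>_::real. flux_low * (2 ^ n) powr p)"
      proof -
        have "(2 ^ n :: real) powr p = 2 ^ n * (2 ^ n) powr (\<alpha> / 2)"
          by (simp add: p_def powr_add)
        then show ?thesis by (simp add: \<rho>_def power_one_over field_simps)
      qed
      also have "\<dots> \<le> integral {?z..?y} (\<lambda>w. flux w (exponent w t))"
        using fl t0 by (intro integral_le exponent_flux_integrable) auto
      also have "\<dots> \<le> flux_tail exponent ?z t"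
        using flux_tail_split[where h = exponent, OF exponent_slice_continuous, of t ?z ?y]
          exponent_tail_nonneg[of t ?y] t0 by simp
      finally show ?thesis .
    qed
    have "integral {?s..?t} (\<lambda>_::real. \<rho>) \<le> integral {?s..?t} (flux_tail exponent ?z)"
      using tail front_time_nonneg[of n] by (intro integral_le exponent_tail_integrable) auto
    also have "\<dots> = exponent ?z ?t - exponent ?z ?s"
      using st front_time_nonneg[of n] by (intro exponent_diff[symmetric]) auto
    finally have "(?t - ?s) * \<rho> \<le> exponent ?z ?t - exponent ?z ?s"
      using st by simp
    moreover have "(?t - ?s) * \<rho> = ln 2 / 2"
    proof -
      have "front_ratio ^ n * (2 ^ n) powr (\<alpha> / 2) = 1"
      proof -
        have "(2 ^ n :: real) powr (\<alpha> / 2) = (2 powr (\<alpha> / 2)) ^ n"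
          by (simp add: powr_realpow[symmetric] powr_powr mult.commute)
        then show ?thesis by (simp add: front_ratio_def power_mult_distrib[symmetric] powr_add[symmetric])
      qed
      then show ?thesis unfolding dt \<rho>_def using flux_low_pos
        by (simp add: field_simps)
    qed
    moreover have "real n * ln 2 / 2 \<le> exponent ?z ?s"
      using Suc exponent_antimono[of ?z ?y ?s] front_time_nonneg[of n] by simp
    ultimately show False using below by (simp add: field_simps)
  qed
qed

section \<open>The blow-up time\<close>

definition bounded_at :: "real \<Rightarrow> bool" where
  "bounded_at t \<longleftrightarrow> 0 \<le> t \<and> (\<exists>M. \<forall>z>0. exponent z t \<le> M)"

definition blowup_time :: real where
  "blowup_time = Sup {t. bounded_at t}"

lemma bounded_at_mono: "bounded_at t \<Longrightarrow> 0 \<le> s \<Longrightarrow> s \<le> t \<Longrightarrow> bounded_at s"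
  unfolding bounded_at_def by (meson exponent_mono_time order_trans)

lemma bounded_at_less:
  assumes "bounded_at t"
  shows "t < ln 2 / flux_low * (1 / (1 - front_ratio))" (is "_ < ?T")
proof (rule ccontr)
  assume "\<not> ?thesis"
  then have T: "?T \<le> t" by simp
  obtain M where M: "\<And>z. 0 < z \<Longrightarrow> exponent z t \<le> M" and t: "0 \<le> t"
    using assms by (auto simp: bounded_at_def)
  have le: "real n * (ln 2 / 2) \<le> M" for n
  proof -
    have "exponent ((1/2) ^ n) (front_time n) \<le> exponent ((1/2) ^ n) t"
      using front_time_nonneg front_time_le[of n] T by (intro exponent_mono_time) auto
    then show ?thesis using front_passes[of n] M[of "(1/2) ^ n"] by simp
  qed
  obtain n where "M < real n * (ln 2 / 2)"
    using reals_Archimedean3[of "ln (2::real) / 2"] by auto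
  then show False using le[of n] by simp
qed

lemma bounded_at_bdd_above: "bdd_above {t. bounded_at t}"
  using bounded_at_less by (intro bdd_aboveI[of _ "ln 2 / flux_low * (1 / (1 - front_ratio))"]) (auto intro: less_imp_le)

text \<open>A bound \<open>M\<close> at one time persists, as \<open>M + 1\<close>, for a time that depends on \<open>M\<close> only:
  by monotonicity a bound for the exponent at \<open>z\<close> controls the flux through all
  hyperbolas beyond \<open>z\<close>.\<close>
lemma bounded_at_extend:
  assumes M: "\<And>z. 0 < z \<Longrightarrow> exponent z t0 \<le> M" and t0: "0 \<le> t0"
  shows "\<exists>\<epsilon>>0. bounded_at (t0 + \<epsilon>)"
proof -
  \<comment> \<open>the flux is at most \<open>K\<close> on an interval of length \<open>3\<close> while the exponent is at most \<open>M + 1\<close>;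
    in time \<open>\<epsilon>\<close> the exponent then grows by at most \<open>3 K \<epsilon> = 1 / 2\<close>\<close>
  define K where "K = 2 * exp (2 * p * (M + 1))"
  define \<epsilon> where "\<epsilon> = 1 / (6 * K)"
  have K: "0 < K" by (simp add: K_def)
  then have \<epsilon>: "0 < \<epsilon>" by (simp add: \<epsilon>_def)
  have "exponent z (t0 + \<epsilon>) \<le> M + 1" if z: "0 < z" for z
  proof (rule ccontr)
    assume "\<not> ?thesis"
    then have gt: "M + 1 \<le> exponent z (t0 + \<epsilon>)" by simp
    have "continuous_on {t0..t0 + \<epsilon>} (\<lambda>s. exponent (fst (z, s)) (snd (z, s)))"
      by (rule continuous_on_compose2[OF exponent_continuous]) (use z t0 in \<open>auto intro!: continuous_intros\<close>)
    then have "continuous_on {t0..t0 + \<epsilon>} (exponent z)" by simp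
    with gt M[OF z] \<epsilon> obtain s where s: "t0 \<le> s" "s \<le> t0 + \<epsilon>" "exponent z s = M + 1"
      using IVT'[of "exponent z" t0 "M + 1" "t0 + \<epsilon>"] by auto
    have tail: "flux_tail exponent z r \<le> 3 * K" if r: "r \<in> {t0..s}" for r
    proof -
      have r0: "0 \<le> r" using r t0 by simp
      have "flux_tail exponent z r \<le> integral {0..3} (\<lambda>_::real. K)"
        unfolding flux_tail_def
      proof (intro integral_le flux_tail_integrable[OF exponent_continuous])
        fix \<theta> :: real assume th: "\<theta> \<in> {0..3}"
        have "exponent (z + \<theta>) r \<le> exponent z r" using th z r0 by (intro exponent_antimono) auto
        also have "\<dots> \<le> exponent z s" using r r0 z by (intro exponent_mono_time) auto
        finally have "exponent (z + \<theta>) r \<le> M + 1" using s by simp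
        then have "2 * p * exponent (z + \<theta>) r \<le> 2 * p * (M + 1)" using p_pos by (intro mult_left_mono) auto
        then show "flux (z + \<theta>) (exponent (z + \<theta>) r) \<le> K"
          using flux_le[of "z + \<theta>" "exponent (z + \<theta>) r"] unfolding K_def
          by (intro order_trans[OF flux_le]) simp
      qed (use z r0 in auto)
      then show ?thesis by simp
    qed
    have "exponent z s - exponent z t0 = integral {t0..s} (flux_tail exponent z)"
      using z t0 s by (intro exponent_diff) auto
    also have "\<dots> \<le> integral {t0..s} (\<lambda>_::real. 3 * K)"
      using tail z t0 by (intro integral_le exponent_tail_integrable) auto
    also have "\<dots> = 3 * K * (s - t0)" using s by simp
    also have "\<dots> \<le> 3 * K * \<epsilon>" using s K by (intro mult_left_mono) auto
    also have "\<dots> = 1 / 2" using K by (simp add: \<epsilon>_def)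
    finally show False using s M[OF z] by simp
  qed
  then have "bounded_at (t0 + \<epsilon>)" using t0 \<epsilon> by (auto simp: bounded_at_def)
  then show ?thesis using \<epsilon> by blast
qed

lemma bounded_at_0: "bounded_at 0"
  by (auto simp: bounded_at_def exponent_0 intro!: exI[of _ 0])

lemma bounded_at_imp_less_blowup_time:
  assumes "bounded_at t"
  shows "t < blowup_time"
proof -
  obtain \<epsilon> where "\<epsilon> > 0" "bounded_at (t + \<epsilon>)"
    using assms bounded_at_extend unfolding bounded_at_def by meson
  then show ?thesis
    unfolding blowup_time_def using cSup_upper[OF _ bounded_at_bdd_above, of "t + \<epsilon>"] by simp
qed

lemma blowup_time_pos: "0 < blowup_time"
  using bounded_at_imp_less_blowup_time[OF bounded_at_0] .

lemma bounded_before_blowup_time: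
  assumes "0 \<le> t" "t < blowup_time"
  shows "bounded_at t"
proof -
  obtain s where "bounded_at s" "t < s"
    using assms less_cSup_iff[OF _ bounded_at_bdd_above] bounded_at_0 unfolding blowup_time_def by blast
  then show ?thesis using bounded_at_mono assms by simp
qed

text \<open>A uniform bound before the blow-up time would hold at that time by continuity, and then persist
  beyond it.\<close>
lemma unbounded_towards_blowup_time:
  "\<exists>t z. 0 \<le> t \<and> t < blowup_time \<and> 0 < z \<and> M < exponent z t"
proof (rule ccontr)
  assume "\<not> ?thesis"
  then have le: "exponent z t \<le> M" if "0 \<le> t" "t < blowup_time" "0 < z" for z t
    using that not_less by blast
  have "exponent z blowup_time \<le> M" if z: "0 < z" for z
  proof -
    have "continuous_on {0..blowup_time} (\<lambda>s. exponent (fst (z, s)) (snd (z, s)))"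
      by (rule continuous_on_compose2[OF exponent_continuous]) (use z in \<open>auto intro!: continuous_intros\<close>)
    then have "((exponent z) \<longlongrightarrow> exponent z blowup_time) (at blowup_time within {0..blowup_time})"
      using blowup_time_pos by (auto simp: continuous_on_def)
    then have "((exponent z) \<longlongrightarrow> exponent z blowup_time) (at_left blowup_time)"
      using blowup_time_pos by (simp add: at_within_Icc_at_left)
    moreover have "\<forall>\<^sub>F t in at_left blowup_time. exponent z t \<le> M"
      using eventually_at_left_real[OF blowup_time_pos] le z by (auto elim!: eventually_mono)
    ultimately show ?thesis by (rule tendsto_upperbound) simp
  qed
  then have "bounded_at blowup_time" using blowup_time_pos by (auto simp: bounded_at_def)
  then show False using bounded_at_imp_less_blowup_time by blast
qed

section \<open>The stretching exponent up to the axes\<close>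

lemma exponent_bounded:
  assumes "0 \<le> t1" "t1 < blowup_time"
  obtains M where "0 \<le> M" "\<And>z t. 0 < z \<Longrightarrow> 0 \<le> t \<Longrightarrow> t \<le> t1 \<Longrightarrow> exponent z t \<le> M"
proof -
  obtain M where M: "\<And>z. 0 < z \<Longrightarrow> exponent z t1 \<le> M"
    using bounded_before_blowup_time[OF assms] unfolding bounded_at_def by blast
  have "exponent z t \<le> max 0 M" if "0 < z" "0 \<le> t" "t \<le> t1" for z t
    using exponent_mono_time[OF that] M[OF that(1)] by linarith
  then show ?thesis by (intro that[of "max 0 M"]) auto
qed

text \<open>A bound for the exponent bounds the flux up to \<open>w = 0\<close>; this Lipschitz estimate, uniform as
  \<open>z\<close> and \<open>w\<close> tend to \<open>0\<close>, is what makes the extension to the axes continuous.\<close>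
lemma exponent_lipschitz:
  assumes "0 \<le> t1" "t1 < blowup_time"
  obtains L where "0 \<le> L" "\<And>z w s t. 0 < z \<Longrightarrow> 0 < w \<Longrightarrow> 0 \<le> s \<Longrightarrow> s \<le> t1 \<Longrightarrow> 0 \<le> t \<Longrightarrow> t \<le> t1 \<Longrightarrow>
    \<bar>exponent z t - exponent w s\<bar> \<le> L * (\<bar>z - w\<bar> + \<bar>t - s\<bar>)"
proof -
  obtain M where M: "\<And>z t. 0 < z \<Longrightarrow> 0 \<le> t \<Longrightarrow> t \<le> t1 \<Longrightarrow> exponent z t \<le> M"
    using exponent_bounded[OF assms] by metis
  define K where "K = 2 * exp (2 * p * M)"
  have K: "0 < K" by (simp add: K_def)
  have fl: "flux w (exponent w t) \<le> K" if "0 < w" "0 \<le> t" "t \<le> t1" for w t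
  proof -
    have "2 * p * exponent w t \<le> 2 * p * M" using M[OF that] p_pos by (intro mult_left_mono) auto
    then show ?thesis unfolding K_def by (intro order_trans[OF flux_le]) simp
  qed
  have bound: "\<bar>flux_tail exponent z s\<bar> \<le> 3 * K" if zs: "0 < z" "s \<in> {0..t1}" for z s
  proof -
    have "flux_tail exponent z s \<le> integral {0..3} (\<lambda>_::real. K)"
      unfolding flux_tail_def
      using fl zs by (intro integral_le flux_tail_integrable[OF exponent_continuous]) auto
    then show ?thesis using exponent_tail_nonneg zs by simp
  qed
  have lip: "\<bar>flux_tail exponent z s - flux_tail exponent w s\<bar> \<le> K * (w - z)"
    if zw: "0 < z" "z \<le> w" and s: "s \<in> {0..t1}" for z w s
  proof -
    have "integral {z..w} (\<lambda>w. flux w (exponent w s)) \<le> integral {z..w} (\<lambda>_. K)"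
      using fl s zw by (intro integral_le exponent_flux_integrable) auto
    then show ?thesis
      using flux_tail_split[where h = exponent, OF exponent_slice_continuous, of s z w]
        exponent_tail_antimono[of s z w] s zw by (simp add: mult.commute)
  qed
  show ?thesis
  proof (rule that)
    fix z w s t :: real
    assume A: "0 < z" "0 < w" "0 \<le> s" "s \<le> t1" "0 \<le> t" "t \<le> t1"
    have "\<bar>integral {0..t} (flux_tail exponent z) - integral {0..s} (flux_tail exponent w)\<bar>
        \<le> (K * t1 + 3 * K) * (\<bar>z - w\<bar> + \<bar>t - s\<bar>)"
    proof (rule time_integral_lipschitz[where A = "{0<..}" and ?t1.0 = t1])
      show "\<bar>flux_tail exponent z s - flux_tail exponent w s\<bar> \<le> K * \<bar>z - w\<bar>"
        if "z \<in> {0<..}" "w \<in> {0<..}" "s \<in> {0..t1}" for z w s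
        using lip[of z w s] lip[of w z s] that by (cases "z \<le> w") (auto simp: abs_minus_commute)
    qed (use A K bound in \<open>auto intro: exponent_tail_integrable\<close>)
    then show "\<bar>exponent z t - exponent w s\<bar> \<le> (K * t1 + 3 * K) * (\<bar>z - w\<bar> + \<bar>t - s\<bar>)"
      using A by (simp add: exponent_eq_picard picard_def)
  qed (use K assms in simp)
qed

text \<open>The extension of the exponent to \<open>z = 0\<close>.  Taking the limit from the right for every \<open>z\<close> lets
  estimates pass to the limit without a case distinction.\<close>
definition stretch :: "real \<Rightarrow> real \<Rightarrow> real" where
  "stretch z t = lim (\<lambda>n. exponent (z + inverse (real (Suc n))) t)"

lemma stretch_tendsto:
  assumes "0 \<le> z" "0 \<le> t" "t < blowup_time"
  shows "(\<lambda>n. exponent (z + inverse (real (Suc n))) t) \<longlonglongrightarrow> stretch z t"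
proof -
  obtain M where M: "\<And>z t'. 0 < z \<Longrightarrow> 0 \<le> t' \<Longrightarrow> t' \<le> t \<Longrightarrow> exponent z t' \<le> M"
    using exponent_bounded[OF assms(2,3)] by metis
  have inc: "incseq (\<lambda>n. exponent (z + inverse (real (Suc n))) t)"
    using assms by (intro incseq_SucI exponent_antimono) (auto intro!: add_nonneg_pos)
  have "\<forall>n. exponent (z + inverse (real (Suc n))) t \<le> M"
    using assms by (intro allI M) (auto intro!: add_nonneg_pos)
  from incseq_convergent[OF inc this] obtain L where "(\<lambda>n. exponent (z + inverse (real (Suc n))) t) \<longlonglongrightarrow> L"
    by metis
  then show ?thesis unfolding stretch_def by (simp add: limI)
qed

lemma inverse_Suc_shift_tendsto: "(\<lambda>n. z + inverse (real (Suc n))) \<longlonglongrightarrow> z"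
  using tendsto_add[OF tendsto_const LIMSEQ_inverse_real_of_nat] by simp

lemma stretch_eq_exponent:
  assumes "0 < z" "0 \<le> t" "t < blowup_time"
  shows "stretch z t = exponent z t"
proof (rule LIMSEQ_unique[OF stretch_tendsto])
  have "continuous_on {z..} (\<lambda>w. exponent w t)" using assms exponent_slice_continuous by simp
  from continuous_on_tendsto_compose[OF this inverse_Suc_shift_tendsto, of z]
  show "(\<lambda>n. exponent (z + inverse (real (Suc n))) t) \<longlonglongrightarrow> exponent z t" by simp
qed (use assms in auto)

lemma stretch_lipschitz:
  assumes "0 \<le> t1" "t1 < blowup_time"
  obtains L where "0 \<le> L" "\<And>z w s t. 0 \<le> z \<Longrightarrow> 0 \<le> w \<Longrightarrow> 0 \<le> s \<Longrightarrow> s \<le> t1 \<Longrightarrow> 0 \<le> t \<Longrightarrow> t \<le> t1 \<Longrightarrow>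
    \<bar>stretch z t - stretch w s\<bar> \<le> L * (\<bar>z - w\<bar> + \<bar>t - s\<bar>)"
proof -
  obtain L where L: "0 \<le> L" "\<And>z w s t. 0 < z \<Longrightarrow> 0 < w \<Longrightarrow> 0 \<le> s \<Longrightarrow> s \<le> t1 \<Longrightarrow> 0 \<le> t \<Longrightarrow> t \<le> t1 \<Longrightarrow>
    \<bar>exponent z t - exponent w s\<bar> \<le> L * (\<bar>z - w\<bar> + \<bar>t - s\<bar>)"
    using exponent_lipschitz[OF assms] by metis
  have "\<bar>stretch z t - stretch w s\<bar> \<le> L * (\<bar>z - w\<bar> + \<bar>t - s\<bar>)"
    if "0 \<le> z" "0 \<le> w" "0 \<le> s" "s \<le> t1" "0 \<le> t" "t \<le> t1" for z w s t
  proof (rule LIMSEQ_le_const2)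
    show "(\<lambda>n. \<bar>exponent (z + inverse (real (Suc n))) t - exponent (w + inverse (real (Suc n))) s\<bar>)
        \<longlonglongrightarrow> \<bar>stretch z t - stretch w s\<bar>"
      using that assms by (intro tendsto_rabs tendsto_diff stretch_tendsto) auto
    have "\<bar>exponent (z + inverse (real (Suc n))) t - exponent (w + inverse (real (Suc n))) s\<bar>
        \<le> L * (\<bar>z + inverse (real (Suc n)) - (w + inverse (real (Suc n)))\<bar> + \<bar>t - s\<bar>)" for n
      using that by (intro L(2)) (auto intro!: add_nonneg_pos)
    then show "\<exists>N. \<forall>n\<ge>N. \<bar>exponent (z + inverse (real (Suc n))) t - exponent (w + inverse (real (Suc n))) s\<bar>
        \<le> L * (\<bar>z - w\<bar> + \<bar>t - s\<bar>)" by simp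
  qed
  then show ?thesis using L(1) by (intro that[of L]) auto
qed

lemma stretch_continuous:
  "continuous_on ({0..} \<times> {0..<blowup_time}) (\<lambda>x. stretch (fst x) (snd x))"
proof (rule continuous_on_locally)
  fix x :: "real \<times> real" assume x: "x \<in> {0..} \<times> {0..<blowup_time}"
  define t1 where "t1 = (snd x + blowup_time) / 2"
  have t1: "0 \<le> t1" "t1 < blowup_time" "snd x < t1" using x by (auto simp: t1_def)
  let ?U = "UNIV \<times> {..<t1} :: (real \<times> real) set"
  obtain L where L: "0 \<le> L" "\<And>z w s t. 0 \<le> z \<Longrightarrow> 0 \<le> w \<Longrightarrow> 0 \<le> s \<Longrightarrow> s \<le> t1 \<Longrightarrow> 0 \<le> t \<Longrightarrow> t \<le> t1 \<Longrightarrow>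
    \<bar>stretch z t - stretch w s\<bar> \<le> L * (\<bar>z - w\<bar> + \<bar>t - s\<bar>)"
    using stretch_lipschitz[OF t1(1,2)] by metis
  have "continuous_on (({0..} \<times> {0..<blowup_time}) \<inter> ?U) (\<lambda>x. stretch (fst x) (snd x))"
    using L(1) by (rule continuous_on_of_l1_lipschitz) (rule L(2); auto)
  moreover have "open ?U" "x \<in> ?U" using x t1 by (auto intro!: open_Times simp: mem_Times_iff)
  ultimately show "\<exists>U. open U \<and> x \<in> U \<and> continuous_on (({0..} \<times> {0..<blowup_time}) \<inter> U) (\<lambda>x. stretch (fst x) (snd x))"
    by (intro exI[of _ ?U] conjI)
qed

lemma stretch_slice_continuous: "0 \<le> t \<Longrightarrow> t < blowup_time \<Longrightarrow> S \<subseteq> {0..} \<Longrightarrow> continuous_on S (\<lambda>w. stretch w t)"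
  by (rule slice_continuous[OF stretch_continuous]) auto

lemma stretch_eq_picard:
  assumes z: "0 \<le> z" and t: "0 \<le> t" "t < blowup_time"
  shows "stretch z t = picard stretch z t"
proof -
  have pos: "stretch w t = picard stretch w t" if w: "0 < w" for w
  proof -
    have "flux_tail stretch w s = flux_tail exponent w s" if "s \<in> {0..t}" for s
      unfolding flux_tail_def
      using w that t by (intro integral_cong) (auto simp: stretch_eq_exponent)
    then have "picard stretch w t = picard exponent w t"
      unfolding picard_def by (rule integral_cong)
    then show ?thesis using w t exponent_eq_picard[OF w t(1)] by (simp add: stretch_eq_exponent)
  qed
  show ?thesis
  proof (rule LIMSEQ_unique)
    have "continuous_on {0..} (\<lambda>w. stretch w t)" using t by (intro stretch_slice_continuous) auto
    from continuous_on_tendsto_compose[OF this inverse_Suc_shift_tendsto, of z]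
    show "(\<lambda>n. stretch (z + inverse (real (Suc n))) t) \<longlonglongrightarrow> stretch z t"
      using z by (simp add: add_nonneg_nonneg)
    have "continuous_on ({0..} \<times> {0..<blowup_time}) (\<lambda>x. picard stretch (fst x) (snd x))"
      by (rule picard_continuous[OF stretch_continuous]) auto
    then have "continuous_on {0..} (\<lambda>w. picard stretch w t)"
      using t by (intro slice_continuous[where h = "picard stretch" and A = "{0..}" and I = "{0..<blowup_time}"]) auto
    from continuous_on_tendsto_compose[OF this inverse_Suc_shift_tendsto, of z]
    have "(\<lambda>n. picard stretch (z + inverse (real (Suc n))) t) \<longlonglongrightarrow> picard stretch z t"
      using z by (simp add: add_nonneg_nonneg)
    then show "(\<lambda>n. stretch (z + inverse (real (Suc n))) t) \<longlonglongrightarrow> picard stretch z t"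
      using pos z by (simp add: add_nonneg_pos)
  qed
qed

lemma stretch_0: "0 \<le> z \<Longrightarrow> stretch z 0 = 0"
  using stretch_eq_picard[of z 0] blowup_time_pos by (simp add: picard_def)

lemma stretch_nonneg:
  assumes "0 \<le> z" "0 \<le> t" "t < blowup_time"
  shows "0 \<le> stretch z t"
proof (rule LIMSEQ_le_const[OF stretch_tendsto[OF assms]])
  have "0 \<le> exponent (z + inverse (real (Suc n))) t" for n
    using exponent_mono_time[of "z + inverse (real (Suc n))" 0 t] assms
    by (simp add: exponent_0 add_nonneg_pos)
  then show "\<exists>N. \<forall>n\<ge>N. 0 \<le> exponent (z + inverse (real (Suc n))) t" by blast
qed

lemma stretch_bounded:
  assumes "0 \<le> t1" "t1 < blowup_time"
  obtains M where "0 \<le> M" "\<And>z t. 0 \<le> z \<Longrightarrow> 0 \<le> t \<Longrightarrow> t \<le> t1 \<Longrightarrow> stretch z t \<le> M"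
proof -
  obtain M where M: "0 \<le> M" "\<And>z t. 0 < z \<Longrightarrow> 0 \<le> t \<Longrightarrow> t \<le> t1 \<Longrightarrow> exponent z t \<le> M"
    using exponent_bounded[OF assms] by metis
  have "stretch z t \<le> M" if "0 \<le> z" "0 \<le> t" "t \<le> t1" for z t
  proof (rule LIMSEQ_le_const2[OF stretch_tendsto])
    show "\<exists>N. \<forall>n\<ge>N. exponent (z + inverse (real (Suc n))) t \<le> M"
      using that by (intro exI allI impI M(2)) (auto intro!: add_nonneg_pos)
  qed (use that assms in auto)
  then show ?thesis using M(1) by (intro that[of M]) auto
qed

lemma at_within_blowup_time:
  assumes "0 \<le> t" "t < t1" "t1 < blowup_time"
  shows "at t within {0..<blowup_time} = at t within {0..t1}"
  using assms by (intro at_within_nhd[of t "{..<t1}"]) auto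

lemma stretch_has_time_derivative:
  assumes z: "0 \<le> z" and t: "0 \<le> t" "t < blowup_time"
  shows "(stretch z has_real_derivative flux_tail stretch z t) (at t within {0..<blowup_time})"
proof -
  define t1 where "t1 = (t + blowup_time) / 2"
  have t1: "t < t1" "t1 < blowup_time" using t by (auto simp: t1_def)
  have "continuous_on {0..t1} (flux_tail stretch z)"
    by (rule flux_tail_continuous_time[OF stretch_continuous]) (use z t1 in auto)
  from integral_has_real_derivative[OF this, of t]
  have "((\<lambda>s. picard stretch z s) has_real_derivative flux_tail stretch z t) (at t within {0..t1})"
    using t t1 by (simp add: picard_def)
  then have "(stretch z has_real_derivative flux_tail stretch z t) (at t within {0..t1})"
    using t t1 z by (elim has_field_derivative_transform_within[where d = 1]) (auto simp: stretch_eq_picard)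
  then show ?thesis using at_within_blowup_time[OF t(1) t1] by simp
qed

definition stretch_slope :: "real \<Rightarrow> real \<Rightarrow> real" where
  "stretch_slope z t = - integral {0..t} (\<lambda>s. flux z (stretch z s))"

lemma stretch_slope_continuous:
  "continuous_on ({0..} \<times> {0..<blowup_time}) (\<lambda>x. stretch_slope (fst x) (snd x))"
proof -
  have "continuous_on ({0..} \<times> {0..<blowup_time}) (\<lambda>x. flux (fst x) (stretch (fst x) (snd x)))"
    by (intro continuous_intros stretch_continuous)
  then have "continuous_on ({0..} \<times> {0..<blowup_time}) (\<lambda>x. integral {0..snd x} (\<lambda>s. flux (fst x) (stretch (fst x) s)))"
    by (intro time_integral_continuous[where f = "\<lambda>z s. flux z (stretch z s)"]) auto
  then show ?thesis unfolding stretch_slope_def by (intro continuous_intros)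
qed

text \<open>Exchanging the order of integration turns \<open>z\<close> into a lower limit of integration, so that the
  fundamental theorem of calculus applies.\<close>
lemma stretch_has_space_derivative:
  assumes z: "0 \<le> z" and t: "0 \<le> t" "t < blowup_time"
  shows "((\<lambda>z. stretch z t) has_real_derivative stretch_slope z t) (at z within {0..})"
proof -
  \<comment> \<open>\<open>b\<close> exceeds \<open>z + 3\<close> by one, so that the formula below holds for all \<open>w\<close> near \<open>z\<close>\<close>
  define b where "b = z + 4"
  let ?H = "\<lambda>w. integral {0..t} (\<lambda>s. flux w (stretch w s))"
  have eq: "integral {w..b} ?H = stretch w t" if w: "0 \<le> w" "w + 3 \<le> b" for w
  proof -
    have "continuous_on (cbox (w, 0) (b, t)) (\<lambda>x. flux (fst x) (stretch (fst x) (snd x)))"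
      by (intro continuous_intros continuous_on_subset[OF stretch_continuous])
        (use w t in \<open>auto simp: cbox_Pair_eq\<close>)
    then have "integral (cbox w b) (\<lambda>x. integral (cbox 0 t) (\<lambda>y. flux x (stretch x y)))
        = integral (cbox 0 t) (\<lambda>y. integral (cbox w b) (\<lambda>x. flux x (stretch x y)))"
      by (intro integral_swap_continuous) (simp add: split_beta)
    then have swap: "integral {w..b} ?H = integral {0..t} (\<lambda>s. integral {w..b} (\<lambda>x. flux x (stretch x s)))"
      by simp
    have "integral {w..b} (\<lambda>x. flux x (stretch x s)) = flux_tail stretch w s" if s: "s \<in> {0..t}" for s
      unfolding flux_tail_def using w s t
      by (intro integral_shift_flux[where g = "\<lambda>x. stretch x s", symmetric] stretch_slice_continuous) auto
    then have "integral {0..t} (\<lambda>s. integral {w..b} (\<lambda>x. flux x (stretch x s))) = picard stretch w t"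
      unfolding picard_def by (rule integral_cong)
    then show ?thesis unfolding swap using stretch_eq_picard w t by simp
  qed
  have "continuous_on ({0..} \<times> {0..<blowup_time}) (\<lambda>x. - stretch_slope (fst x) (snd x))"
    by (intro continuous_intros stretch_slope_continuous)
  then have "continuous_on {0..b} (\<lambda>w. - stretch_slope w t)"
    using t by (intro slice_continuous[where h = "\<lambda>z t. - stretch_slope z t" and A = "{0..}"]) auto
  then have "continuous_on {0..b} ?H" by (simp add: stretch_slope_def)
  from integral_has_real_derivative'[OF this, of z]
  have "((\<lambda>w. integral {w..b} ?H) has_real_derivative stretch_slope z t) (at z within {0..b})"
    using z by (simp add: b_def stretch_slope_def)
  moreover have "at z within {0..b} = at z within {0..}"
    by (intro at_within_nhd[of z "{..<b}"]) (auto simp: b_def)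
  ultimately have "((\<lambda>w. integral {w..b} ?H) has_real_derivative stretch_slope z t) (at z within {0..})"
    by simp
  then show ?thesis
  proof (rule has_field_derivative_transform_within[where d = 1])
    fix w assume "w \<in> {0..}" "dist w z < 1"
    then show "integral {w..b} ?H = stretch w t"
      by (intro eq) (auto simp: b_def dist_real_def)
  qed (use z in auto)
qed

section \<open>The solution built from the stretching exponent\<close>

definition vorticity :: "real \<Rightarrow> real \<times> real \<Rightarrow> real" where
  "vorticity t x = \<phi> (fst x * exp (stretch (fst x * snd x) t)) * \<psi> (snd x * exp (- stretch (fst x * snd x) t))"

definition vorticity_dx :: "real \<Rightarrow> real \<times> real \<Rightarrow> real" where
  "vorticity_dx t x = (let z = fst x * snd x; E = exp (stretch z t); e = exp (- stretch z t); d = stretch_slope z t in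
     \<phi>' (fst x * E) * (E + fst x * E * d * snd x) * \<psi> (snd x * e)
     - \<phi> (fst x * E) * \<psi>' (snd x * e) * (snd x * e * d * snd x))"

definition vorticity_dy :: "real \<Rightarrow> real \<times> real \<Rightarrow> real" where
  "vorticity_dy t x = (let z = fst x * snd x; E = exp (stretch z t); e = exp (- stretch z t); d = stretch_slope z t in
     \<phi>' (fst x * E) * (fst x * E * d * fst x) * \<psi> (snd x * e)
     + \<phi> (fst x * E) * \<psi>' (snd x * e) * (e - snd x * e * d * fst x))"

lemma quadrant_prod_nonneg: "x \<in> quadrant \<Longrightarrow> 0 \<le> fst x * snd x"
  by (simp add: quadrant_def)

lemma vorticity_has_derivative:
  assumes x: "x \<in> quadrant" and t: "0 \<le> t" "t < blowup_time"
  shows "(vorticity t has_derivative (\<lambda>h. vorticity_dx t x * fst h + vorticity_dy t x * snd h)) (at x within quadrant)"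
proof -
  let ?g = "\<lambda>x. stretch (fst x * snd x) t" and ?d = "stretch_slope (fst x * snd x) t"
  have "((\<lambda>x. fst x * snd x) has_derivative (\<lambda>h. fst x * snd h + fst h * snd x)) (at x within quadrant)"
    by (auto intro!: derivative_eq_intros)
  moreover have "((\<lambda>z. stretch z t) has_derivative (\<lambda>h. stretch_slope z t * h)) (at z within {0..})" if "z \<in> {0..}" for z
    using stretch_has_space_derivative[of z t] that t by (simp add: has_field_derivative_def)
  moreover have "(\<lambda>x. fst x * snd x) ` quadrant \<subseteq> {0..}" using quadrant_prod_nonneg by auto
  ultimately have g: "(?g has_derivative (\<lambda>h. ?d * (fst x * snd h + fst h * snd x))) (at x within quadrant)"
    using has_derivative_in_compose2[of "{0..}" "\<lambda>z. stretch z t" "\<lambda>z h. stretch_slope z t * h" "\<lambda>x. fst x * snd x" quadrant x] x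
    by blast
  let ?E = "exp (?g x)" and ?e = "exp (- ?g x)"
  have a: "((\<lambda>x. fst x * exp (?g x)) has_derivative
      (\<lambda>h. fst h * ?E + fst x * (?E * (?d * (fst x * snd h + fst h * snd x))))) (at x within quadrant)"
    using has_derivative_mult[OF has_derivative_fst[OF has_derivative_ident] has_derivative_exp[OF g]]
    by (rule has_derivative_eq_rhs) (auto simp: algebra_simps)
  have b: "((\<lambda>x. snd x * exp (- ?g x)) has_derivative
      (\<lambda>h. snd h * ?e - snd x * (?e * (?d * (fst x * snd h + fst h * snd x))))) (at x within quadrant)"
    using has_derivative_mult[OF has_derivative_snd[OF has_derivative_ident] has_derivative_exp[OF has_derivative_minus[OF g]]]
    by (rule has_derivative_eq_rhs) (auto simp: algebra_simps)
  from has_derivative_mult[OF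
      has_derivative_compose[OF a phi_deriv[unfolded has_field_derivative_def]]
      has_derivative_compose[OF b psi_deriv[unfolded has_field_derivative_def]]]
  have "((\<lambda>x. \<phi> (fst x * exp (?g x)) * \<psi> (snd x * exp (- ?g x))) has_derivative
      (\<lambda>h. vorticity_dx t x * fst h + vorticity_dy t x * snd h)) (at x within quadrant)"
    by (rule has_derivative_eq_rhs) (auto simp: vorticity_dx_def vorticity_dy_def Let_def algebra_simps)
  then show ?thesis by (simp only: vorticity_def[abs_def])
qed

lemma gradient_vorticity:
  "x \<in> quadrant \<Longrightarrow> 0 \<le> t \<Longrightarrow> t < blowup_time \<Longrightarrow> gradient (vorticity t) x = (vorticity_dx t x, vorticity_dy t x)"
  using vorticity_has_derivative by (intro gradient_eqI) auto

lemma stretch_compose_continuous: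
  assumes "continuous_on S f" "continuous_on S g" "\<And>x. x \<in> S \<Longrightarrow> 0 \<le> f x" "\<And>x. x \<in> S \<Longrightarrow> 0 \<le> g x \<and> g x < blowup_time"
  shows "continuous_on S (\<lambda>x. stretch (f x) (g x))" "continuous_on S (\<lambda>x. stretch_slope (f x) (g x))"
proof -
  have c: "continuous_on S (\<lambda>x. (f x, g x))" using assms by (intro continuous_on_Pair)
  have "(\<lambda>x. (f x, g x)) ` S \<subseteq> {0..} \<times> {0..<blowup_time}" using assms by auto
  from continuous_on_compose2[OF stretch_continuous c this] continuous_on_compose2[OF stretch_slope_continuous c this]
  show "continuous_on S (\<lambda>x. stretch (f x) (g x))" "continuous_on S (\<lambda>x. stretch_slope (f x) (g x))" by simp_all
qed

lemma vorticity_jointly_continuous: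
  fixes S :: "(real \<times> real \<times> real) set"
  assumes S: "S \<subseteq> {0..<blowup_time} \<times> quadrant"
  shows "continuous_on S (\<lambda>y. vorticity (fst y) (snd y))"
    and "continuous_on S (\<lambda>y. vorticity_dx (fst y) (snd y))"
    and "continuous_on S (\<lambda>y. vorticity_dy (fst y) (snd y))"
proof -
  have *: "0 \<le> fst (snd y) * snd (snd y)" "0 \<le> fst y \<and> fst y < blowup_time" if "y \<in> S" for y
    using that S quadrant_prod_nonneg by auto
  note [continuous_intros] = stretch_compose_continuous
  show "continuous_on S (\<lambda>y. vorticity (fst y) (snd y))"
    unfolding vorticity_def by (intro continuous_intros *) auto
  show "continuous_on S (\<lambda>y. vorticity_dx (fst y) (snd y))"
    unfolding vorticity_dx_def Let_def by (intro continuous_intros *) auto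
  show "continuous_on S (\<lambda>y. vorticity_dy (fst y) (snd y))"
    unfolding vorticity_dy_def Let_def by (intro continuous_intros *) auto
qed

lemma vorticity_slice_continuous:
  assumes "0 \<le> t" "t < blowup_time"
  shows "continuous_on quadrant (vorticity t)" "continuous_on quadrant (vorticity_dx t)" "continuous_on quadrant (vorticity_dy t)"
proof -
  have c: "continuous_on quadrant (\<lambda>x. (t, x))" by (intro continuous_on_Pair continuous_on_const continuous_on_id)
  have "(\<lambda>x. (t, x)) ` quadrant \<subseteq> {0..<blowup_time} \<times> quadrant" using assms by auto
  note * = continuous_on_compose2[OF _ c this]
  show "continuous_on quadrant (vorticity t)" "continuous_on quadrant (vorticity_dx t)" "continuous_on quadrant (vorticity_dy t)"
    using *[OF vorticity_jointly_continuous(1)[OF subset_refl]] *[OF vorticity_jointly_continuous(2)[OF subset_refl]]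
      *[OF vorticity_jointly_continuous(3)[OF subset_refl]] by simp_all
qed

text \<open>The exponent is nonnegative, so points of the support have moved towards the second axis, and by at
  most the factor \<open>exp M\<close> away from the first.\<close>
lemma supp_vorticity:
  assumes t: "0 \<le> t" "t < blowup_time" and M: "\<And>z. 0 \<le> z \<Longrightarrow> stretch z t \<le> M"
  shows "supp (vorticity t) \<subseteq> {0..3} \<times> {0..exp M}"
  unfolding supp_def
proof (rule closure_minimal)
  show "support_on quadrant (vorticity t) \<subseteq> {0..3} \<times> {0..exp M}"
  proof
    fix x assume "x \<in> support_on quadrant (vorticity t)"
    then have x: "x \<in> quadrant" "vorticity t x \<noteq> 0" by (auto simp: support_on_def)
    let ?g = "stretch (fst x * snd x) t"
    have g: "0 \<le> ?g" "?g \<le> M" using M quadrant_prod_nonneg[OF x(1)] stretch_nonneg t by auto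
    have "fst x * exp ?g \<le> 3" "snd x * exp (- ?g) < 1"
      using x(2) phi_0[of "fst x * exp ?g"] psi_0[of "snd x * exp (- ?g)"] by (force simp: vorticity_def)+
    moreover have "fst x * 1 \<le> fst x * exp ?g" using x(1) g by (intro mult_left_mono) (auto simp: quadrant_def)
    moreover have "snd x * exp (- ?g) * exp ?g = snd x" by (simp add: exp_minus)
    then have "snd x \<le> exp ?g" using \<open>snd x * exp (- ?g) < 1\<close>
      by (metis exp_ge_zero less_imp_le mult_1 mult_right_mono)
    then have "snd x \<le> exp M" using g by (meson exp_le_cancel_iff order_trans)
    ultimately show "x \<in> {0..3} \<times> {0..exp M}" using x(1) by (auto simp: quadrant_def mem_Times_iff)
  qed
qed (intro closed_Times closed_atLeastAtMost)

lemma vorticity_C01: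
  assumes t: "0 \<le> t" "t < blowup_time"
  shows "vorticity t \<in> C01"
proof -
  obtain M where M: "\<And>z s. 0 \<le> z \<Longrightarrow> 0 \<le> s \<Longrightarrow> s \<le> t \<Longrightarrow> stretch z s \<le> M"
    using stretch_bounded[OF t] by metis
  have "Ck_quadrant (Suc 0) (vorticity t)"
    using vorticity_slice_continuous[OF t]
    by (intro Ck_quadrant_SucI[OF vorticity_has_derivative]) (use t in auto)
  moreover have "compact ({0..3::real} \<times> {0..exp M})" by (intro compact_Times compact_Icc)
  then have "compact (supp (vorticity t))"
    using supp_vorticity[OF t, of M] M t
    by (auto simp: compact_eq_bounded_closed supp_def intro: bounded_subset)
  ultimately show ?thesis by (simp add: C01_def)
qed

text \<open>Up to a time \<open>t1\<close> before blow-up all supports lie in one compact box, on which the vorticity and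
  its gradient are uniformly continuous jointly in time and space.\<close>
lemma vorticity_C1_continuous:
  assumes t: "0 \<le> t" "t < blowup_time"
  shows "((\<lambda>s. C1_norm (\<lambda>x. vorticity s x - vorticity t x)) \<longlongrightarrow> 0) (at t within {0..<blowup_time})"
proof (rule tendstoI)
  fix e :: real assume e: "0 < e"
  define t1 where "t1 = (t + blowup_time) / 2"
  have t1: "0 \<le> t1" "t < t1" "t1 < blowup_time" using t by (auto simp: t1_def)
  obtain M where M: "\<And>z s. 0 \<le> z \<Longrightarrow> 0 \<le> s \<Longrightarrow> s \<le> t1 \<Longrightarrow> stretch z s \<le> M"
    using stretch_bounded[OF t1(1,3)] by metis
  let ?K = "{0..3} \<times> {0..exp M} :: (real \<times> real) set"
  let ?P = "\<lambda>y. (vorticity (fst y) (snd y), (vorticity_dx (fst y) (snd y), vorticity_dy (fst y) (snd y)))"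
  have K: "?K \<subseteq> quadrant" by (auto simp: quadrant_def)
  have "{0..t1} \<times> ?K \<subseteq> {0..<blowup_time} \<times> quadrant" using K t1 by auto
  then have "continuous_on ({0..t1} \<times> ?K) ?P"
    by (intro continuous_on_Pair vorticity_jointly_continuous)
  moreover have "compact ({0..t1} \<times> ?K)" by (intro compact_Times compact_Icc)
  ultimately have "uniformly_continuous_on ({0..t1} \<times> ?K) ?P" by (rule compact_uniformly_continuous)
  then obtain d where d: "0 < d" "\<And>y y'. y \<in> {0..t1} \<times> ?K \<Longrightarrow> y' \<in> {0..t1} \<times> ?K \<Longrightarrow> dist y' y < d \<Longrightarrow> dist (?P y') (?P y) < e / 3"
    using e unfolding uniformly_continuous_on_def by (metis divide_pos_pos zero_less_numeral)
  have close: "dist (C1_norm (\<lambda>x. vorticity s x - vorticity t x)) 0 < e"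
    if s: "0 \<le> s" "s < t1" "dist s t < d" for s
  proof -
    have sb: "s < blowup_time" using s t1 by simp
    have gr: "gradient (\<lambda>x. vorticity s x - vorticity t x) x = gradient (vorticity s) x - gradient (vorticity t) x"
      if "x \<in> quadrant" for x
      using that t s sb by (intro gradient_diff C01_differentiable vorticity_C01)
    have bd: "\<bar>vorticity s x - vorticity t x\<bar> \<le> e / 3 \<and> norm (gradient (vorticity s) x - gradient (vorticity t) x) \<le> e / 3"
      if x: "x \<in> quadrant" for x
    proof (cases "x \<in> ?K")
      case True
      have "dist (s, x) (t, x) < d" using s by (simp add: dist_Pair_Pair)
      then have "dist (?P (s, x)) (?P (t, x)) < e / 3" using True s t t1 by (intro d(2)) auto
      then have "dist (vorticity s x) (vorticity t x) < e / 3"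
        "dist (gradient (vorticity s) x) (gradient (vorticity t) x) < e / 3"
        using dist_fst_le[of "?P (s, x)" "?P (t, x)"] dist_snd_le[of "?P (s, x)" "?P (t, x)"]
          gradient_vorticity[OF x] s sb t by simp_all
      then show ?thesis by (simp add: dist_norm)
    next
      case False
      have "x \<notin> supp (vorticity s)" "x \<notin> supp (vorticity t)"
        using False supp_vorticity[of s M] supp_vorticity[of t M] M s sb t t1 by auto
      then show ?thesis
        using x e by (simp add: eq_0_outside_supp gradient_eq_0_outside_supp)
    qed
    have diff: "(\<lambda>x. vorticity s x - vorticity t x) \<in> C01"
      using s sb t by (intro C01_diff vorticity_C01)
    have "C1_norm (\<lambda>x. vorticity s x - vorticity t x) \<le> e / 3 + e / 3"
      using bd gr by (intro C1_norm_le) auto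
    moreover have "0 \<le> C1_norm (\<lambda>x. vorticity s x - vorticity t x)" using diff by (rule C1_norm_nonneg)
    ultimately show ?thesis using e by simp
  qed
  show "\<forall>\<^sub>F s in at t within {0..<blowup_time}. dist (C1_norm (\<lambda>x. vorticity s x - vorticity t x)) 0 < e"
    unfolding eventually_at
  proof (intro exI conjI ballI impI)
    show "0 < min d (t1 - t)" using d t1 by simp
    fix s assume "s \<in> {0..<blowup_time}" "s \<noteq> t \<and> dist s t < min d (t1 - t)"
    then show "dist (C1_norm (\<lambda>x. vorticity s x - vorticity t x)) 0 < e"
      by (intro close) (auto simp: dist_real_def)
  qed
qed

lemma vorticity_stretched:
  assumes "0 \<le> t" "t < blowup_time"
  shows "stretched (\<lambda>w. stretch w t) (vorticity t)"
  using vorticity_slice_continuous(1)[OF assms] unfolding stretched_def by (auto simp: vorticity_def)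

lemma velocity_vorticity:
  assumes x: "x \<in> quadrant" and t: "0 \<le> t" "t < blowup_time"
  shows "set_integrable lborel (hyperbolic_region x) (kernel_integrand \<alpha> (vorticity t))"
    and "velocity \<alpha> (vorticity t) x =
      (- fst x * flux_tail stretch (fst x * snd x) t, snd x * flux_tail stretch (fst x * snd x) t)"
proof -
  note * = velocity_integral_eq_flux[OF vorticity_stretched[OF t] stretch_slice_continuous[OF t subset_refl]
      quadrant_prod_nonneg[OF x]]
  show "set_integrable lborel (hyperbolic_region x) (kernel_integrand \<alpha> (vorticity t))"
    using *(1) by (simp add: hyperbolic_region_eq)
  show "velocity \<alpha> (vorticity t) x =
      (- fst x * flux_tail stretch (fst x * snd x) t, snd x * flux_tail stretch (fst x * snd x) t)"
    using *(2) by (simp add: velocity_def hyperbolic_region_eq flux_tail_def)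
qed

text \<open>The gradient involves the slope of the exponent across hyperbolas; it cancels against the velocity,
  which is tangent to them.\<close>
lemma vorticity_transport:
  assumes x: "x \<in> quadrant" and t: "0 \<le> t" "t < blowup_time"
  shows "((\<lambda>s. vorticity s x) has_real_derivative - (velocity \<alpha> (vorticity t) x \<bullet> gradient (vorticity t) x))
           (at t within {0..<blowup_time})"
proof -
  let ?z = "fst x * snd x"
  let ?W = "flux_tail stretch ?z t" and ?E = "exp (stretch ?z t)" and ?e = "exp (- stretch ?z t)"
  have g: "(stretch ?z has_real_derivative ?W) (at t within {0..<blowup_time})"
    using x t by (intro stretch_has_time_derivative quadrant_prod_nonneg)
  have "((\<lambda>s. fst x * exp (stretch ?z s)) has_real_derivative fst x * (?E * ?W)) (at t within {0..<blowup_time})"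
    using g by (auto intro!: derivative_eq_intros)
  from DERIV_chain2[OF phi_deriv this]
  have a: "((\<lambda>s. \<phi> (fst x * exp (stretch ?z s))) has_real_derivative \<phi>' (fst x * ?E) * (fst x * (?E * ?W))) (at t within {0..<blowup_time})" .
  have "((\<lambda>s. snd x * exp (- stretch ?z s)) has_real_derivative snd x * (?e * (- ?W))) (at t within {0..<blowup_time})"
    using g by (auto intro!: derivative_eq_intros)
  from DERIV_chain2[OF psi_deriv this]
  have b: "((\<lambda>s. \<psi> (snd x * exp (- stretch ?z s))) has_real_derivative \<psi>' (snd x * ?e) * (snd x * (?e * (- ?W)))) (at t within {0..<blowup_time})" .
  from DERIV_mult[OF a b]
  have "((\<lambda>s. vorticity s x) has_real_derivative
      \<phi>' (fst x * ?E) * (fst x * (?E * ?W)) * \<psi> (snd x * ?e)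
      + \<psi>' (snd x * ?e) * (snd x * (?e * (- ?W))) * \<phi> (fst x * ?E)) (at t within {0..<blowup_time})"
    by (simp add: vorticity_def)
  moreover have "\<phi>' (fst x * ?E) * (fst x * (?E * ?W)) * \<psi> (snd x * ?e)
      + \<psi>' (snd x * ?e) * (snd x * (?e * (- ?W))) * \<phi> (fst x * ?E)
      = - (velocity \<alpha> (vorticity t) x \<bullet> gradient (vorticity t) x)"
    unfolding velocity_vorticity(2)[OF x t] gradient_vorticity[OF x t]
    by (simp add: inner_prod_def vorticity_dx_def vorticity_dy_def Let_def algebra_simps)
  ultimately show ?thesis by simp
qed

definition initial_vorticity :: "real \<times> real \<Rightarrow> real" where
  "initial_vorticity x = \<phi> (fst x) * \<psi> (snd x)"

lemma vorticity_0: "x \<in> quadrant \<Longrightarrow> vorticity 0 x = initial_vorticity x"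
  by (simp add: vorticity_def initial_vorticity_def stretch_0 quadrant_prod_nonneg)

lemma vorticity_solution: "solution \<alpha> initial_vorticity blowup_time vorticity"
  unfolding solution_def C_time_C01_def velocity_well_defined_def
  using vorticity_C01 vorticity_C1_continuous velocity_vorticity(1) vorticity_transport vorticity_0
  by auto

end

section \<open>Every solution is carried by the same stretching exponent\<close>

lemma constant_of_zero_derivative:
  fixes f :: "real \<Rightarrow> real"
  assumes "\<And>s. s \<in> {0..<T} \<Longrightarrow> (f has_real_derivative 0) (at s within {0..<T})" "0 \<le> t" "t < T"
  shows "f t = f 0"
proof -
  have "\<exists>k. \<forall>s\<in>{0..<T}. f s = k"
    using assms(1) by (rule has_field_derivative_zero_constant[OF convex_real_interval(7)])
  then show ?thesis using assms(2,3) by auto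
qed

locale vortex_solution = vortex_profile +
  fixes T :: real and \<omega> :: "real \<Rightarrow> real \<times> real \<Rightarrow> real"
  assumes sol: "solution \<alpha> initial_vorticity T \<omega>"
begin

definition rate :: "real \<Rightarrow> real \<Rightarrow> real" where
  "rate z t = (LINT y:hyp_region z|lborel. kernel_integrand \<alpha> (\<omega> t) y)"

definition solution_exponent :: "real \<Rightarrow> real \<Rightarrow> real" where
  "solution_exponent z t = integral {0..t} (rate z)"

definition kernel_mass :: real where
  "kernel_mass = (LINT y|lborel. kernel_weight \<alpha> y)"

lemma kernel_mass_nonneg: "0 \<le> kernel_mass"
  unfolding kernel_mass_def by (intro integral_nonneg_AE) (simp add: kernel_weight_nonneg)

lemma omega_C01: "0 \<le> t \<Longrightarrow> t < T \<Longrightarrow> \<omega> t \<in> C01"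
  and omega_C1_continuous: "0 \<le> t \<Longrightarrow> t < T \<Longrightarrow>
    ((\<lambda>s. C1_norm (\<lambda>x. \<omega> s x - \<omega> t x)) \<longlongrightarrow> 0) (at t within {0..<T})"
  and omega_transport: "0 \<le> t \<Longrightarrow> t < T \<Longrightarrow> x \<in> quadrant \<Longrightarrow>
    ((\<lambda>s. \<omega> s x) has_real_derivative - (velocity \<alpha> (\<omega> t) x \<bullet> gradient (\<omega> t) x)) (at t within {0..<T})"
  and omega_initial: "x \<in> quadrant \<Longrightarrow> \<omega> 0 x = initial_vorticity x"
  using sol by (auto simp: solution_def C_time_C01_def)

text \<open>The velocity vanishes at the origin, so the value there is frozen.\<close>
lemma omega_origin: "0 \<le> t \<Longrightarrow> t < T \<Longrightarrow> \<omega> t 0 = 0"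
proof -
  assume t: "0 \<le> t" "t < T"
  have "((\<lambda>s. \<omega> s 0) has_real_derivative 0) (at s within {0..<T})" if "s \<in> {0..<T}" for s
    using omega_transport[OF _ _ quadrant_zero, of s] that by (simp add: velocity_def inner_prod_def)
  from constant_of_zero_derivative[OF this t] have "\<omega> t 0 = \<omega> 0 0" .
  moreover have "\<omega> 0 0 = 0" using omega_initial[OF quadrant_zero] phi_0[of 0] by (simp add: initial_vorticity_def)
  ultimately show ?thesis by simp
qed

lemma C01_le_min_norm:
  assumes "f \<in> C01" "f 0 = 0" "\<And>x. x \<in> quadrant \<Longrightarrow> \<bar>f x\<bar> \<le> A"
    "\<And>x. x \<in> quadrant \<Longrightarrow> norm (gradient f x) \<le> A" and y: "y \<in> quadrant"
  shows "\<bar>f y\<bar> \<le> A * min (norm y) 1"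
proof -
  have "\<bar>f y\<bar> \<le> A * norm y"
    using abs_diff_le_gradient_bound[OF assms(1,4) y quadrant_zero] assms(2) by simp
  moreover have "\<bar>f y\<bar> \<le> A * 1" using assms(3)[OF y] by simp
  ultimately show ?thesis by (cases "norm y \<le> 1") (auto simp: min_def)
qed

lemma rate_bounds:
  assumes t: "0 \<le> t" "t < T"
    and A: "\<And>x. x \<in> quadrant \<Longrightarrow> \<bar>\<omega> t x\<bar> \<le> A" "\<And>x. x \<in> quadrant \<Longrightarrow> norm (gradient (\<omega> t) x) \<le> A"
  shows "set_integrable lborel (hyp_region z) (kernel_integrand \<alpha> (\<omega> t))"
    and "\<bar>rate z t\<bar> \<le> A * kernel_mass"
  unfolding rate_def kernel_mass_def
  using kernel_integrand_bound[OF alpha C01_continuous_on[OF omega_C01[OF t]]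
      C01_le_min_norm[OF omega_C01[OF t] omega_origin[OF t] A]] by auto

lemma rate_integrable:
  assumes t: "0 \<le> t" "t < T"
  shows "set_integrable lborel (hyp_region z) (kernel_integrand \<alpha> (\<omega> t))"
  using rate_bounds(1)[OF t abs_le_C1_norm[OF omega_C01[OF t]] gradient_le_C1_norm[OF omega_C01[OF t]]] .

text \<open>The difference of two vorticities is again of class \<open>C01\<close> and vanishes at the origin.\<close>
lemma rate_diff_le:
  assumes s: "0 \<le> s" "s < T" and t: "0 \<le> t" "t < T"
  shows "\<bar>rate z s - rate z t\<bar> \<le> C1_norm (\<lambda>x. \<omega> s x - \<omega> t x) * kernel_mass"
proof -
  let ?u = "\<lambda>x. \<omega> s x - \<omega> t x"
  have u: "?u \<in> C01" using s t by (intro C01_diff omega_C01)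
  have "\<bar>LINT y:hyp_region z|lborel. kernel_integrand \<alpha> ?u y\<bar> \<le> C1_norm ?u * kernel_mass"
    unfolding kernel_mass_def using omega_origin[OF s] omega_origin[OF t]
    by (intro kernel_integrand_bound alpha C01_continuous_on u C01_le_min_norm abs_le_C1_norm gradient_le_C1_norm) auto
  moreover have "(LINT y:hyp_region z|lborel. kernel_integrand \<alpha> ?u y) = rate z s - rate z t"
  proof -
    have "kernel_integrand \<alpha> ?u = (\<lambda>y. kernel_integrand \<alpha> (\<omega> s) y - kernel_integrand \<alpha> (\<omega> t) y)"
      by (auto simp: kernel_integrand_def diff_divide_distrib)
    then show ?thesis
      unfolding rate_def using set_integral_diff(2)[OF rate_integrable[OF s] rate_integrable[OF t]] by simp
  qed
  ultimately show ?thesis by simp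
qed

lemma continuous_on_of_C1_modulus:
  assumes "\<And>s t. 0 \<le> s \<Longrightarrow> s < T \<Longrightarrow> 0 \<le> t \<Longrightarrow> t < T \<Longrightarrow>
      \<bar>f s - f t\<bar> \<le> C1_norm (\<lambda>x. \<omega> s x - \<omega> t x) * B"
  shows "continuous_on {0..<T} (f :: real \<Rightarrow> real)"
  unfolding continuous_on_def
proof
  fix t assume t: "t \<in> {0..<T}"
  show "(f \<longlongrightarrow> f t) (at t within {0..<T})"
  proof (rule LIM_zero_cancel, rule Lim_null_comparison)
    show "((\<lambda>s. C1_norm (\<lambda>x. \<omega> s x - \<omega> t x) * B) \<longlongrightarrow> 0) (at t within {0..<T})"
      using tendsto_mult[OF omega_C1_continuous tendsto_const, of t B] t by simp
    show "\<forall>\<^sub>F s in at t within {0..<T}. norm (f s - f t) \<le> C1_norm (\<lambda>x. \<omega> s x - \<omega> t x) * B"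
      using assms t by (auto simp: eventually_at_filter)
  qed
qed

lemma rate_continuous: "continuous_on {0..<T} (rate z)"
  using rate_diff_le by (rule continuous_on_of_C1_modulus)

lemma rate_interval_integrable: "0 \<le> s \<Longrightarrow> t < T \<Longrightarrow> rate z integrable_on {s..t}"
  by (intro integrable_continuous_interval continuous_on_subset[OF rate_continuous]) auto

lemma solution_exponent_0: "solution_exponent z 0 = 0"
  by (simp add: solution_exponent_def)

lemma solution_exponent_has_derivative:
  assumes t: "0 \<le> t" "t < T"
  shows "(solution_exponent z has_real_derivative rate z t) (at t within {0..<T})"
proof -
  define t1 where "t1 = (t + T) / 2"
  have t1: "t < t1" "t1 < T" using t by (auto simp: t1_def)
  have "continuous_on {0..t1} (rate z)" using t1 by (intro continuous_on_subset[OF rate_continuous]) auto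
  from integral_has_real_derivative[OF this, of t]
  have "(solution_exponent z has_real_derivative rate z t) (at t within {0..t1})"
    using t t1 by (simp add: solution_exponent_def[abs_def])
  moreover have "at t within {0..<T} = at t within {0..t1}"
    using t t1 by (intro at_within_nhd[of t "{..<t1}"]) auto
  ultimately show ?thesis by simp
qed

text \<open>Since only continuity in time with values in \<open>C\<^sup>1\<close> is known, the chain rule along a
  characteristic is applied to the vorticity frozen at time \<open>t\<close>; the increment
  \<open>\<omega> s - \<omega> t\<close> is small in \<open>C\<^sup>1\<close> and contributes nothing to the derivative.\<close>
lemma omega_along_characteristic:
  assumes x: "x \<in> quadrant" and t: "0 \<le> t" "t < T"
  shows "\<omega> t (fst x * exp (- solution_exponent (fst x * snd x) t), snd x * exp (solution_exponent (fst x * snd x) t))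
    = initial_vorticity x"
proof -
  let ?z = "fst x * snd x"
  let ?X1 = "\<lambda>s. fst x * exp (- solution_exponent ?z s)" and ?X2 = "\<lambda>s. snd x * exp (solution_exponent ?z s)"
  let ?X = "\<lambda>s. (?X1 s, ?X2 s)"
  have Xq: "?X s \<in> quadrant" for s using x by (simp add: quadrant_def)
  have Xz: "fst (?X s) * snd (?X s) = ?z" for s by (simp add: exp_minus field_simps)
  have "((\<lambda>s. \<omega> s (?X s)) has_real_derivative 0) (at t within {0..<T})" if t: "t \<in> {0..<T}" for t
  proof -
    let ?F = "at t within {0..<T}"
    have t': "0 \<le> t" "t < T" using t by auto
    let ?W = "rate ?z t"
    have c: "(solution_exponent ?z has_real_derivative ?W) ?F" using t' by (rule solution_exponent_has_derivative)
    have X1: "(?X1 has_real_derivative - ?W * ?X1 t) ?F"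
      using c by (auto intro!: derivative_eq_intros)
    have X2: "(?X2 has_real_derivative ?W * ?X2 t) ?F"
      using c by (auto intro!: derivative_eq_intros)
    define D where "D = ?W * (- ?X1 t * fst (gradient (\<omega> t) (?X t)) + ?X2 t * snd (gradient (\<omega> t) (?X t)))"
    have frozen_time: "((\<lambda>s. \<omega> t (?X s)) has_real_derivative D) ?F"
    proof -
      have dX: "(?X has_derivative (\<lambda>h. (- ?W * ?X1 t * h, ?W * ?X2 t * h))) ?F"
        using has_derivative_Pair[OF X1[unfolded has_field_derivative_def] X2[unfolded has_field_derivative_def]] .
      have d: "(\<omega> t has_derivative (\<lambda>h. fst (gradient (\<omega> t) y) * fst h + snd (gradient (\<omega> t) y) * snd h)) (at y within quadrant)"
        if "y \<in> quadrant" for y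
        using that t' by (intro has_derivative_gradient C01_differentiable omega_C01)
      have "?X ` {0..<T} \<subseteq> quadrant" using Xq by (intro image_subsetI)
      from has_derivative_in_compose2[OF d this t dX]
      show ?thesis unfolding has_field_derivative_def
        by (rule has_derivative_eq_rhs) (auto simp: D_def algebra_simps)
    qed
    have frozen_place: "((\<lambda>s. \<omega> s (?X t)) has_real_derivative - D) ?F"
    proof -
      have "velocity \<alpha> (\<omega> t) (?X t) \<bullet> gradient (\<omega> t) (?X t) = D"
        unfolding velocity_def hyperbolic_region_eq Xz D_def rate_def
        by (simp add: inner_prod_def algebra_simps)
      then show ?thesis using omega_transport[OF t' Xq[of t]] by simp
    qed
    have rest: "((\<lambda>s. (\<omega> s (?X s) - \<omega> t (?X s)) - (\<omega> s (?X t) - \<omega> t (?X t))) has_real_derivative 0) ?F"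
    proof -
      let ?q = "\<lambda>s. \<bar>(?X1 s - ?X1 t) / (s - t)\<bar> + \<bar>(?X2 s - ?X2 t) / (s - t)\<bar>"
      let ?u = "\<lambda>s. (\<omega> s (?X s) - \<omega> t (?X s)) - (\<omega> s (?X t) - \<omega> t (?X t))"
      have "((\<lambda>s. C1_norm (\<lambda>x. \<omega> s x - \<omega> t x) * ?q s) \<longlongrightarrow> 0 * (\<bar>- ?W * ?X1 t\<bar> + \<bar>?W * ?X2 t\<bar>)) ?F"
        using X1 X2 unfolding has_field_derivative_iff
        by (intro tendsto_mult tendsto_add tendsto_rabs omega_C1_continuous t')
      then have lim: "((\<lambda>s. C1_norm (\<lambda>x. \<omega> s x - \<omega> t x) * ?q s) \<longlongrightarrow> 0) ?F" by simp
      have "((\<lambda>s. (?u s - ?u t) / (s - t)) \<longlongrightarrow> 0) ?F"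
      proof (rule Lim_null_comparison[OF _ lim])
        show "\<forall>\<^sub>F s in ?F. norm ((?u s - ?u t) / (s - t)) \<le> C1_norm (\<lambda>x. \<omega> s x - \<omega> t x) * ?q s"
          unfolding eventually_at_filter
        proof (intro always_eventually allI impI)
          fix s assume s: "s \<noteq> t" "s \<in> {0..<T}"
          let ?d = "\<lambda>x. \<omega> s x - \<omega> t x"
          have d: "?d \<in> C01" using s t' by (intro C01_diff omega_C01) auto
          have "norm (?X s - ?X t) \<le> \<bar>?X1 s - ?X1 t\<bar> + \<bar>?X2 s - ?X2 t\<bar>"
            using norm_Pair_le[of "?X1 s - ?X1 t" "?X2 s - ?X2 t"] by simp
          then have "C1_norm ?d * norm (?X s - ?X t) \<le> C1_norm ?d * (\<bar>?X1 s - ?X1 t\<bar> + \<bar>?X2 s - ?X2 t\<bar>)"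
            using C1_norm_nonneg[OF d] by (intro mult_left_mono)
          moreover have "\<bar>?d (?X s) - ?d (?X t)\<bar> \<le> C1_norm ?d * norm (?X s - ?X t)"
            by (intro abs_diff_le_gradient_bound d gradient_le_C1_norm Xq)
          ultimately have "\<bar>?u s\<bar> \<le> C1_norm ?d * (\<bar>?X1 s - ?X1 t\<bar> + \<bar>?X2 s - ?X2 t\<bar>)" by linarith
          then have "\<bar>?u s\<bar> / \<bar>s - t\<bar> \<le> C1_norm ?d * (\<bar>?X1 s - ?X1 t\<bar> + \<bar>?X2 s - ?X2 t\<bar>) / \<bar>s - t\<bar>"
            by (rule divide_right_mono) simp
          then show "norm ((?u s - ?u t) / (s - t)) \<le> C1_norm ?d * ?q s"
            by (simp only: real_norm_def abs_divide add_divide_distrib[symmetric] times_divide_eq_right diff_self diff_zero)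
        qed
      qed
      then show ?thesis unfolding has_field_derivative_iff .
    qed
    have "((\<lambda>s. \<omega> t (?X s) + \<omega> s (?X t) + ((\<omega> s (?X s) - \<omega> t (?X s)) - (\<omega> s (?X t) - \<omega> t (?X t))) - \<omega> t (?X t))
        has_real_derivative D + - D + 0 - 0) ?F"
      by (intro DERIV_add DERIV_diff frozen_time frozen_place rest DERIV_const)
    then show ?thesis by simp
  qed
  from constant_of_zero_derivative[OF this t] have "\<omega> t (?X t) = \<omega> 0 (?X 0)" .
  also have "\<omega> 0 (?X 0) = initial_vorticity x" using omega_initial[OF x] by (simp add: solution_exponent_0)
  finally show ?thesis .
qed

text \<open>Every point lies on the characteristic that starts at its image under the inverse flow, and both
  points lie on the same hyperbola.\<close>
lemma omega_stretched:
  assumes t: "0 \<le> t" "t < T"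
  shows "stretched (\<lambda>w. solution_exponent w t) (\<omega> t)"
  unfolding stretched_def
proof (intro conjI ballI)
  show "continuous_on quadrant (\<omega> t)" using t by (intro C01_continuous_on omega_C01)
  fix y :: "real \<times> real" assume y: "y \<in> quadrant"
  let ?g = "solution_exponent (fst y * snd y) t"
  let ?x = "(fst y * exp ?g, snd y * exp (- ?g))"
  have x: "?x \<in> quadrant" using y by (simp add: quadrant_def)
  have z: "fst ?x * snd ?x = fst y * snd y" by (simp add: exp_minus field_simps)
  show "\<omega> t y = \<phi> (fst y * exp ?g) * \<psi> (snd y * exp (- ?g))"
    using omega_along_characteristic[OF x t] unfolding z
    by (simp add: initial_vorticity_def mult.assoc exp_add[symmetric])
qed

lemma kernel_nonneg: "0 \<le> t \<Longrightarrow> t < T \<Longrightarrow> y \<in> quadrant \<Longrightarrow> 0 \<le> kernel_integrand \<alpha> (\<omega> t) y"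
  using stretched_nonneg[OF omega_stretched] by (simp add: kernel_integrand_def)

lemma rate_mono:
  assumes t: "0 \<le> t" "t < T" and z: "z \<le> z'"
  shows "0 \<le> rate z' t" "rate z' t \<le> rate z t"
proof -
  have k: "0 \<le> kernel_integrand \<alpha> (\<omega> t) y" if "y \<in> hyp_region w" for y w
    using kernel_nonneg[OF t] that by (simp add: hyp_region_def)
  show "0 \<le> rate z' t"
    unfolding rate_def set_lebesgue_integral_def using k[of _ z']
    by (intro integral_nonneg_AE) (auto simp: indicator_def)
  show "rate z' t \<le> rate z t"
    unfolding rate_def set_lebesgue_integral_def
  proof (rule integral_mono)
    show "integrable lborel (\<lambda>y. indicat_real (hyp_region z') y *\<^sub>R kernel_integrand \<alpha> (\<omega> t) y)"
      "integrable lborel (\<lambda>y. indicat_real (hyp_region z) y *\<^sub>R kernel_integrand \<alpha> (\<omega> t) y)"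
      using rate_integrable[OF t] by (simp_all add: set_integrable_def)
    fix y
    show "indicat_real (hyp_region z') y *\<^sub>R kernel_integrand \<alpha> (\<omega> t) y
        \<le> indicat_real (hyp_region z) y *\<^sub>R kernel_integrand \<alpha> (\<omega> t) y"
      using k[of y z] z by (auto simp: indicator_def hyp_region_def)
  qed
qed

lemma solution_exponent_le_at_axes:
  assumes "0 \<le> z" "0 \<le> t" "t < T"
  shows "solution_exponent z t \<le> solution_exponent 0 t"
  unfolding solution_exponent_def using assms
  by (intro integral_le rate_interval_integrable) (auto intro: rate_mono)

lemma solution_exponent_mono_time:
  assumes "0 \<le> s" "s \<le> t" "t < T"
  shows "solution_exponent z s \<le> solution_exponent z t"
  unfolding solution_exponent_def using assms
  by (intro integral_subset_le rate_interval_integrable) (auto intro: rate_mono(1)[OF _ _ order_refl])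

lemma solution_exponent_continuous:
  assumes t1: "0 \<le> t1" "t1 < T"
  shows "continuous_on ({0..} \<times> {0..t1}) (\<lambda>x. solution_exponent (fst x) (snd x))"
proof -
  define K where "K = 2 * exp (2 * p * solution_exponent 0 t1)"
  have K: "0 \<le> K" by (simp add: K_def)
  have lip: "\<bar>rate z s - rate z' s\<bar> \<le> K * \<bar>z - z'\<bar>" if "0 \<le> z" "0 \<le> z'" "0 \<le> s" "s \<le> t1" for z z' s
  proof -
    have s: "s < T" using that t1 by simp
    have gM: "solution_exponent w s \<le> solution_exponent 0 t1" if "0 \<le> w" for w
      using solution_exponent_le_at_axes[OF that \<open>0 \<le> s\<close> s] solution_exponent_mono_time[OF \<open>0 \<le> s\<close> \<open>s \<le> t1\<close> t1(2), of 0] by simp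
    have "\<bar>rate z s - rate z' s\<bar> \<le> K * (z' - z)" if "0 \<le> z" "z \<le> z'" for z z'
      unfolding rate_def K_def
      by (rule velocity_integral_lipschitz[OF omega_stretched[OF \<open>0 \<le> s\<close> s] gM that rate_integrable[OF \<open>0 \<le> s\<close> s]])
    from this[of z z'] this[of z' z] that show ?thesis
      by (cases "z \<le> z'") (auto simp: abs_minus_commute)
  qed
  have "compact (rate 0 ` {0..t1})"
    using t1 by (intro compact_continuous_image continuous_on_subset[OF rate_continuous]) auto
  then have "bounded (rate 0 ` {0..t1})" by (rule compact_imp_bounded)
  then obtain B where "\<forall>r\<in>rate 0 ` {0..t1}. norm r \<le> B" unfolding bounded_iff by (elim exE)
  then have B: "norm (rate 0 s) \<le> B" if "s \<in> {0..t1}" for s using that by blast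
  have "norm (rate 0 0) \<le> B" using t1 by (intro B) simp
  then have B0: "0 \<le> B" by (rule order_trans[OF norm_ge_zero])
  have rB: "rate z s \<le> B" if "0 \<le> z" "s \<in> {0..t1}" for z s
  proof -
    have "rate z s \<le> rate 0 s" using that t1 by (intro rate_mono) auto
    then show ?thesis using B[OF that(2)] by simp
  qed
  show ?thesis
  proof (rule continuous_on_of_l1_lipschitz)
    fix x y :: "real \<times> real" assume x: "x \<in> {0..} \<times> {0..t1}" and y: "y \<in> {0..} \<times> {0..t1}"
    show "\<bar>solution_exponent (fst x) (snd x) - solution_exponent (fst y) (snd y)\<bar>
        \<le> (K * t1 + B) * (\<bar>fst x - fst y\<bar> + \<bar>snd x - snd y\<bar>)"
      unfolding solution_exponent_def
    proof (rule time_integral_lipschitz[where A = "{0..}" and ?t1.0 = t1])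
      show "\<bar>rate z s\<bar> \<le> B" if "z \<in> {0..}" "s \<in> {0..t1}" for z s
        using rB[of z s] rate_mono(1)[of s z z] that t1 by simp
    qed (use x y K B0 lip t1 in \<open>auto intro: rate_interval_integrable\<close>)
  qed (use K B0 t1 in simp)
qed

text \<open>The vorticity being stretched by its own exponent, the rate is the flux integral of that
  exponent.\<close>
lemma solution_exponent_eq_picard:
  assumes z: "0 \<le> z" and t: "0 \<le> t" "t < T"
  shows "solution_exponent z t = picard solution_exponent z t"
proof -
  have "rate z s = flux_tail solution_exponent z s" if s: "s \<in> {0..t}" for s
  proof -
    have s': "0 \<le> s" "s < T" using s t by auto
    have "continuous_on {0..} (\<lambda>w. solution_exponent w s)"
      by (rule slice_continuous[OF solution_exponent_continuous[OF s']]) (use s' in auto)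
    from velocity_integral_eq_flux(2)[OF omega_stretched[OF s'] this z]
    show ?thesis by (simp add: rate_def flux_tail_def)
  qed
  then show ?thesis unfolding solution_exponent_def picard_def by (rule integral_cong)
qed

lemma solution_exponent_eq_exponent:
  assumes z: "0 < z" and t: "0 \<le> t" "t < T"
  shows "solution_exponent z t = exponent z t"
proof (rule picard_unique[where h = solution_exponent and k = exponent and z = z and w = z and t = t and ?t1.0 = t])
  show "continuous_on ({z..} \<times> {0..t}) (\<lambda>x. solution_exponent (fst x) (snd x))"
    by (rule continuous_on_subset[OF solution_exponent_continuous[OF t]]) (use z in auto)
  show "continuous_on ({z..} \<times> {0..t}) (\<lambda>x. exponent (fst x) (snd x))"
    by (rule continuous_on_subset[OF exponent_continuous]) (use z in auto)
qed (use z t in \<open>auto intro: solution_exponent_eq_picard exponent_eq_picard\<close>)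

text \<open>A solution that lived past the blow-up time would have a finite exponent on the axes then, which
  dominates the exponent at all \<open>z > 0\<close>.\<close>
lemma solution_time_le: "T \<le> blowup_time"
proof (rule ccontr)
  assume "\<not> ?thesis"
  then have T: "0 \<le> blowup_time" "blowup_time < T" using blowup_time_pos by auto
  have "exponent z blowup_time \<le> solution_exponent 0 blowup_time" if "0 < z" for z
    using solution_exponent_le_at_axes[of z, OF _ T] solution_exponent_eq_exponent[OF that T] that by simp
  then have "bounded_at blowup_time" using T by (auto simp: bounded_at_def)
  then show False using bounded_at_imp_less_blowup_time by blast
qed

section \<open>Blow-up of the gradient\<close>

definition max_gradient :: "real \<Rightarrow> real" where
  "max_gradient t = Linf_norm (gradient (\<omega> t))"

lemma max_gradient_eq: "0 \<le> t \<Longrightarrow> t < T \<Longrightarrow> max_gradient t = (SUP x\<in>quadrant. norm (gradient (\<omega> t) x))"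
  unfolding max_gradient_def by (intro Linf_norm_gradient_eq_SUP omega_C01)

lemma gradient_le_max_gradient:
  "0 \<le> t \<Longrightarrow> t < T \<Longrightarrow> x \<in> quadrant \<Longrightarrow> norm (gradient (\<omega> t) x) \<le> max_gradient t"
  using gradient_le_SUP[OF omega_C01] by (simp add: max_gradient_eq)

lemma max_gradient_nonneg: "0 \<le> t \<Longrightarrow> t < T \<Longrightarrow> 0 \<le> max_gradient t"
  using order_trans[OF norm_ge_zero gradient_le_max_gradient[OF _ _ quadrant_zero]] .

lemma max_gradient_le:
  assumes s: "0 \<le> s" "s < T" and t: "0 \<le> t" "t < T"
  shows "max_gradient s \<le> max_gradient t + C1_norm (\<lambda>x. \<omega> s x - \<omega> t x)"
  unfolding max_gradient_eq[OF s]
proof (rule cSUP_least)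
  fix x :: "real \<times> real" assume x: "x \<in> quadrant"
  let ?d = "\<lambda>x. \<omega> s x - \<omega> t x"
  have d: "?d \<in> C01" using s t by (intro C01_diff omega_C01)
  have "gradient ?d x = gradient (\<omega> s) x - gradient (\<omega> t) x"
    using x s t by (intro gradient_diff C01_differentiable omega_C01)
  then have "norm (gradient (\<omega> s) x - gradient (\<omega> t) x) \<le> C1_norm ?d"
    using gradient_le_C1_norm[OF d x] by simp
  moreover have "norm (gradient (\<omega> s) x) \<le> norm (gradient (\<omega> t) x) + norm (gradient (\<omega> s) x - gradient (\<omega> t) x)"
    using norm_triangle_ineq[of "gradient (\<omega> t) x" "gradient (\<omega> s) x - gradient (\<omega> t) x"] by simp
  ultimately show "norm (gradient (\<omega> s) x) \<le> max_gradient t + C1_norm ?d"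
    using gradient_le_max_gradient[OF t x] by linarith
qed (use quadrant_zero in blast)

lemma C1_norm_diff_commute:
  assumes s: "0 \<le> s" "s < T" and t: "0 \<le> t" "t < T"
  shows "C1_norm (\<lambda>x. \<omega> t x - \<omega> s x) = C1_norm (\<lambda>x. \<omega> s x - \<omega> t x)"
proof -
  have "norm (gradient (\<lambda>x. \<omega> t x - \<omega> s x) x) = norm (gradient (\<lambda>x. \<omega> s x - \<omega> t x) x)"
    if x: "x \<in> quadrant" for x
    using x s t by (subst (1 2) gradient_diff)
      (auto intro!: C01_differentiable omega_C01 simp: norm_minus_commute)
  then show ?thesis
    unfolding C1_norm_def by (simp add: abs_minus_commute cong: SUP_cong)
qed

lemma max_gradient_continuous: "continuous_on {0..<T} max_gradient"
proof (rule continuous_on_of_C1_modulus[where B = 1])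
  fix s t assume s: "0 \<le> s" "s < T" and t: "0 \<le> t" "t < T"
  show "\<bar>max_gradient s - max_gradient t\<bar> \<le> C1_norm (\<lambda>x. \<omega> s x - \<omega> t x) * 1"
    using max_gradient_le[OF s t] max_gradient_le[OF t s] C1_norm_diff_commute[OF s t] by linarith
qed

text \<open>The constant \<open>kernel_mass + 1\<close> in place of \<open>kernel_mass\<close> is strictly positive, so that one may
  divide by it.\<close>
lemma solution_exponent_at_axes_le:
  assumes t: "0 \<le> t" "t < T"
  shows "solution_exponent 0 t \<le> (kernel_mass + 1) * (t + (LINT s:{0..t}|lborel. max_gradient s))"
proof -
  have c: "continuous_on {0..t} max_gradient" using t by (intro continuous_on_subset[OF max_gradient_continuous]) auto
  then have i: "max_gradient integrable_on {0..t}" by (rule integrable_continuous_interval)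
  have "set_integrable lborel {0..t} max_gradient" using c by (intro borel_integrable_atLeastAtMost')
  then have eq: "(LINT s:{0..t}|lborel. max_gradient s) = integral {0..t} max_gradient"
    by (rule set_borel_integral_eq_integral(2))
  have le: "rate 0 s \<le> (kernel_mass + 1) * (1 + max_gradient s)" if s: "s \<in> {0..t}" for s
  proof -
    have s': "0 \<le> s" "s < T" using s t by auto
    have "\<bar>\<omega> s x\<bar> \<le> 1 + max_gradient s" if "x \<in> quadrant" for x
      using stretched_nonneg[OF omega_stretched[OF s'] that] stretched_le_1[OF omega_stretched[OF s'] that]
        max_gradient_nonneg[OF s'] by linarith
    moreover have "norm (gradient (\<omega> s) x) \<le> 1 + max_gradient s" if "x \<in> quadrant" for x
      using gradient_le_max_gradient[OF s' that] by linarith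
    ultimately have "\<bar>rate 0 s\<bar> \<le> (1 + max_gradient s) * kernel_mass"
      by (rule rate_bounds(2)[OF s'])
    also have "\<dots> \<le> (1 + max_gradient s) * (kernel_mass + 1)"
      using max_gradient_nonneg[OF s'] by (intro mult_left_mono) auto
    finally show ?thesis by (simp add: mult.commute)
  qed
  have i1: "(\<lambda>s. 1 + max_gradient s) integrable_on {0..t}"
    using i by (intro integrable_add integrable_const_ivl)
  have "solution_exponent 0 t \<le> integral {0..t} (\<lambda>s. (kernel_mass + 1) * (1 + max_gradient s))"
    unfolding solution_exponent_def using le i1 t
    by (intro integral_le rate_interval_integrable integrable_continuous_interval continuous_intros c) auto
  moreover have "integral {0..t} (\<lambda>s. (kernel_mass + 1) * (1 + max_gradient s))
      = (kernel_mass + 1) * integral {0..t} (\<lambda>s. 1 + max_gradient s)" by simp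
  moreover have "integral {0..t} (\<lambda>s. 1 + max_gradient s) = t + integral {0..t} max_gradient"
    using integral_add[OF integrable_const_ivl i, of 1] t by simp
  ultimately show ?thesis unfolding eq by simp
qed

lemma gradient_blowup:
  assumes T: "T = blowup_time"
  shows "filterlim (\<lambda>t. LINT s:{0..t}|lborel. Linf_norm (gradient (\<omega> s))) at_top (at_left T)"
  unfolding filterlim_at_top max_gradient_def[symmetric]
proof
  fix Z :: real
  obtain t0 z where t0: "0 \<le> t0" "t0 < T" and z: "0 < z"
    and gt: "(kernel_mass + 1) * (T + Z) < exponent z t0"
    using unbounded_towards_blowup_time[of "(kernel_mass + 1) * (T + Z)"] unfolding T by blast
  have "Z \<le> (LINT s:{0..t}|lborel. max_gradient s)" if t: "t0 < t" "t < T" for t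
  proof -
    have t': "0 \<le> t" "t < T" using t t0 by auto
    have "exponent z t0 \<le> exponent z t" using z t0 t by (intro exponent_mono_time) auto
    also have "\<dots> = solution_exponent z t" using solution_exponent_eq_exponent[OF z t'] by simp
    also have "\<dots> \<le> solution_exponent 0 t" using z t' by (intro solution_exponent_le_at_axes) auto
    also have "\<dots> \<le> (kernel_mass + 1) * (t + (LINT s:{0..t}|lborel. max_gradient s))"
      using t' by (rule solution_exponent_at_axes_le)
    finally have "(kernel_mass + 1) * (T + Z) < (kernel_mass + 1) * (t + (LINT s:{0..t}|lborel. max_gradient s))"
      using gt by simp
    then have "T + Z < t + (LINT s:{0..t}|lborel. max_gradient s)"
      using kernel_mass_nonneg by (simp add: mult_less_cancel_left_pos)
    then show ?thesis using t by simp
  qed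
  then show "\<forall>\<^sub>F t in at_left T. Z \<le> (LINT s:{0..t}|lborel. max_gradient s)"
    using eventually_at_left_real[OF t0(2)] by (auto elim!: eventually_mono)
qed

end

context vortex_profile
begin

lemma maximal_existence_time_blowup_time: "maximal_existence_time \<alpha> initial_vorticity blowup_time"
  unfolding maximal_existence_time_def
proof (intro conjI allI impI)
  show "0 < blowup_time" by (rule blowup_time_pos)
  show "\<exists>\<omega>. solution \<alpha> initial_vorticity blowup_time \<omega>" using vorticity_solution by blast
  fix T assume "\<exists>\<omega>. solution \<alpha> initial_vorticity T \<omega>"
  then obtain \<omega> where "solution \<alpha> initial_vorticity T \<omega>" by blast
  then interpret vortex_solution \<alpha> c \<phi> \<phi>' \<psi> \<psi>' T \<omega> by unfold_locales
  show "T \<le> blowup_time" by (rule solution_time_le)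
qed

lemma solution_gradient_blowup:
  assumes "solution \<alpha> initial_vorticity blowup_time \<omega>"
  shows "filterlim (\<lambda>t. LINT s:{0..t}|lborel. Linf_norm (gradient (\<omega> s))) at_top (at_left blowup_time)"
proof -
  interpret vortex_solution \<alpha> c \<phi> \<phi>' \<psi> \<psi>' blowup_time \<omega> using assms by unfold_locales
  show ?thesis by (rule gradient_blowup) simp
qed

end

section \<open>A smooth admissible profile\<close>

text \<open>The bump \<open>\<phi>\<close> lives on \<open>1 \<le> s \<le> 3\<close>.  The factor \<open>\<psi>\<close> need not decay for negative arguments, as
  only its values on the quadrant enter.\<close>
definition profile_phi :: "real \<Rightarrow> real" where
  "profile_phi s = flat (s - 1) * flat (3 - s)"

definition profile_psi :: "real \<Rightarrow> real" where
  "profile_psi y = flat (1 - y)"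

abbreviation flat' :: "real \<Rightarrow> real" where "flat' \<equiv> flat_poly (flat_deriv 1)"

lemma vortex_profile_flat:
  assumes "0 < \<alpha>" "\<alpha> < 1"
  shows "vortex_profile \<alpha> ((flat (1/3))\<^sup>2) profile_phi
           (\<lambda>s. flat' (s - 1) * flat (3 - s) - flat (s - 1) * flat' (3 - s)) profile_psi (\<lambda>y. - flat' (1 - y))"
proof
  have d: "((\<lambda>s. flat_poly p (a + b * s)) has_real_derivative flat_poly (flat_deriv p) (a + b * s) * b) (at s)" for p a b s
    by (rule DERIV_chain2[OF flat_poly_has_real_derivative]) (auto intro!: derivative_eq_intros)
  show "(profile_phi has_real_derivative flat' (s - 1) * flat (3 - s) - flat (s - 1) * flat' (3 - s)) (at s)" for s
    using DERIV_mult[OF d[of 1 "-1" 1 s] d[of 1 3 "-1" s]]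
    by (simp add: profile_phi_def[abs_def] algebra_simps)
  show "(profile_psi has_real_derivative - flat' (1 - y)) (at y)" for y
    using d[of 1 1 "-1" y] by (simp add: profile_psi_def[abs_def])
  note c = continuous_on_compose2[OF flat_poly_continuous_on[of UNIV]]
  show "continuous_on UNIV (\<lambda>s. flat' (s - 1) * flat (3 - s) - flat (s - 1) * flat' (3 - s))"
    "continuous_on UNIV (\<lambda>y. - flat' (1 - y))"
    by (intro continuous_intros c; simp)+
  have third: "0 < flat (1/3)" "flat (1/3) \<le> 1" by (auto intro: flat_pos flat_le_1)
  show "0 < (flat (1/3))\<^sup>2" using third by simp
  show "(flat (1/3))\<^sup>2 \<le> profile_phi s" if "3/2 \<le> s" "s \<le> 5/2" for s
    unfolding profile_phi_def power2_eq_square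
    using that third by (intro mult_mono flat_mono flat_nonneg) auto
  show "(flat (1/3))\<^sup>2 \<le> profile_psi y" if "y \<le> 2/3" for y
  proof -
    have "(flat (1/3))\<^sup>2 \<le> flat (1/3)"
      unfolding power2_eq_square using third by (intro mult_left_le) auto
    also have "\<dots> \<le> profile_psi y" unfolding profile_psi_def using that by (intro flat_mono) auto
    finally show ?thesis .
  qed
qed (use assms in \<open>auto simp: profile_phi_def profile_psi_def flat_nonneg flat_le_1 flat_eq_0 mult_le_one\<close>)

definition vortex_bump :: "real \<times> real \<Rightarrow> real" where
  "vortex_bump x = profile_phi (fst x) * profile_psi (snd x)"

lemma vortex_bump_smooth: "smooth_quadrant vortex_bump"
  unfolding smooth_quadrant_def
proof
  fix k
  have "Ck_quadrant k (\<lambda>x. flat (- 1 + 1 * fst x + 0 * snd x) * flat (3 + (- 1) * fst x + 0 * snd x)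
      * flat (1 + 0 * fst x + (- 1) * snd x))"
    by (intro Ck_quadrant_mult Ck_quadrant_flat_poly_affine)
  then show "Ck_quadrant k vortex_bump"
    by (simp add: vortex_bump_def[abs_def] profile_phi_def profile_psi_def)
qed

lemma supp_vortex_bump: "supp vortex_bump \<subseteq> {1..3} \<times> {0..1}"
  unfolding supp_def
proof (rule closure_minimal)
  show "support_on quadrant vortex_bump \<subseteq> {1..3} \<times> {0..1}"
  proof
    fix x assume "x \<in> support_on quadrant vortex_bump"
    then have "x \<in> quadrant" "flat (fst x - 1) \<noteq> 0" "flat (3 - fst x) \<noteq> 0" "flat (1 - snd x) \<noteq> 0"
      by (auto simp: support_on_def vortex_bump_def profile_phi_def profile_psi_def)
    then show "x \<in> {1..3} \<times> {0..1}"
      using flat_eq_0[of "fst x - 1"] flat_eq_0[of "3 - fst x"] flat_eq_0[of "1 - snd x"]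
      by (force simp: quadrant_def mem_Times_iff)
  qed
qed (intro closed_Times closed_atLeastAtMost)

theorem theorem2:
  fixes \<alpha> :: real
  assumes "0 < \<alpha>" and "\<alpha> < 1"
  shows "\<exists>\<omega>0. smooth_quadrant \<omega>0 \<and> \<omega>0 \<in> C01 \<and>
           (\<exists>\<delta>>0. \<forall>x\<in>supp \<omega>0. \<delta> \<le> norm x) \<and>
           (\<exists>T. maximal_existence_time \<alpha> \<omega>0 T \<and>
             (\<forall>\<omega>. solution \<alpha> \<omega>0 T \<omega> \<longrightarrow>
               filterlim (\<lambda>t. LINT s:{0..t}|lborel. Linf_norm (gradient (\<omega> s)))
                 at_top (at_left T)))"
proof -
  interpret vortex_profile \<alpha> "(flat (1/3))\<^sup>2" profile_phi
    "\<lambda>s. flat' (s - 1) * flat (3 - s) - flat (s - 1) * flat' (3 - s)" profile_psi "\<lambda>y. - flat' (1 - y)"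
    using assms by (rule vortex_profile_flat)
  have eq: "initial_vorticity = vortex_bump"
    by (simp add: initial_vorticity_def[abs_def] vortex_bump_def[abs_def])
  have "compact ({1..3::real} \<times> {0..1::real})" by (intro compact_Times compact_Icc)
  then have "compact (supp vortex_bump)"
    using supp_vortex_bump by (auto simp: compact_eq_bounded_closed supp_def intro: bounded_subset)
  moreover have "Ck_quadrant 1 vortex_bump" using vortex_bump_smooth unfolding smooth_quadrant_def by blast
  ultimately have C01: "vortex_bump \<in> C01" by (simp add: C01_def)
  have far: "1 \<le> norm x" if "x \<in> supp vortex_bump" for x
  proof -
    have "1 \<le> fst x" using that supp_vortex_bump by auto
    then show ?thesis using norm_fst_le[of "fst x" "snd x"] by simp
  qed
  show ?thesis
  proof (intro exI[of _ vortex_bump] conjI)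
    show "\<exists>\<delta>>0. \<forall>x\<in>supp vortex_bump. \<delta> \<le> norm x"
      using far by (intro exI[of _ 1]) simp
    show "\<exists>T. maximal_existence_time \<alpha> vortex_bump T \<and>
        (\<forall>\<omega>. solution \<alpha> vortex_bump T \<omega> \<longrightarrow>
          filterlim (\<lambda>t. LINT s:{0..t}|lborel. Linf_norm (gradient (\<omega> s))) at_top (at_left T))"
      using maximal_existence_time_blowup_time solution_gradient_blowup
      unfolding eq by (intro exI[of _ blowup_time] conjI allI impI)
  qed (rule vortex_bump_smooth C01)+
qed

end
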